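(* $$\sigma_{ess}(T_1+T_2)=\{0\}\cup\left(\bigcup_{i=1}^n Essran(h_i)\right)\cup\left(\bigcup_{j=1}^m Essran(p_j)\right).$$
   Context: Let $a<b$, $c<d$ be real numbers, $\mu_1,\mu_2$ the Lebesgue measures on $[a,b]$ and $[c,d]$, and let $n,m$ be positive integers. $L_2$ spaces are complex. Let $\{\varphi_k\}_{k=1}^n$ be an orthonormal system in $L_2[a,b]$, $\{h_k\}_{k=1}^n$ essentially bounded real measurable functions on $[c,d]$, $\{\psi_j\}_{j=1}^m$ an orthonormal system in $L_2[c,d]$, and $\{p_j\}_{j=1}^m$ essentially bounded real measurable functions on $[a,b]$. Define the bounded self-adjoint operators on $L_2([a,b]\times[c,d])$ $$T_1f(x,y)=\int_a^b\sum_{k=1}^n\varphi_k(x)\overline{\varphi_k(s)}h_k(y)f(s,y)\,d\mu_1(s),\qquad T_2f(x,y)=\int_c^d\sum_{j=1}^m p_j(x)\psi_j(y)\overline{\psi_j(t)}f(x,t)\,d\mu_2(t).$$ For a real measurable function $\varphi$ on $\Omega$, $Essran(\varphi)$ is the set of all $\lambda\in\mathbb{R}$ such that $\mu(\{\xi\in\Omega:\lambda-\varepsilon<\varphi(\xi)<\lambda+\varepsilon\})>0$ for all $\varepsilon>0$, where $\mu$ is Lebesgue measure. For a self-adjoint operator, the discrete spectrum is the set of isolated points of the spectrum that are eigenvalues of finite multiplicity, and the essential spectrum $\sigma_{ess}$ is the complement of the discrete spectrum in the spectrum. *)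

theory Defs
  imports "HOL-Analysis.Analysis"
begin

text \<open>Elements of $L_2(M)$ are represented by square-integrable functions; equality in
  $L_2(M)$ is equality almost everywhere and is written out wherever it is meant.\<close>

definition L2_space :: "'a measure \<Rightarrow> ('a \<Rightarrow> complex) set" where
  "L2_space M = {f \<in> borel_measurable M. integrable M (\<lambda>x. (cmod (f x))\<^sup>2)}"

definition L2_inner :: "'a measure \<Rightarrow> ('a \<Rightarrow> complex) \<Rightarrow> ('a \<Rightarrow> complex) \<Rightarrow> complex" where
  "L2_inner M f g = (LINT x|M. f x * cnj (g x))"

definition L2_norm :: "'a measure \<Rightarrow> ('a \<Rightarrow> complex) \<Rightarrow> real" where
  "L2_norm M f = sqrt (LINT x|M. (cmod (f x))\<^sup>2)"

definition L2_orthonormal :: "'a measure \<Rightarrow> 'i set \<Rightarrow> ('i \<Rightarrow> 'a \<Rightarrow> complex) \<Rightarrow> bool" where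
  "L2_orthonormal M I e \<longleftrightarrow>
     (\<forall>i\<in>I. e i \<in> L2_space M) \<and>
     (\<forall>i\<in>I. \<forall>j\<in>I. L2_inner M (e i) (e j) = (if i = j then 1 else 0))"

definition ess_bounded_measurable :: "'a measure \<Rightarrow> ('a \<Rightarrow> real) \<Rightarrow> bool" where
  "ess_bounded_measurable M g \<longleftrightarrow>
     g \<in> borel_measurable M \<and> (\<exists>C. AE x in M. \<bar>g x\<bar> \<le> C)"

definition Essran :: "'a measure \<Rightarrow> ('a \<Rightarrow> real) \<Rightarrow> real set" where
  "Essran M g = {l. \<forall>\<epsilon>>0. emeasure M {\<xi> \<in> space M. l - \<epsilon> < g \<xi> \<and> g \<xi> < l + \<epsilon>} > 0}"

text \<open>Below, \<open>T\<close> is a linear operator on $L_2(M)$ acting on representatives: it maps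
  \<open>L2_space M\<close> to itself and respects equality almost everywhere. The resolvent set
  consists of the \<open>z\<close> for which $T - z$ is injective and surjective on $L_2(M)$ with
  bounded inverse.\<close>

definition L2_resolvent_set ::
    "'a measure \<Rightarrow> (('a \<Rightarrow> complex) \<Rightarrow> 'a \<Rightarrow> complex) \<Rightarrow> complex set" where
  "L2_resolvent_set M T = {z.
     (\<forall>f\<in>L2_space M. (AE x in M. T f x - z * f x = 0) \<longrightarrow> (AE x in M. f x = 0)) \<and>
     (\<forall>g\<in>L2_space M. \<exists>f\<in>L2_space M. AE x in M. T f x - z * f x = g x) \<and>
     (\<exists>C. \<forall>f\<in>L2_space M. L2_norm M f \<le> C * L2_norm M (\<lambda>x. T f x - z * f x))}"

definition L2_spectrum ::
    "'a measure \<Rightarrow> (('a \<Rightarrow> complex) \<Rightarrow> 'a \<Rightarrow> complex) \<Rightarrow> complex set" where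
  "L2_spectrum M T = - L2_resolvent_set M T"

definition L2_eigenspace ::
    "'a measure \<Rightarrow> (('a \<Rightarrow> complex) \<Rightarrow> 'a \<Rightarrow> complex) \<Rightarrow> complex \<Rightarrow> ('a \<Rightarrow> complex) set" where
  "L2_eigenspace M T z = {f \<in> L2_space M. AE x in M. T f x = z * f x}"

definition L2_eigenvalue ::
    "'a measure \<Rightarrow> (('a \<Rightarrow> complex) \<Rightarrow> 'a \<Rightarrow> complex) \<Rightarrow> complex \<Rightarrow> bool" where
  "L2_eigenvalue M T z \<longleftrightarrow> (\<exists>f\<in>L2_eigenspace M T z. \<not> (AE x in M. f x = 0))"

definition L2_finite_dim :: "'a measure \<Rightarrow> ('a \<Rightarrow> complex) set \<Rightarrow> bool" where
  "L2_finite_dim M E \<longleftrightarrow>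
     (\<exists>B. finite B \<and> B \<subseteq> E \<and> (\<forall>f\<in>E. \<exists>c. AE x in M. f x = (\<Sum>b\<in>B. c b * b x)))"

definition L2_discrete_spectrum ::
    "'a measure \<Rightarrow> (('a \<Rightarrow> complex) \<Rightarrow> 'a \<Rightarrow> complex) \<Rightarrow> complex set" where
  "L2_discrete_spectrum M T =
     {z. z isolated_in L2_spectrum M T \<and> L2_eigenvalue M T z \<and>
         L2_finite_dim M (L2_eigenspace M T z)}"

definition L2_essential_spectrum ::
    "'a measure \<Rightarrow> (('a \<Rightarrow> complex) \<Rightarrow> 'a \<Rightarrow> complex) \<Rightarrow> complex set" where
  "L2_essential_spectrum M T = L2_spectrum M T - L2_discrete_spectrum M T"

text \<open>For \<open>f\<close> in $L_2$ of the rectangle, the integrals below exist for almost every \<open>y\<close>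
  (respectively \<open>x\<close>); on the exceptional null set the Bochner integral takes a default
  value, which does not affect the class of the result.\<close>

definition partial_int_op1 ::
    "real \<Rightarrow> real \<Rightarrow> nat \<Rightarrow> (nat \<Rightarrow> real \<Rightarrow> complex) \<Rightarrow> (nat \<Rightarrow> real \<Rightarrow> real) \<Rightarrow>
     (real \<times> real \<Rightarrow> complex) \<Rightarrow> real \<times> real \<Rightarrow> complex" where
  "partial_int_op1 a b n \<phi> h f = (\<lambda>(x, y).
     LINT s|lebesgue_on {a..b}.
       (\<Sum>k = 1..n. \<phi> k x * cnj (\<phi> k s) * complex_of_real (h k y)) * f (s, y))"

definition partial_int_op2 ::
    "real \<Rightarrow> real \<Rightarrow> nat \<Rightarrow> (nat \<Rightarrow> real \<Rightarrow> real) \<Rightarrow> (nat \<Rightarrow> real \<Rightarrow> complex) \<Rightarrow>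
     (real \<times> real \<Rightarrow> complex) \<Rightarrow> real \<times> real \<Rightarrow> complex" where
  "partial_int_op2 c d m p \<psi> f = (\<lambda>(x, y).
     LINT t|lebesgue_on {c..d}.
       (\<Sum>j = 1..m. complex_of_real (p j x) * \<psi> j y * cnj (\<psi> j t)) * f (x, t))"

end

theory Submission
  imports Defs
begin

text \<open>
  Write \<open>T\<^sub>1\<close> and \<open>T\<^sub>2\<close> for the two partial integral operators. On the subspace of functions
  \<open>\<phi>\<^sub>k(x) g(y)\<close> the operator \<open>T\<^sub>1\<close> multiplies \<open>g\<close> by \<open>h\<^sub>k\<close>, and it vanishes on the orthogonal
  complement of these subspaces; likewise \<open>T\<^sub>2\<close> with \<open>g(x) \<psi>\<^sub>j(y)\<close> and \<open>p\<^sub>j\<close>. Each operator alone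
  therefore has an explicit resolvent, and \<open>T\<^sub>1 T\<^sub>2\<close> has finite rank.

  \<^emph>\<open>Upper bound.\<close> Let \<open>z \<noteq> 0\<close> lie outside all essential ranges. Then \<open>T\<^sub>1 - z\<close> and \<open>T\<^sub>2 - z\<close> have
  bounded inverses, and \<open>(T\<^sub>1 - z) (T\<^sub>2 - z) = T\<^sub>1 T\<^sub>2 - z (T\<^sub>1 + T\<^sub>2 - z)\<close> shows that \<open>T\<^sub>1 + T\<^sub>2 - z\<close> is
  invertible up to finite rank (\<open>L2_parametrix_sum_if_finite_rank_product\<close>). The Fredholm
  alternative then makes such a \<open>z\<close> either a resolvent point or an eigenvalue of finite
  multiplicity. These eigenvalues are isolated: the operator is symmetric, so eigenvectors for
  distinct eigenvalues are orthogonal, and too many eigenvalues near \<open>z\<close> would contradict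
  invertibility up to finite rank (\<open>spectrum_discrete_if_parametrix\<close>).

  \<^emph>\<open>Lower bound.\<close> If \<open>g\<close> is orthogonal to all \<open>\<psi>\<^sub>j\<close>, then \<open>T\<^sub>2\<close> kills \<open>\<phi>\<^sub>k(x) g(y)\<close>, so \<open>T\<^sub>1 + T\<^sub>2\<close>
  acts on this vector as multiplication by \<open>h\<^sub>k(y)\<close>. Such \<open>g\<close> exist with support in any given set
  of positive measure, and orthogonal to finitely many further functions. This puts the essential
  range of \<open>h\<^sub>k\<close> into the spectrum. A point of it that is isolated in the spectrum is
  isolated in the essential range, so \<open>h\<^sub>k\<close> takes this value on a set of positive measure and the
  eigenspace is infinite-dimensional (\<open>Essran_subset_essential_spectrum\<close>). Vectors \<open>u(x) v(y)\<close> with \<open>u\<close> orthogonal to all \<open>\<phi>\<^sub>k\<close> and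
  \<open>v\<close> to all \<open>\<psi>\<^sub>j\<close> give an infinite-dimensional kernel, hence the point \<open>0\<close>.

  The argument is carried out for two finite measures; the spaces of the theorem arise by
  completion. The results for \<open>T\<^sub>2\<close> follow from those for \<open>T\<^sub>1\<close> by exchanging the factors.
\<close>

section \<open>The semi-inner product space of square-integrable functions\<close>

lemma L2_spaceD:
  assumes "f \<in> L2_space M"
  shows "f \<in> borel_measurable M" "integrable M (\<lambda>x. (cmod (f x))\<^sup>2)"
  using assms by (auto simp: L2_space_def)

lemma L2_space_bounded_mult:
  assumes f: "f \<in> L2_space M" and q: "q \<in> borel_measurable M" "AE x in M. cmod (q x) \<le> C"
  shows "(\<lambda>x. q x * f x) \<in> L2_space M"
proof -
  have "integrable M (\<lambda>x. (cmod (q x * f x))\<^sup>2)"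
  proof (rule Bochner_Integration.integrable_bound)
    show "integrable M (\<lambda>x. C\<^sup>2 * (cmod (f x))\<^sup>2)"
      using L2_spaceD[OF f] by simp
    show "(\<lambda>x. (cmod (q x * f x))\<^sup>2) \<in> borel_measurable M"
      using L2_spaceD[OF f] q(1) by measurable
    show "AE x in M. norm ((cmod (q x * f x))\<^sup>2) \<le> norm (C\<^sup>2 * (cmod (f x))\<^sup>2)"
      using q(2) by eventually_elim (auto simp: norm_mult power_mult_distrib intro!: mult_right_mono power_mono)
  qed
  then show ?thesis
    using L2_spaceD[OF f] q(1) by (auto simp: L2_space_def)
qed

lemma L2_space_scale: "f \<in> L2_space M \<Longrightarrow> (\<lambda>x. c * f x) \<in> L2_space M"
  by (rule L2_space_bounded_mult[where C = "cmod c"]) auto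

lemma cmod_add_square_le: "(cmod (a + b))\<^sup>2 \<le> 2 * (cmod a)\<^sup>2 + 2 * (cmod b)\<^sup>2"
proof -
  have "(cmod (a + b))\<^sup>2 \<le> (cmod a + cmod b)\<^sup>2"
    by (intro power_mono norm_triangle_ineq) auto
  also have "\<dots> \<le> 2 * (cmod a)\<^sup>2 + 2 * (cmod b)\<^sup>2"
    using sum_squares_bound[of "cmod a" "cmod b"] by (simp add: power2_sum)
  finally show ?thesis .
qed

lemma L2_space_add:
  assumes f: "f \<in> L2_space M" and g: "g \<in> L2_space M"
  shows "(\<lambda>x. f x + g x) \<in> L2_space M"
proof -
  have "integrable M (\<lambda>x. (cmod (f x + g x))\<^sup>2)"
  proof (rule Bochner_Integration.integrable_bound)
    show "integrable M (\<lambda>x. 2 * (cmod (f x))\<^sup>2 + 2 * (cmod (g x))\<^sup>2)"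
      using L2_spaceD[OF f] L2_spaceD[OF g] by simp
    show "(\<lambda>x. (cmod (f x + g x))\<^sup>2) \<in> borel_measurable M"
      using L2_spaceD[OF f] L2_spaceD[OF g] by measurable
  qed (use cmod_add_square_le in auto)
  then show ?thesis
    using L2_spaceD[OF f] L2_spaceD[OF g] by (auto simp: L2_space_def)
qed

lemma L2_space_zero: "(\<lambda>x. 0) \<in> L2_space M"
  by (auto simp: L2_space_def)

lemma L2_space_diff: "f \<in> L2_space M \<Longrightarrow> g \<in> L2_space M \<Longrightarrow> (\<lambda>x. f x - g x) \<in> L2_space M"
  using L2_space_add[OF _ L2_space_scale[of g M "-1"], of f] by simp

lemma L2_space_sum:
  "(\<And>i. i \<in> I \<Longrightarrow> f i \<in> L2_space M) \<Longrightarrow> (\<lambda>x. \<Sum>i\<in>I. f i x) \<in> L2_space M"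
  by (induction I rule: infinite_finite_induct) (auto simp: L2_space_zero intro: L2_space_add)

lemmas L2_space_closed =
  L2_space_zero L2_space_scale L2_space_add L2_space_diff L2_space_sum

lemma borel_measurable_cnj [measurable]:
  "f \<in> borel_measurable M \<Longrightarrow> (\<lambda>x. cnj (f x)) \<in> borel_measurable M"
  by (rule measurable_compose[OF _ borel_measurable_continuous_onI[OF continuous_on_cnj[OF continuous_on_id]]])

lemma L2_product_integrable:
  assumes f: "f \<in> L2_space M" and g: "g \<in> L2_space M"
  shows "integrable M (\<lambda>x. f x * cnj (g x))"
proof (rule Bochner_Integration.integrable_bound)
  show "integrable M (\<lambda>x. (cmod (f x))\<^sup>2 + (cmod (g x))\<^sup>2)"
    using L2_spaceD[OF f] L2_spaceD[OF g] by simp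
  show "(\<lambda>x. f x * cnj (g x)) \<in> borel_measurable M"
    using L2_spaceD[OF f] L2_spaceD[OF g] by measurable
  have "cmod a * cmod b \<le> (cmod a)\<^sup>2 + (cmod b)\<^sup>2" for a b
    using sum_squares_bound[of "cmod a" "cmod b"] mult_nonneg_nonneg[OF norm_ge_zero norm_ge_zero, of a b]
    by linarith
  then show "AE x in M. norm (f x * cnj (g x)) \<le> norm ((cmod (f x))\<^sup>2 + (cmod (g x))\<^sup>2)"
    by (auto simp: norm_mult)
qed

lemma L2_inner_add_left:
  "f \<in> L2_space M \<Longrightarrow> g \<in> L2_space M \<Longrightarrow> w \<in> L2_space M \<Longrightarrow>
    L2_inner M (\<lambda>x. f x + g x) w = L2_inner M f w + L2_inner M g w"
  unfolding L2_inner_def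
  by (subst Bochner_Integration.integral_add[symmetric])
     (auto intro: L2_product_integrable simp: distrib_right)

lemma L2_inner_scale_left: "L2_inner M (\<lambda>x. c * f x) w = c * L2_inner M f w"
  unfolding L2_inner_def by (simp add: mult.assoc)

lemma L2_inner_zero_left: "L2_inner M (\<lambda>x. 0) w = 0"
  unfolding L2_inner_def by simp

lemma L2_inner_cnj: "cnj (L2_inner M f g) = L2_inner M g f"
  unfolding L2_inner_def Bochner_Integration.integral_cnj[symmetric] by (simp add: mult.commute)

lemma L2_inner_diff_left:
  "f \<in> L2_space M \<Longrightarrow> g \<in> L2_space M \<Longrightarrow> w \<in> L2_space M \<Longrightarrow>
    L2_inner M (\<lambda>x. f x - g x) w = L2_inner M f w - L2_inner M g w"
  using L2_inner_add_left[OF _ L2_space_scale[of g M "-1"], of f w]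
  by (simp add: L2_inner_scale_left[of M "-1" g w, simplified])

lemma L2_inner_sum_left:
  assumes "\<And>i. i \<in> I \<Longrightarrow> f i \<in> L2_space M" "w \<in> L2_space M"
  shows "L2_inner M (\<lambda>x. \<Sum>i\<in>I. f i x) w = (\<Sum>i\<in>I. L2_inner M (f i) w)"
  using assms
  by (induction I rule: infinite_finite_induct)
     (auto simp: L2_inner_zero_left L2_inner_add_left L2_space_sum)

lemma L2_inner_scale_right: "L2_inner M f (\<lambda>x. c * w x) = cnj c * L2_inner M f w"
  by (subst (1 2) L2_inner_cnj[symmetric]) (simp add: L2_inner_scale_left)

lemma L2_inner_add_right:
  "f \<in> L2_space M \<Longrightarrow> g \<in> L2_space M \<Longrightarrow> w \<in> L2_space M \<Longrightarrow>
    L2_inner M w (\<lambda>x. f x + g x) = L2_inner M w f + L2_inner M w g"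
  by (subst (1 2 3) L2_inner_cnj[symmetric]) (simp add: L2_inner_add_left)

lemma L2_inner_diff_right:
  "f \<in> L2_space M \<Longrightarrow> g \<in> L2_space M \<Longrightarrow> w \<in> L2_space M \<Longrightarrow>
    L2_inner M w (\<lambda>x. f x - g x) = L2_inner M w f - L2_inner M w g"
  by (subst (1 2 3) L2_inner_cnj[symmetric]) (simp add: L2_inner_diff_left)

lemma L2_inner_sum_right:
  assumes "\<And>i. i \<in> I \<Longrightarrow> f i \<in> L2_space M" "w \<in> L2_space M"
  shows "L2_inner M w (\<lambda>x. \<Sum>i\<in>I. f i x) = (\<Sum>i\<in>I. L2_inner M w (f i))"
  by (subst (1 2) L2_inner_cnj[symmetric]) (use assms in \<open>simp add: L2_inner_sum_left\<close>)

lemma L2_norm_nonneg: "0 \<le> L2_norm M f"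
  by (simp add: L2_norm_def)

lemma L2_norm_square: "(L2_norm M f)\<^sup>2 = (LINT x|M. (cmod (f x))\<^sup>2)"
  by (simp add: L2_norm_def)

lemma L2_inner_self: "L2_inner M f f = complex_of_real ((L2_norm M f)\<^sup>2)"
  unfolding L2_norm_square L2_inner_def
  by (simp flip: complex_norm_square integral_complex_of_real)

lemma L2_norm_scale: "L2_norm M (\<lambda>x. c * f x) = cmod c * L2_norm M f"
  unfolding L2_norm_def by (simp add: norm_mult power_mult_distrib real_sqrt_mult)

definition L2_eq :: "'a measure \<Rightarrow> ('a \<Rightarrow> complex) \<Rightarrow> ('a \<Rightarrow> complex) \<Rightarrow> bool" where
  "L2_eq M f g \<longleftrightarrow> (AE x in M. f x = g x)"

lemma L2_eq_refl: "L2_eq M f f"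
  by (simp add: L2_eq_def)

lemma L2_eq_sym: "L2_eq M f g \<Longrightarrow> L2_eq M g f"
  by (auto simp: L2_eq_def)

lemma L2_eq_trans [trans]: "L2_eq M f g \<Longrightarrow> L2_eq M g w \<Longrightarrow> L2_eq M f w"
  unfolding L2_eq_def by (auto elim: eventually_elim2)

lemma L2_eq_add: "L2_eq M f g \<Longrightarrow> L2_eq M f' g' \<Longrightarrow> L2_eq M (\<lambda>x. f x + f' x) (\<lambda>x. g x + g' x)"
  unfolding L2_eq_def by (auto elim: eventually_elim2)

lemma L2_eq_diff: "L2_eq M f g \<Longrightarrow> L2_eq M f' g' \<Longrightarrow> L2_eq M (\<lambda>x. f x - f' x) (\<lambda>x. g x - g' x)"
  unfolding L2_eq_def by (auto elim: eventually_elim2)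

lemma L2_eq_mult: "L2_eq M f g \<Longrightarrow> L2_eq M (\<lambda>x. q x * f x) (\<lambda>x. q x * g x)"
  unfolding L2_eq_def by (auto elim: eventually_mono)

lemma L2_eq_sum:
  assumes "\<And>i. i \<in> I \<Longrightarrow> L2_eq M (f i) (g i)"
  shows "L2_eq M (\<lambda>x. \<Sum>i\<in>I. f i x) (\<lambda>x. \<Sum>i\<in>I. g i x)"
  using assms by (induction I rule: infinite_finite_induct) (auto simp: L2_eq_refl L2_eq_add)

lemma L2_inner_cong_left:
  assumes "L2_eq M f g" "f \<in> L2_space M" "g \<in> L2_space M" "w \<in> L2_space M"
  shows "L2_inner M f w = L2_inner M g w"
  unfolding L2_inner_def
proof (rule integral_cong_AE)
  show "AE x in M. f x * cnj (w x) = g x * cnj (w x)"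
    using assms(1) unfolding L2_eq_def by eventually_elim simp
qed (use assms in \<open>auto dest!: L2_spaceD(1)\<close>)

lemma L2_inner_cong_right:
  "L2_eq M f g \<Longrightarrow> f \<in> L2_space M \<Longrightarrow> g \<in> L2_space M \<Longrightarrow> w \<in> L2_space M \<Longrightarrow>
    L2_inner M w f = L2_inner M w g"
  by (subst (1 2) L2_inner_cnj[symmetric]) (simp add: L2_inner_cong_left)

lemma L2_norm_cong:
  assumes "L2_eq M f g" "f \<in> L2_space M" "g \<in> L2_space M"
  shows "L2_norm M f = L2_norm M g"
  unfolding L2_norm_def
proof (rule arg_cong[where f = sqrt], rule integral_cong_AE)
  show "AE x in M. (cmod (f x))\<^sup>2 = (cmod (g x))\<^sup>2"
    using assms(1) unfolding L2_eq_def by eventually_elim simp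
qed (use assms in \<open>auto dest!: L2_spaceD(1)\<close>)

lemma L2_norm_eq_0_iff:
  assumes "f \<in> L2_space M"
  shows "L2_norm M f = 0 \<longleftrightarrow> L2_eq M f (\<lambda>x. 0)"
  unfolding L2_norm_def L2_eq_def
  using integral_nonneg_eq_0_iff_AE[of M "\<lambda>x. (cmod (f x))\<^sup>2"] L2_spaceD[OF assms] by simp

lemma L2_Cauchy_Schwarz:
  assumes f: "f \<in> L2_space M" and g: "g \<in> L2_space M"
  shows "cmod (L2_inner M f g) \<le> L2_norm M f * L2_norm M g"
proof (cases "L2_norm M g = 0")
  case True
  then have "L2_inner M f g = L2_inner M f (\<lambda>x. 0)"
    using f g by (intro L2_inner_cong_right) (auto simp: L2_norm_eq_0_iff L2_space_zero)
  also have "\<dots> = 0"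
    using L2_inner_cnj[of M "\<lambda>x. 0" f] by (simp add: L2_inner_zero_left)
  finally show ?thesis
    by (simp add: True)
next
  case False
  \<comment> \<open>\<open>c * g\<close> is the orthogonal projection of \<open>f\<close> onto the line spanned by \<open>g\<close>.\<close>
  define c where "c = L2_inner M f g / complex_of_real ((L2_norm M g)\<^sup>2)"
  define N where "N = L2_norm M (\<lambda>x. f x - c * g x)"
  have "complex_of_real (N\<^sup>2) = L2_inner M (\<lambda>x. f x - c * g x) (\<lambda>x. f x - c * g x)"
    by (simp add: L2_inner_self N_def)
  also have "\<dots> = complex_of_real ((L2_norm M f)\<^sup>2) - cnj c * L2_inner M f g
      - c * cnj (L2_inner M f g) + c * cnj c * complex_of_real ((L2_norm M g)\<^sup>2)"
    using f g by (simp add: L2_inner_diff_left L2_inner_diff_right L2_inner_scale_left L2_inner_cnj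
        L2_inner_scale_right L2_space_closed algebra_simps flip: L2_inner_self del: of_real_power)
  also have "\<dots> = complex_of_real ((L2_norm M f)\<^sup>2 - (cmod (L2_inner M f g))\<^sup>2 / (L2_norm M g)\<^sup>2)"
    using False by (simp add: c_def field_simps power2_eq_square flip: complex_norm_square[unfolded power2_eq_square])
  finally have "0 \<le> (L2_norm M f)\<^sup>2 - (cmod (L2_inner M f g))\<^sup>2 / (L2_norm M g)\<^sup>2"
    by (metis of_real_eq_iff zero_le_power2)
  then have "(cmod (L2_inner M f g))\<^sup>2 \<le> (L2_norm M f * L2_norm M g)\<^sup>2"
    using False by (simp add: field_simps power_mult_distrib)
  then show ?thesis
    by (rule power2_le_imp_le) (simp add: L2_norm_nonneg)
qed

lemma L2_norm_triangle:
  assumes f: "f \<in> L2_space M" and g: "g \<in> L2_space M"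
  shows "L2_norm M (\<lambda>x. f x + g x) \<le> L2_norm M f + L2_norm M g"
proof -
  have "complex_of_real ((L2_norm M (\<lambda>x. f x + g x))\<^sup>2) =
      complex_of_real ((L2_norm M f)\<^sup>2) + (L2_inner M f g + cnj (L2_inner M f g))
        + complex_of_real ((L2_norm M g)\<^sup>2)"
    unfolding L2_inner_cnj using f g
    by (simp flip: L2_inner_self add: L2_inner_add_left L2_inner_add_right L2_space_closed
        del: of_real_power)
  also have "\<dots> = complex_of_real ((L2_norm M f)\<^sup>2 + 2 * Re (L2_inner M f g) + (L2_norm M g)\<^sup>2)"
    by (simp add: complex_add_cnj)
  finally have "(L2_norm M (\<lambda>x. f x + g x))\<^sup>2 =
      (L2_norm M f)\<^sup>2 + 2 * Re (L2_inner M f g) + (L2_norm M g)\<^sup>2"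
    by (simp only: of_real_eq_iff)
  also have "Re (L2_inner M f g) \<le> L2_norm M f * L2_norm M g"
    using L2_Cauchy_Schwarz[OF f g] complex_Re_le_cmod order_trans by blast
  finally have "(L2_norm M (\<lambda>x. f x + g x))\<^sup>2 \<le> (L2_norm M f + L2_norm M g)\<^sup>2"
    by (simp add: power2_sum)
  then show ?thesis
    by (rule power2_le_imp_le) (simp add: L2_norm_nonneg)
qed

lemma L2_norm_diff_triangle:
  assumes "f \<in> L2_space M" "g \<in> L2_space M"
  shows "L2_norm M (\<lambda>x. f x - g x) \<le> L2_norm M f + L2_norm M g"
  using L2_norm_triangle[OF assms(1) L2_space_scale[OF assms(2), of "-1"]]
    L2_norm_scale[of M "-1" g] by simp

lemma L2_norm_sum:
  assumes "\<And>i. i \<in> I \<Longrightarrow> f i \<in> L2_space M"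
  shows "L2_norm M (\<lambda>x. \<Sum>i\<in>I. f i x) \<le> (\<Sum>i\<in>I. L2_norm M (f i))"
  using assms
proof (induction I rule: infinite_finite_induct)
  case (insert i I)
  have "L2_norm M (\<lambda>x. \<Sum>j\<in>insert i I. f j x) \<le> L2_norm M (f i) + L2_norm M (\<lambda>x. \<Sum>j\<in>I. f j x)"
    using insert by (simp add: L2_norm_triangle L2_space_sum)
  then show ?case
    using insert by fastforce
qed (simp_all add: L2_norm_def)

text \<open>Almost-everywhere identities between operators are obtained below by pairing both sides
  with an arbitrary vector, which replaces bookkeeping of exceptional null sets.\<close>

lemma L2_eq_if_inner_eq:
  assumes f: "f \<in> L2_space M" and g: "g \<in> L2_space M"
    and eq: "\<And>w. w \<in> L2_space M \<Longrightarrow> L2_inner M f w = L2_inner M g w"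
  shows "L2_eq M f g"
proof -
  let ?d = "\<lambda>x. f x - g x"
  have d: "?d \<in> L2_space M"
    by (simp add: f g L2_space_diff)
  then have "L2_inner M ?d ?d = 0"
    using f g eq by (simp add: L2_inner_diff_left)
  then have "L2_norm M ?d = 0"
    by (simp add: L2_inner_self)
  then have "L2_eq M ?d (\<lambda>x. 0)"
    using d by (simp add: L2_norm_eq_0_iff)
  then show ?thesis
    by (simp add: L2_eq_def)
qed

lemma L2_norm_mono:
  assumes f: "f \<in> L2_space M" and g: "g \<in> L2_space M" and C: "0 \<le> C"
    and le: "AE x in M. cmod (g x) \<le> C * cmod (f x)"
  shows "L2_norm M g \<le> C * L2_norm M f"
proof -
  have "(L2_norm M g)\<^sup>2 \<le> (LINT x|M. C\<^sup>2 * (cmod (f x))\<^sup>2)"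
    unfolding L2_norm_square
  proof (rule integral_mono_AE)
    show "AE x in M. (cmod (g x))\<^sup>2 \<le> C\<^sup>2 * (cmod (f x))\<^sup>2"
      using le by eventually_elim (metis power_mono norm_ge_zero power_mult_distrib)
  qed (use L2_spaceD(2)[OF f] L2_spaceD(2)[OF g] in auto)
  also have "\<dots> = (C * L2_norm M f)\<^sup>2"
    by (simp add: power_mult_distrib L2_norm_square)
  finally show ?thesis
    by (rule power2_le_imp_le) (simp add: C L2_norm_nonneg)
qed

lemma L2_norm_bounded_mult:
  assumes f: "f \<in> L2_space M" and q: "q \<in> borel_measurable M" "AE x in M. cmod (q x) \<le> C"
    and C: "0 \<le> C"
  shows "L2_norm M (\<lambda>x. q x * f x) \<le> C * L2_norm M f"
proof (rule L2_norm_mono[OF f L2_space_bounded_mult[OF f q] C])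
  show "AE x in M. cmod (q x * f x) \<le> C * cmod (f x)"
    using q(2) by eventually_elim (simp add: norm_mult mult_right_mono)
qed

lemma L2_eq_imp_space:
  assumes "L2_eq M f g" "g \<in> L2_space M" "f \<in> borel_measurable M"
  shows "f \<in> L2_space M"
proof -
  have "AE x in M. (cmod (g x))\<^sup>2 = (cmod (f x))\<^sup>2"
    using assms(1) unfolding L2_eq_def by eventually_elim simp
  then have "integrable M (\<lambda>x. (cmod (f x))\<^sup>2)"
    using L2_spaceD[OF assms(2)] assms(3) by (subst integrable_cong_AE[of _ _ "\<lambda>x. (cmod (g x))\<^sup>2"]) auto
  then show ?thesis
    using assms(3) by (simp add: L2_space_def)
qed

section \<open>Bounded operators on representatives\<close>

text \<open>Linearity is required almost everywhere only, because the partial integral operators take default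
  values on exceptional null sets. Boundedness makes such a map respect equality almost everywhere.\<close>

definition L2_op :: "'a measure \<Rightarrow> (('a \<Rightarrow> complex) \<Rightarrow> 'a \<Rightarrow> complex) \<Rightarrow> bool" where
  "L2_op M T \<longleftrightarrow>
     (\<forall>f\<in>L2_space M. T f \<in> L2_space M) \<and>
     (\<forall>f\<in>L2_space M. \<forall>g\<in>L2_space M. \<forall>c.
        L2_eq M (T (\<lambda>x. c * f x + g x)) (\<lambda>x. c * T f x + T g x)) \<and>
     (\<exists>C\<ge>0. \<forall>f\<in>L2_space M. L2_norm M (T f) \<le> C * L2_norm M f)"

lemma L2_op_space: "L2_op M T \<Longrightarrow> f \<in> L2_space M \<Longrightarrow> T f \<in> L2_space M"
  by (auto simp: L2_op_def)

lemma L2_op_linear: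
  "L2_op M T \<Longrightarrow> f \<in> L2_space M \<Longrightarrow> g \<in> L2_space M \<Longrightarrow>
    L2_eq M (T (\<lambda>x. c * f x + g x)) (\<lambda>x. c * T f x + T g x)"
  by (auto simp: L2_op_def)

lemma L2_op_bound:
  assumes "L2_op M T"
  obtains C where "0 \<le> C" "\<And>f. f \<in> L2_space M \<Longrightarrow> L2_norm M (T f) \<le> C * L2_norm M f"
  using assms by (auto simp: L2_op_def)

lemma L2_op_null:
  assumes "L2_op M T" "f \<in> L2_space M" "L2_eq M f (\<lambda>x. 0)"
  shows "L2_eq M (T f) (\<lambda>x. 0)"
proof -
  obtain C where "L2_norm M (T f) \<le> C * L2_norm M f"
    using L2_op_bound[OF assms(1)] assms(2) by metis
  then have "L2_norm M (T f) = 0"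
    using assms L2_norm_eq_0_iff[OF assms(2)] L2_norm_nonneg[of M "T f"] by simp
  then show ?thesis
    using L2_norm_eq_0_iff[OF L2_op_space[OF assms(1,2)]] by simp
qed

lemma L2_op_diff:
  assumes "L2_op M T" "f \<in> L2_space M" "g \<in> L2_space M"
  shows "L2_eq M (T (\<lambda>x. f x - g x)) (\<lambda>x. T f x - T g x)"
  using L2_op_linear[OF assms(1,3,2), of "-1"] by simp

lemma L2_op_cong:
  assumes "L2_op M T" "f \<in> L2_space M" "g \<in> L2_space M" "L2_eq M f g"
  shows "L2_eq M (T f) (T g)"
proof -
  have "L2_eq M (\<lambda>x. f x - g x) (\<lambda>x. 0)"
    using assms(4) by (simp add: L2_eq_def)
  then have "L2_eq M (T (\<lambda>x. f x - g x)) (\<lambda>x. 0)"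
    by (rule L2_op_null[OF assms(1) L2_space_diff[OF assms(2,3)]])
  then have "L2_eq M (\<lambda>x. T f x - T g x) (\<lambda>x. 0)"
    using L2_op_diff[OF assms(1-3)] L2_eq_sym L2_eq_trans by blast
  then show ?thesis
    by (simp add: L2_eq_def)
qed

lemma L2_op_add:
  assumes "L2_op M T" "f \<in> L2_space M" "g \<in> L2_space M"
  shows "L2_eq M (T (\<lambda>x. f x + g x)) (\<lambda>x. T f x + T g x)"
  using L2_op_linear[OF assms, of 1] by simp

lemma L2_op_zero:
  assumes "L2_op M T" shows "L2_eq M (T (\<lambda>x. 0)) (\<lambda>x. 0)"
  by (rule L2_op_null[OF assms L2_space_zero L2_eq_refl])

lemma L2_op_scale:
  assumes "L2_op M T" "f \<in> L2_space M"
  shows "L2_eq M (T (\<lambda>x. c * f x)) (\<lambda>x. c * T f x)"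
proof -
  have "L2_eq M (T (\<lambda>x. c * f x + 0)) (\<lambda>x. c * T f x + T (\<lambda>x. 0) x)"
    by (rule L2_op_linear[OF assms L2_space_zero])
  also have "L2_eq M (\<lambda>x. c * T f x + T (\<lambda>x. 0) x) (\<lambda>x. c * T f x + 0)"
    by (rule L2_eq_add[OF L2_eq_refl L2_op_zero[OF assms(1)]])
  finally show ?thesis by simp
qed

lemma L2_op_sum:
  assumes "L2_op M T" "\<And>i. i \<in> I \<Longrightarrow> f i \<in> L2_space M"
  shows "L2_eq M (T (\<lambda>x. \<Sum>i\<in>I. f i x)) (\<lambda>x. \<Sum>i\<in>I. T (f i) x)"
  using assms(2)
proof (induction I rule: infinite_finite_induct)
  case (insert i I)
  have "L2_eq M (T (\<lambda>x. f i x + (\<Sum>i\<in>I. f i x))) (\<lambda>x. T (f i) x + T (\<lambda>x. \<Sum>i\<in>I. f i x) x)"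
    using insert by (intro L2_op_add[OF assms(1)] L2_space_sum) auto
  also have "L2_eq M (\<lambda>x. T (f i) x + T (\<lambda>x. \<Sum>i\<in>I. f i x) x) (\<lambda>x. T (f i) x + (\<Sum>i\<in>I. T (f i) x))"
    using insert by (intro L2_eq_add L2_eq_refl) auto
  finally show ?case
    using insert by simp
qed (simp_all add: L2_op_zero assms)

lemma L2_op_lincomb:
  assumes T: "L2_op M T" and S: "L2_op M S"
  shows "L2_op M (\<lambda>f x. \<alpha> * T f x + \<beta> * S f x)"
  unfolding L2_op_def
proof (intro conjI ballI allI)
  show "(\<lambda>x. \<alpha> * T f x + \<beta> * S f x) \<in> L2_space M" if "f \<in> L2_space M" for f
    using that by (intro L2_space_closed L2_op_space[OF T] L2_op_space[OF S])
  show "L2_eq M (\<lambda>x. \<alpha> * T (\<lambda>x. c * f x + g x) x + \<beta> * S (\<lambda>x. c * f x + g x) x)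
      (\<lambda>x. c * (\<alpha> * T f x + \<beta> * S f x) + (\<alpha> * T g x + \<beta> * S g x))"
    if "f \<in> L2_space M" "g \<in> L2_space M" for f g c
    using L2_op_linear[OF T that, of c] L2_op_linear[OF S that, of c] unfolding L2_eq_def
    by eventually_elim (simp add: algebra_simps)
  obtain C D where C: "0 \<le> C" "\<And>f. f \<in> L2_space M \<Longrightarrow> L2_norm M (T f) \<le> C * L2_norm M f"
    and D: "0 \<le> D" "\<And>f. f \<in> L2_space M \<Longrightarrow> L2_norm M (S f) \<le> D * L2_norm M f"
    using L2_op_bound[OF T] L2_op_bound[OF S] by metis
  show "\<exists>C\<ge>0. \<forall>f\<in>L2_space M. L2_norm M (\<lambda>x. \<alpha> * T f x + \<beta> * S f x) \<le> C * L2_norm M f"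
  proof (intro exI[of _ "cmod \<alpha> * C + cmod \<beta> * D"] conjI ballI)
    fix f assume f: "f \<in> L2_space M"
    have "L2_norm M (\<lambda>x. \<alpha> * T f x + \<beta> * S f x) \<le> cmod \<alpha> * L2_norm M (T f) + cmod \<beta> * L2_norm M (S f)"
      using f L2_norm_triangle[OF L2_space_scale L2_space_scale] L2_op_space[OF T f] L2_op_space[OF S f]
      by (metis L2_norm_scale)
    also have "\<dots> \<le> cmod \<alpha> * (C * L2_norm M f) + cmod \<beta> * (D * L2_norm M f)"
      by (intro add_mono mult_left_mono C(2) D(2) f norm_ge_zero)
    finally show "L2_norm M (\<lambda>x. \<alpha> * T f x + \<beta> * S f x) \<le> (cmod \<alpha> * C + cmod \<beta> * D) * L2_norm M f"
      by (simp add: algebra_simps)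
  qed (simp add: C D)
qed

lemma L2_op_id: "L2_op M (\<lambda>f. f)"
  by (auto simp: L2_op_def L2_eq_refl intro!: exI[of _ 1])

lemma L2_op_comp:
  assumes T: "L2_op M T" and S: "L2_op M S"
  shows "L2_op M (\<lambda>f. T (S f))"
  unfolding L2_op_def
proof (intro conjI ballI allI)
  show "T (S f) \<in> L2_space M" if "f \<in> L2_space M" for f
    using that by (intro L2_op_space[OF T] L2_op_space[OF S])
  show "L2_eq M (T (S (\<lambda>x. c * f x + g x))) (\<lambda>x. c * T (S f) x + T (S g) x)"
    if "f \<in> L2_space M" "g \<in> L2_space M" for f g c
  proof -
    have "L2_eq M (T (S (\<lambda>x. c * f x + g x))) (T (\<lambda>x. c * S f x + S g x))"
      using that by (intro L2_op_cong[OF T] L2_op_linear[OF S] L2_op_space[OF S] L2_space_closed) auto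
    also have "L2_eq M (T (\<lambda>x. c * S f x + S g x)) (\<lambda>x. c * T (S f) x + T (S g) x)"
      using that by (intro L2_op_linear[OF T] L2_op_space[OF S])
    finally show ?thesis .
  qed
  obtain C D where C: "0 \<le> C" "\<And>f. f \<in> L2_space M \<Longrightarrow> L2_norm M (T f) \<le> C * L2_norm M f"
    and D: "0 \<le> D" "\<And>f. f \<in> L2_space M \<Longrightarrow> L2_norm M (S f) \<le> D * L2_norm M f"
    using L2_op_bound[OF T] L2_op_bound[OF S] by metis
  show "\<exists>C\<ge>0. \<forall>f\<in>L2_space M. L2_norm M (T (S f)) \<le> C * L2_norm M f"
  proof (intro exI[of _ "C * D"] conjI ballI)
    fix f assume f: "f \<in> L2_space M"
    have "L2_norm M (T (S f)) \<le> C * L2_norm M (S f)"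
      by (intro C(2) L2_op_space[OF S] f)
    also have "\<dots> \<le> C * (D * L2_norm M f)"
      by (intro mult_left_mono C(1) D(2) f)
    finally show "L2_norm M (T (S f)) \<le> C * D * L2_norm M f"
      by (simp add: mult.assoc)
  qed (simp add: C D)
qed

lemma L2_essential_spectrum_cong:
  assumes eq: "\<And>f. f \<in> L2_space M \<Longrightarrow> L2_eq M (T f) (T' f)"
    and T: "\<And>f. f \<in> L2_space M \<Longrightarrow> T f \<in> L2_space M" and T': "\<And>f. f \<in> L2_space M \<Longrightarrow> T' f \<in> L2_space M"
  shows "L2_essential_spectrum M T = L2_essential_spectrum M T'"
proof -
  have iff: "(AE x in M. T f x - z * f x = g x) \<longleftrightarrow> (AE x in M. T' f x - z * f x = g x)"
    "(AE x in M. T f x = g x) \<longleftrightarrow> (AE x in M. T' f x = g x)"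
    if "f \<in> L2_space M" for f g z
    using eq[OF that] unfolding L2_eq_def by (auto elim: eventually_elim2)
  have norm: "L2_norm M (\<lambda>x. T f x - z * f x) = L2_norm M (\<lambda>x. T' f x - z * f x)"
    if f: "f \<in> L2_space M" for f z
    by (rule L2_norm_cong) (intro L2_eq_diff L2_eq_refl eq L2_space_diff L2_space_scale T T' f)+
  have "L2_resolvent_set M T = L2_resolvent_set M T'"
    unfolding L2_resolvent_set_def
    by (intro Collect_cong arg_cong2[where f = "(\<and>)"] ball_cong bex_cong ex_cong1 refl)
      (simp_all only: iff norm)
  moreover have "L2_eigenspace M T = L2_eigenspace M T'"
    unfolding L2_eigenspace_def fun_eq_iff by (simp add: iff(2) cong: conj_cong)
  ultimately show ?thesis
    by (simp add: L2_essential_spectrum_def L2_discrete_spectrum_def L2_spectrum_def L2_eigenvalue_def)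
qed

section \<open>Linear systems\<close>

text \<open>By Gaussian elimination: an equation with a nonzero coefficient is solved for one unknown, and the
  remaining equations are a system of the same kind with one equation and one unknown less.\<close>

lemma underdetermined_system_nontrivial_solution:
  fixes A :: "'i \<Rightarrow> 'w \<Rightarrow> 'k::field"
  assumes "finite W" "finite I" "card W < card I"
  shows "\<exists>c. (\<exists>i\<in>I. c i \<noteq> 0) \<and> (\<forall>w\<in>W. (\<Sum>i\<in>I. c i * A i w) = 0)"
  using assms
proof (induction W arbitrary: I A rule: finite_induct)
  case empty
  then show ?case
    by (intro exI[of _ "\<lambda>_. 1"]) (auto simp: card_gt_0_iff)
next
  case (insert w0 W)
  show ?case
  proof (cases "\<forall>i\<in>I. A i w0 = 0")
    case True
    have "card W < card I"
      using insert.prems insert.hyps by simp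
    then obtain c where "\<exists>i\<in>I. c i \<noteq> 0" "\<forall>w\<in>W. (\<Sum>i\<in>I. c i * A i w) = 0"
      using insert.IH[of I A] insert.prems(1) by auto
    then show ?thesis
      using True by (intro exI[of _ c]) auto
  next
    case False
    then obtain i0 where i0: "i0 \<in> I" "A i0 w0 \<noteq> 0"
      by auto
    define J where "J = I - {i0}"
    have J: "finite J" "card W < card J" "I = insert i0 J" "i0 \<notin> J"
      using insert.prems insert.hyps i0(1) by (auto simp: J_def)
    define A' where "A' = (\<lambda>i w. A i w - (A i w0 / A i0 w0) * A i0 w)"
    obtain c where c: "\<exists>i\<in>J. c i \<noteq> 0" "\<forall>w\<in>W. (\<Sum>i\<in>J. c i * A' i w) = 0"
      using insert.IH[of J A'] J by auto
    define c0 where "c0 = - (\<Sum>i\<in>J. c i * A i w0) / A i0 w0"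
    define c' where "c' = (\<lambda>i. if i = i0 then c0 else c i)"
    have split: "(\<Sum>i\<in>I. c' i * A i w) = c0 * A i0 w + (\<Sum>i\<in>J. c i * A i w)" for w
    proof -
      have "(\<Sum>i\<in>J. c' i * A i w) = (\<Sum>i\<in>J. c i * A i w)"
        using J(4) by (intro sum.cong) (auto simp: c'_def)
      then show ?thesis
        using J by (simp add: c'_def)
    qed
    have "(\<Sum>i\<in>J. c i * A' i w) = c0 * A i0 w + (\<Sum>i\<in>J. c i * A i w)" for w
    proof -
      have "(\<Sum>i\<in>J. c i * A' i w) = (\<Sum>i\<in>J. c i * A i w) - (\<Sum>i\<in>J. c i * A i w0 * A i0 w / A i0 w0)"
        unfolding A'_def by (simp add: right_diff_distrib sum_subtractf mult.assoc)
      also have "(\<Sum>i\<in>J. c i * A i w0 * A i0 w / A i0 w0) = - c0 * A i0 w"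
        by (simp add: c0_def sum_distrib_right sum_divide_distrib)
      finally show ?thesis by simp
    qed
    with c(2) have "(\<Sum>i\<in>I. c' i * A i w) = 0" if "w \<in> W" for w
      using that split by metis
    moreover have "(\<Sum>i\<in>I. c' i * A i w0) = 0"
      unfolding split using i0(2) by (simp add: c0_def)
    moreover have "\<exists>i\<in>I. c' i \<noteq> 0"
      using c(1) J by (auto simp: c'_def)
    ultimately show ?thesis
      by (intro exI[of _ c']) auto
  qed
qed

text \<open>The columns of an inverse matrix come from nontrivial solutions of the systems in which the
  right-hand side is multiplied by an additional unknown; injectivity makes this unknown nonzero.\<close>

lemma injective_square_system_inverse:
  fixes A :: "'i \<Rightarrow> 'i \<Rightarrow> 'k::field"
  assumes I: "finite I"
    and inj: "\<And>c. (\<And>i. i \<in> I \<Longrightarrow> (\<Sum>j\<in>I. c j * A j i) = 0) \<Longrightarrow> (\<And>i. i \<in> I \<Longrightarrow> c i = 0)"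
  obtains B where "\<And>\<gamma> i. i \<in> I \<Longrightarrow> (\<Sum>j\<in>I. (\<Sum>l\<in>I. \<gamma> l * B l j) * A j i) = \<gamma> i"
proof -
  have "\<exists>b. \<forall>i\<in>I. (\<Sum>j\<in>I. b j * A j i) = (if i = l then 1 else 0)" if l: "l \<in> I" for l
  proof -
    \<comment> \<open>\<open>None\<close> is the index of the additional unknown.\<close>
    define A' where "A' = (\<lambda>i' i. case i' of None \<Rightarrow> - (if i = l then 1 else 0) | Some j \<Rightarrow> A j i)"
    let ?I' = "insert None (Some ` I)"
    have "card I < card ?I'"
      using I by (simp add: card_image)
    then obtain c where c: "\<exists>i\<in>?I'. c i \<noteq> 0" "\<forall>i\<in>I. (\<Sum>i'\<in>?I'. c i' * A' i' i) = 0"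
      using underdetermined_system_nontrivial_solution[of I ?I' A'] I by auto
    have split: "(\<Sum>i'\<in>?I'. c i' * A' i' i) =
        - c None * (if i = l then 1 else 0) + (\<Sum>j\<in>I. c (Some j) * A j i)" for i
      using I by (simp add: sum.reindex A'_def)
    have "c None \<noteq> 0"
    proof
      assume 0: "c None = 0"
      then have "c (Some i) = 0" if "i \<in> I" for i
        using inj[of "\<lambda>j. c (Some j)"] c(2) split that by auto
      with c(1) 0 show False by auto
    qed
    then have "(\<Sum>j\<in>I. (c (Some j) / c None) * A j i) = (if i = l then 1 else 0)" if "i \<in> I" for i
      using c(2) split[of i] that
      by (simp add: sum_divide_distrib[symmetric] divide_simps split: if_splits)
    then show ?thesis
      by (intro exI[of _ "\<lambda>j. c (Some j) / c None"] ballI)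
  qed
  then obtain B where B: "\<And>l i. l \<in> I \<Longrightarrow> i \<in> I \<Longrightarrow> (\<Sum>j\<in>I. B l j * A j i) = (if i = l then 1 else 0)"
    by metis
  show ?thesis
  proof
    fix \<gamma> i assume i: "i \<in> I"
    have "(\<Sum>j\<in>I. (\<Sum>l\<in>I. \<gamma> l * B l j) * A j i) = (\<Sum>l\<in>I. \<gamma> l * (\<Sum>j\<in>I. B l j * A j i))"
      unfolding sum_distrib_left sum_distrib_right by (subst sum.swap) (simp add: mult.assoc)
    also have "\<dots> = (\<Sum>l\<in>I. if i = l then \<gamma> l else 0)"
      using B i by (intro sum.cong) auto
    finally show "(\<Sum>j\<in>I. (\<Sum>l\<in>I. \<gamma> l * B l j) * A j i) = \<gamma> i"
      using I i by simp
  qed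
qed

section \<open>Operators invertible up to finite rank\<close>

text \<open>An injective bounded \<open>R\<close> inverts \<open>T - z\<close> from the left up to the operator
  \<open>f \<mapsto> (\<Sum>i\<in>I. \<langle>f, u i\<rangle> v i)\<close> of finite rank. Only the index set \<open>I\<close>
  is exposed, since \<open>R\<close>, \<open>u\<close> and \<open>v\<close> vary with \<open>z\<close>.\<close>

definition L2_parametrix ::
    "'a measure \<Rightarrow> (('a \<Rightarrow> complex) \<Rightarrow> 'a \<Rightarrow> complex) \<Rightarrow> 'i set \<Rightarrow> complex \<Rightarrow> bool" where
  "L2_parametrix M T I z \<longleftrightarrow> (\<exists>R u v.
     L2_op M R \<and> (\<forall>g\<in>L2_space M. L2_eq M (R g) (\<lambda>x. 0) \<longrightarrow> L2_eq M g (\<lambda>x. 0)) \<and>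
     (\<forall>i\<in>I. u i \<in> L2_space M \<and> v i \<in> L2_space M) \<and>
     (\<forall>f\<in>L2_space M.
        L2_eq M (R (\<lambda>x. T f x - z * f x)) (\<lambda>x. f x + (\<Sum>i\<in>I. L2_inner M f (u i) * v i x))))"

lemma L2_parametrixE:
  assumes "L2_parametrix M T I z"
  obtains R u v where "L2_op M R"
    "\<And>g. g \<in> L2_space M \<Longrightarrow> L2_eq M (R g) (\<lambda>x. 0) \<Longrightarrow> L2_eq M g (\<lambda>x. 0)"
    "\<And>i. i \<in> I \<Longrightarrow> u i \<in> L2_space M" "\<And>i. i \<in> I \<Longrightarrow> v i \<in> L2_space M"
    "\<And>f. f \<in> L2_space M \<Longrightarrow>
      L2_eq M (R (\<lambda>x. T f x - z * f x)) (\<lambda>x. f x + (\<Sum>i\<in>I. L2_inner M f (u i) * v i x))"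
proof -
  from assms[unfolded L2_parametrix_def] obtain R u v where *: "L2_op M R"
    "\<forall>g\<in>L2_space M. L2_eq M (R g) (\<lambda>x. 0) \<longrightarrow> L2_eq M g (\<lambda>x. 0)"
    "\<forall>i\<in>I. u i \<in> L2_space M \<and> v i \<in> L2_space M"
    "\<forall>f\<in>L2_space M.
      L2_eq M (R (\<lambda>x. T f x - z * f x)) (\<lambda>x. f x + (\<Sum>i\<in>I. L2_inner M f (u i) * v i x))"
    by (elim exE conjE)
  show thesis
    by (rule that[of R u v]) (use * in auto)
qed

lemma L2_inner_lincomb_left:
  assumes "\<And>i. i \<in> I \<Longrightarrow> f i \<in> L2_space M" "w \<in> L2_space M"
  shows "L2_inner M (\<lambda>x. \<Sum>i\<in>I. c i * f i x) w = (\<Sum>i\<in>I. c i * L2_inner M (f i) w)"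
  using assms by (subst L2_inner_sum_left) (auto simp: L2_inner_scale_left L2_space_scale)

lemma L2_eq_diff_zero_iff: "L2_eq M (\<lambda>x. f x - g x) (\<lambda>x. 0) \<longleftrightarrow> L2_eq M f g"
  by (simp add: L2_eq_def)

text \<open>The Fredholm alternative. The vector \<open>f = R g - (\<Sum>i\<in>I. c i * v i)\<close> solves \<open>R (T f - z f) = R g\<close>
  if \<open>c\<close> solves a square linear system with matrix \<open>A\<close>, and then \<open>c i = \<langle>f, u i\<rangle>\<close>. A kernel vector of \<open>A\<close> yields a kernel
  vector of \<open>T - z\<close>, so injectivity of \<open>T - z\<close> makes \<open>A\<close> invertible, and the inverse matrix
  bounds the coefficients.\<close>

lemma injective_parametrix_in_resolvent_set:
  assumes T: "L2_op M T" and I: "finite I" and P: "L2_parametrix M T I z"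
    and inj: "\<And>f. f \<in> L2_space M \<Longrightarrow> L2_eq M (\<lambda>x. T f x - z * f x) (\<lambda>x. 0) \<Longrightarrow> L2_eq M f (\<lambda>x. 0)"
  shows "z \<in> L2_resolvent_set M T"
proof -
  obtain R u v where R: "L2_op M R"
    and Rinj: "\<And>g. g \<in> L2_space M \<Longrightarrow> L2_eq M (R g) (\<lambda>x. 0) \<Longrightarrow> L2_eq M g (\<lambda>x. 0)"
    and u: "\<And>i. i \<in> I \<Longrightarrow> u i \<in> L2_space M" and v: "\<And>i. i \<in> I \<Longrightarrow> v i \<in> L2_space M"
    and RT: "\<And>f. f \<in> L2_space M \<Longrightarrow>
      L2_eq M (R (\<lambda>x. T f x - z * f x)) (\<lambda>x. f x + (\<Sum>i\<in>I. L2_inner M f (u i) * v i x))"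
    by (rule L2_parametrixE[OF P]) (rule that; assumption)
  have Tz: "(\<lambda>x. T f x - z * f x) \<in> L2_space M" if "f \<in> L2_space M" for f
    using that by (intro L2_space_diff L2_space_scale L2_op_space[OF T])
  define A where "A = (\<lambda>j i. (if j = i then 1 else 0) + L2_inner M (v j) (u i))"
  have A_sum: "(\<Sum>j\<in>I. c j * A j i) = c i + (\<Sum>j\<in>I. c j * L2_inner M (v j) (u i))" if "i \<in> I" for c i
  proof -
    have "(\<Sum>j\<in>I. c j * A j i) = (\<Sum>j\<in>I. if j = i then c j else 0) + (\<Sum>j\<in>I. c j * L2_inner M (v j) (u i))"
      unfolding sum.distrib[symmetric] A_def by (intro sum.cong) (auto simp: distrib_left)
    then show ?thesis
      using that I by simp
  qed
  have Ainj: "c i = 0" if c: "\<And>i. i \<in> I \<Longrightarrow> (\<Sum>j\<in>I. c j * A j i) = 0" and i: "i \<in> I" for c i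
  proof -
    define f where "f = (\<lambda>x. \<Sum>j\<in>I. c j * v j x)"
    have f: "f \<in> L2_space M"
      unfolding f_def by (intro L2_space_sum L2_space_scale v)
    have fu: "L2_inner M f (u i) = - c i" if "i \<in> I" for i
    proof -
      have "L2_inner M f (u i) = (\<Sum>j\<in>I. c j * L2_inner M (v j) (u i))"
        unfolding f_def using v u that by (simp add: L2_inner_lincomb_left)
      then show ?thesis
        using c[OF that] A_sum[OF that, of c] by (simp add: eq_neg_iff_add_eq_0 add.commute)
    qed
    have "(\<lambda>x. f x + (\<Sum>i\<in>I. L2_inner M f (u i) * v i x)) = (\<lambda>x. 0)"
      by (simp add: fu sum_negf cong: sum.cong) (simp add: f_def)
    then have "L2_eq M (R (\<lambda>x. T f x - z * f x)) (\<lambda>x. 0)"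
      using RT[OF f] by simp
    then have "L2_eq M f (\<lambda>x. 0)"
      by (rule inj[OF f Rinj[OF Tz[OF f]]])
    then have "L2_inner M f (u i) = L2_inner M (\<lambda>x. 0) (u i)"
      using f u i by (intro L2_inner_cong_left) (auto simp: L2_space_zero)
    then show ?thesis
      using fu[OF i] by (simp add: L2_inner_zero_left)
  qed
  obtain B where B: "\<And>\<gamma> i. i \<in> I \<Longrightarrow> (\<Sum>j\<in>I. (\<Sum>l\<in>I. \<gamma> l * B l j) * A j i) = \<gamma> i"
  proof (rule injective_square_system_inverse[OF I, where A = A])
    show "c i = 0" if "\<And>i. i \<in> I \<Longrightarrow> (\<Sum>j\<in>I. c j * A j i) = 0" "i \<in> I" for c i
      using that by (rule Ainj)
  qed (rule that)
  show ?thesis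
    unfolding L2_resolvent_set_def
  proof (intro CollectI conjI ballI impI)
    fix f assume "f \<in> L2_space M" "AE x in M. T f x - z * f x = 0"
    then show "AE x in M. f x = 0"
      using inj[of f] by (simp add: L2_eq_def)
  next
    fix g assume g: "g \<in> L2_space M"
    define c where "c = (\<lambda>j. \<Sum>l\<in>I. L2_inner M (R g) (u l) * B l j)"
    define f where "f = (\<lambda>x. R g x - (\<Sum>j\<in>I. c j * v j x))"
    have Rg: "R g \<in> L2_space M"
      by (intro L2_op_space[OF R] g)
    have vs: "(\<lambda>x. \<Sum>j\<in>I. c j * v j x) \<in> L2_space M"
      by (intro L2_space_sum L2_space_scale v)
    have f: "f \<in> L2_space M"
      unfolding f_def by (intro L2_space_diff Rg vs)
    have fu: "L2_inner M f (u i) = c i" if "i \<in> I" for i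
    proof -
      have "L2_inner M f (u i) = L2_inner M (R g) (u i) - (\<Sum>j\<in>I. c j * L2_inner M (v j) (u i))"
        unfolding f_def using v u that Rg vs by (simp add: L2_inner_diff_left L2_inner_lincomb_left)
      moreover have "(\<Sum>j\<in>I. c j * A j i) = L2_inner M (R g) (u i)"
        unfolding c_def using B[OF that, of "\<lambda>l. L2_inner M (R g) (u l)"] .
      ultimately show ?thesis
        using A_sum[OF that, of c] by (simp add: diff_eq_eq)
    qed
    have "L2_eq M (R (\<lambda>x. T f x - z * f x)) (R g)"
      using RT[OF f] by (simp add: fu cong: sum.cong) (simp add: f_def)
    then have "L2_eq M (R (\<lambda>x. (T f x - z * f x) - g x)) (\<lambda>x. 0)"
      using L2_op_diff[OF R Tz[OF f] g] L2_eq_diff_zero_iff L2_eq_trans by blast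
    then have "L2_eq M (\<lambda>x. (T f x - z * f x) - g x) (\<lambda>x. 0)"
      by (rule Rinj[OF L2_space_diff[OF Tz[OF f] g]])
    then show "\<exists>f\<in>L2_space M. AE x in M. T f x - z * f x = g x"
      using f by (auto simp: L2_eq_def)
  next
    obtain C where C: "0 \<le> C" "\<And>f. f \<in> L2_space M \<Longrightarrow> L2_norm M (R f) \<le> C * L2_norm M f"
      using L2_op_bound[OF R] by metis
    define D where "D = 1 + (\<Sum>j\<in>I. (\<Sum>l\<in>I. L2_norm M (u l) * cmod (B l j)) * L2_norm M (v j))"
    show "\<exists>C. \<forall>f\<in>L2_space M. L2_norm M f \<le> C * L2_norm M (\<lambda>x. T f x - z * f x)"
    proof (intro exI[of _ "D * C"] ballI)
      fix f assume f: "f \<in> L2_space M"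
      define g where "g = R (\<lambda>x. T f x - z * f x)"
      have g: "g \<in> L2_space M"
        unfolding g_def by (intro L2_op_space[OF R] Tz f)
      define c where "c = (\<lambda>j. \<Sum>l\<in>I. L2_inner M g (u l) * B l j)"
      have vs: "(\<lambda>x. \<Sum>j\<in>I. c j * v j x) \<in> L2_space M" for c
        by (intro L2_space_sum L2_space_scale v)
      have gf: "L2_eq M g (\<lambda>x. f x + (\<Sum>i\<in>I. L2_inner M f (u i) * v i x))"
        unfolding g_def by (rule RT[OF f])
      have gu: "L2_inner M g (u i) = (\<Sum>j\<in>I. L2_inner M f (u j) * A j i)" if "i \<in> I" for i
      proof -
        have "L2_inner M g (u i) = L2_inner M (\<lambda>x. f x + (\<Sum>i\<in>I. L2_inner M f (u i) * v i x)) (u i)"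
          using gf g f vs u that by (intro L2_inner_cong_left L2_space_add) auto
        also have "\<dots> = (\<Sum>j\<in>I. L2_inner M f (u j) * A j i)"
          using f vs u v that by (simp add: A_sum L2_inner_add_left L2_inner_lincomb_left)
        finally show ?thesis .
      qed
      have fu: "L2_inner M f (u i) = c i" if "i \<in> I" for i
      proof -
        have "(\<Sum>j\<in>I. (c j - L2_inner M f (u j)) * A j i) = 0" if "i \<in> I" for i
          unfolding c_def using B[OF that, of "\<lambda>l. L2_inner M g (u l)"] gu[OF that]
          by (simp add: left_diff_distrib sum_subtractf)
        then show ?thesis
          using Ainj[of "\<lambda>j. c j - L2_inner M f (u j)" i] that by simp
      qed
      have "L2_eq M f (\<lambda>x. g x - (\<Sum>j\<in>I. c j * v j x))"
        using gf unfolding L2_eq_def by eventually_elim (simp add: fu cong: sum.cong)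
      then have "L2_norm M f = L2_norm M (\<lambda>x. g x - (\<Sum>j\<in>I. c j * v j x))"
        by (intro L2_norm_cong L2_space_diff f g vs)
      also have "\<dots> \<le> L2_norm M g + L2_norm M (\<lambda>x. \<Sum>j\<in>I. c j * v j x)"
        by (intro L2_norm_diff_triangle g vs)
      also have "L2_norm M (\<lambda>x. \<Sum>j\<in>I. c j * v j x) \<le> (\<Sum>j\<in>I. L2_norm M (\<lambda>x. c j * v j x))"
        by (intro L2_norm_sum L2_space_scale v)
      also have "\<dots> \<le> (\<Sum>j\<in>I. (\<Sum>l\<in>I. L2_norm M (u l) * cmod (B l j)) * L2_norm M (v j) * L2_norm M g)"
      proof (intro sum_mono)
        fix j assume "j \<in> I"
        have "cmod (c j) \<le> (\<Sum>l\<in>I. cmod (L2_inner M g (u l)) * cmod (B l j))"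
          unfolding c_def by (rule order_trans[OF norm_sum]) (simp add: norm_mult)
        also have "\<dots> \<le> (\<Sum>l\<in>I. (L2_norm M g * L2_norm M (u l)) * cmod (B l j))"
          by (intro sum_mono mult_right_mono L2_Cauchy_Schwarz g u norm_ge_zero)
        also have "\<dots> = (\<Sum>l\<in>I. L2_norm M (u l) * cmod (B l j)) * L2_norm M g"
          by (simp add: sum_distrib_left mult_ac)
        finally have "cmod (c j) * L2_norm M (v j) \<le>
            ((\<Sum>l\<in>I. L2_norm M (u l) * cmod (B l j)) * L2_norm M g) * L2_norm M (v j)"
          by (intro mult_right_mono L2_norm_nonneg)
        then show "L2_norm M (\<lambda>x. c j * v j x) \<le>
            (\<Sum>l\<in>I. L2_norm M (u l) * cmod (B l j)) * L2_norm M (v j) * L2_norm M g"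
          by (simp add: L2_norm_scale mult_ac)
      qed
      finally have "L2_norm M f \<le> D * L2_norm M g"
        unfolding D_def by (simp add: distrib_right sum_distrib_right)
      also have "\<dots> \<le> D * (C * L2_norm M (\<lambda>x. T f x - z * f x))"
        unfolding g_def D_def
        by (intro mult_left_mono C(2) Tz f add_nonneg_nonneg sum_nonneg mult_nonneg_nonneg) (auto simp: L2_norm_nonneg)
      finally show "L2_norm M f \<le> D * C * L2_norm M (\<lambda>x. T f x - z * f x)"
        by (simp add: mult.assoc)
    qed
  qed
qed

lemma L2_finite_dim_if_spanned:
  fixes E :: "('a \<Rightarrow> complex) set"
  assumes I: "finite I"
    and span: "\<And>f. f \<in> E \<Longrightarrow> \<exists>c. L2_eq M f (\<lambda>x. \<Sum>i\<in>I. c i * v i x)"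
  shows "L2_finite_dim M E"
proof -
  \<comment> \<open>A maximal linearly independent subset of \<open>E\<close> exists because its size is at most \<open>card I\<close>.\<close>
  define indep where "indep B \<longleftrightarrow> finite B \<and> B \<subseteq> E \<and>
      (\<forall>c. L2_eq M (\<lambda>x. \<Sum>b\<in>B. c b * b x) (\<lambda>x. 0) \<longrightarrow> (\<forall>b\<in>B. c b = 0))" for B :: "('a \<Rightarrow> complex) set"
  have card: "card B \<le> card I" if B: "indep B" for B
  proof (rule ccontr)
    assume "\<not> card B \<le> card I"
    obtain a where a: "\<And>b. b \<in> B \<Longrightarrow> L2_eq M b (\<lambda>x. \<Sum>i\<in>I. a b i * v i x)"
      using span B unfolding indep_def by (metis subsetD)
    obtain c where c: "\<exists>b\<in>B. c b \<noteq> 0" "\<forall>i\<in>I. (\<Sum>b\<in>B. c b * a b i) = 0"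
      using underdetermined_system_nontrivial_solution[OF I, of B a] B \<open>\<not> card B \<le> card I\<close>
      by (auto simp: indep_def)
    have "L2_eq M (\<lambda>x. \<Sum>b\<in>B. c b * b x) (\<lambda>x. \<Sum>b\<in>B. c b * (\<Sum>i\<in>I. a b i * v i x))"
      by (intro L2_eq_sum L2_eq_mult a)
    also have "(\<lambda>x. \<Sum>b\<in>B. c b * (\<Sum>i\<in>I. a b i * v i x)) = (\<lambda>x. \<Sum>i\<in>I. (\<Sum>b\<in>B. c b * a b i) * v i x)"
      unfolding sum_distrib_left sum_distrib_right by (subst sum.swap) (simp add: mult.assoc)
    also have "\<dots> = (\<lambda>x. 0)"
      using c(2) by simp
    finally show False
      using B c(1) unfolding indep_def by blast
  qed
  have "indep {}"
    by (simp add: indep_def)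
  then obtain B where B: "indep B" and max: "\<And>B'. indep B' \<Longrightarrow> card B' \<le> card B"
    using ex_has_greatest_nat[of indep "{}" card "Suc (card I)"] card by (metis less_Suc_eq_le)
  have "\<exists>c. AE x in M. f x = (\<Sum>b\<in>B. c b * b x)" if f: "f \<in> E" for f
  proof (cases "f \<in> B")
    case True
    have "(\<Sum>b\<in>B. (if b = f then 1 else 0) * b x) = (\<Sum>b\<in>B. if b = f then b x else 0)" for x
      by (intro sum.cong) auto
    then have "f x = (\<Sum>b\<in>B. (if b = f then 1 else 0) * b x)" for x
      using True B by (simp add: indep_def)
    then show ?thesis
      by (intro exI[of _ "\<lambda>b. if b = f then 1 else 0"]) auto
  next
    case False
    have "\<not> indep (insert f B)"
      using max[of "insert f B"] False B by (auto simp: indep_def)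
    then obtain c where c: "L2_eq M (\<lambda>x. \<Sum>b\<in>insert f B. c b * b x) (\<lambda>x. 0)" "\<exists>b\<in>insert f B. c b \<noteq> 0"
      using B f unfolding indep_def by auto
    have split: "(\<lambda>x. \<Sum>b\<in>insert f B. c b * b x) = (\<lambda>x. c f * f x + (\<Sum>b\<in>B. c b * b x))"
      using B False by (simp add: indep_def)
    have "c f \<noteq> 0"
    proof
      assume 0: "c f = 0"
      then have "L2_eq M (\<lambda>x. \<Sum>b\<in>B. c b * b x) (\<lambda>x. 0)"
        using c(1) unfolding split by simp
      then show False
        using B c(2) 0 unfolding indep_def by blast
    qed
    have "AE x in M. c f * f x + (\<Sum>b\<in>B. c b * b x) = 0"
      using c(1) unfolding split L2_eq_def .
    then have "AE x in M. f x = (\<Sum>b\<in>B. (- c b / c f) * b x)"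
    proof eventually_elim
      case (elim x)
      then have "c f * f x = - (\<Sum>b\<in>B. c b * b x)"
        by (simp add: eq_neg_iff_add_eq_0)
      then have "f x = - (\<Sum>b\<in>B. c b * b x) / c f"
        using \<open>c f \<noteq> 0\<close> by (metis nonzero_mult_div_cancel_left)
      then show ?case
        by (simp add: sum_negf sum_divide_distrib)
    qed
    then show ?thesis by (intro exI)
  qed
  then show ?thesis
    unfolding L2_finite_dim_def using B by (auto simp: indep_def)
qed

lemma L2_eigenspace_eq:
  "L2_eigenspace M T z = {f \<in> L2_space M. L2_eq M (\<lambda>x. T f x - z * f x) (\<lambda>x. 0)}"
  by (simp add: L2_eigenspace_def L2_eq_def)

lemma L2_eigenvalue_eq:
  "L2_eigenvalue M T z \<longleftrightarrow> (\<exists>f\<in>L2_space M. L2_eq M (\<lambda>x. T f x - z * f x) (\<lambda>x. 0) \<and> \<not> L2_eq M f (\<lambda>x. 0))"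
  by (auto simp: L2_eigenvalue_def L2_eigenspace_eq L2_eq_def)

lemma parametrix_eigenspace_finite_dim:
  assumes T: "L2_op M T" and I: "finite I" and P: "L2_parametrix M T I z"
  shows "L2_finite_dim M (L2_eigenspace M T z)"
proof -
  obtain R u v where R: "L2_op M R"
    and "\<And>g. g \<in> L2_space M \<Longrightarrow> L2_eq M (R g) (\<lambda>x. 0) \<Longrightarrow> L2_eq M g (\<lambda>x. 0)"
    and u: "\<And>i. i \<in> I \<Longrightarrow> u i \<in> L2_space M" and "\<And>i. i \<in> I \<Longrightarrow> v i \<in> L2_space M"
    and RT: "\<And>f. f \<in> L2_space M \<Longrightarrow>
      L2_eq M (R (\<lambda>x. T f x - z * f x)) (\<lambda>x. f x + (\<Sum>i\<in>I. L2_inner M f (u i) * v i x))"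
    by (rule L2_parametrixE[OF P]) (rule that; assumption)
  show ?thesis
  proof (rule L2_finite_dim_if_spanned[OF I])
    fix f assume "f \<in> L2_eigenspace M T z"
    then have f: "f \<in> L2_space M" and ef: "L2_eq M (\<lambda>x. T f x - z * f x) (\<lambda>x. 0)"
      by (auto simp: L2_eigenspace_eq)
    have "L2_eq M (R (\<lambda>x. T f x - z * f x)) (\<lambda>x. 0)"
      by (rule L2_op_null[OF R _ ef]) (intro L2_space_diff L2_space_scale L2_op_space[OF T] f)
    with RT[OF f] have "L2_eq M f (\<lambda>x. \<Sum>i\<in>I. (- L2_inner M f (u i)) * v i x)"
      unfolding L2_eq_def by eventually_elim (simp add: sum_negf eq_neg_iff_add_eq_0)
    then show "\<exists>c. L2_eq M f (\<lambda>x. \<Sum>i\<in>I. c i * v i x)"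
      by (intro exI)
  qed
qed

definition L2_symmetric :: "'a measure \<Rightarrow> (('a \<Rightarrow> complex) \<Rightarrow> 'a \<Rightarrow> complex) \<Rightarrow> bool" where
  "L2_symmetric M T \<longleftrightarrow>
     (\<forall>f\<in>L2_space M. \<forall>g\<in>L2_space M. L2_inner M (T f) g = L2_inner M f (T g))"

lemma L2_Pythagoras:
  assumes W: "finite W" and e: "\<And>w. w \<in> W \<Longrightarrow> e w \<in> L2_space M"
    and orth: "\<And>w w'. w \<in> W \<Longrightarrow> w' \<in> W \<Longrightarrow> w \<noteq> w' \<Longrightarrow> L2_inner M (e w) (e w') = 0"
  shows "(L2_norm M (\<lambda>x. \<Sum>w\<in>W. a w * e w x))\<^sup>2 = (\<Sum>w\<in>W. (cmod (a w))\<^sup>2 * (L2_norm M (e w))\<^sup>2)"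
proof -
  have "complex_of_real ((L2_norm M (\<lambda>x. \<Sum>w\<in>W. a w * e w x))\<^sup>2) =
      (\<Sum>w\<in>W. a w * (\<Sum>w'\<in>W. cnj (a w') * L2_inner M (e w) (e w')))"
    unfolding L2_inner_self[symmetric] using e
    by (simp add: L2_inner_lincomb_left L2_inner_sum_right L2_inner_scale_right L2_space_closed)
  also have "\<dots> = (\<Sum>w\<in>W. a w * (\<Sum>w'\<in>W. if w' = w then cnj (a w) * L2_inner M (e w) (e w) else 0))"
    using orth by (intro sum.cong arg_cong2[where f = "(*)"]) auto
  also have "\<dots> = complex_of_real (\<Sum>w\<in>W. (cmod (a w))\<^sup>2 * (L2_norm M (e w))\<^sup>2)"
    using W by (simp add: L2_inner_self complex_norm_square mult.assoc del: of_real_power)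
  finally show ?thesis
    by (simp only: of_real_eq_iff)
qed

text \<open>Eigenvectors for more than \<open>card I\<close> eigenvalues near \<open>z\<close> have a nontrivial combination on which
  the finite-rank part vanishes. On it \<open>R\<close> is a left inverse of \<open>T - z\<close>, so \<open>T - z\<close> does not shrink
  its norm below a fixed fraction. But the eigenvectors are orthogonal by symmetry, so \<open>T - z\<close>
  multiplies norms on their span by at most the largest distance of the eigenvalues to \<open>z\<close>.\<close>

lemma parametrix_finitely_many_near_eigenvalues:
  assumes T: "L2_op M T" and sym: "L2_symmetric M T" and I: "finite I" and P: "L2_parametrix M T I z"
  obtains \<delta> where "0 < \<delta>" "finite {w. dist z w < \<delta> \<and> L2_eigenvalue M T w}"
proof -
  obtain R u v where R: "L2_op M R"
    and "\<And>g. g \<in> L2_space M \<Longrightarrow> L2_eq M (R g) (\<lambda>x. 0) \<Longrightarrow> L2_eq M g (\<lambda>x. 0)"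
    and u: "\<And>i. i \<in> I \<Longrightarrow> u i \<in> L2_space M" and "\<And>i. i \<in> I \<Longrightarrow> v i \<in> L2_space M"
    and RT: "\<And>f. f \<in> L2_space M \<Longrightarrow>
      L2_eq M (R (\<lambda>x. T f x - z * f x)) (\<lambda>x. f x + (\<Sum>i\<in>I. L2_inner M f (u i) * v i x))"
    by (rule L2_parametrixE[OF P]) (rule that; assumption)
  obtain C where C: "0 \<le> C" "\<And>f. f \<in> L2_space M \<Longrightarrow> L2_norm M (R f) \<le> C * L2_norm M f"
    using L2_op_bound[OF R] by metis
  define \<delta> where "\<delta> = 1 / (C + 1)"
  have \<delta>: "0 < \<delta>" "C * \<delta> < 1"
    using C(1) by (auto simp: \<delta>_def)
  have "finite {w. dist z w < \<delta> \<and> L2_eigenvalue M T w}"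
  proof (rule ccontr)
    assume "infinite {w. dist z w < \<delta> \<and> L2_eigenvalue M T w}"
    then obtain W where W: "finite W" "card W = Suc (card I)"
      "\<And>w. w \<in> W \<Longrightarrow> dist z w < \<delta>" "\<And>w. w \<in> W \<Longrightarrow> L2_eigenvalue M T w"
      using infinite_arbitrarily_large[of _ "Suc (card I)"] by (smt (verit) mem_Collect_eq subset_iff)
    then have "\<forall>w\<in>W. \<exists>f\<in>L2_space M. L2_eq M (\<lambda>x. T f x - w * f x) (\<lambda>x. 0) \<and> \<not> L2_eq M f (\<lambda>x. 0)"
      by (simp add: L2_eigenvalue_eq)
    then obtain e where e: "\<And>w. w \<in> W \<Longrightarrow> e w \<in> L2_space M"
      and Te: "\<And>w. w \<in> W \<Longrightarrow> L2_eq M (T (e w)) (\<lambda>x. w * e w x)"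
      and e0: "\<And>w. w \<in> W \<Longrightarrow> \<not> L2_eq M (e w) (\<lambda>x. 0)"
      unfolding L2_eq_diff_zero_iff by metis
    have ne: "L2_norm M (e w) \<noteq> 0" if "w \<in> W" for w
      using e0[OF that] L2_norm_eq_0_iff[OF e[OF that]] by blast
    have swap: "w * L2_inner M (e w) (e w') = cnj w' * L2_inner M (e w) (e w')" if "w \<in> W" "w' \<in> W" for w w'
    proof -
      have "w * L2_inner M (e w) (e w') = L2_inner M (\<lambda>x. w * e w x) (e w')"
        by (simp add: L2_inner_scale_left)
      also have "\<dots> = L2_inner M (T (e w)) (e w')"
        using that by (intro L2_inner_cong_left L2_eq_sym[OF Te] L2_op_space[OF T] L2_space_scale e)
      also have "\<dots> = L2_inner M (e w) (T (e w'))"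
        using sym e that by (simp add: L2_symmetric_def)
      also have "\<dots> = L2_inner M (e w) (\<lambda>x. w' * e w' x)"
        using that by (intro L2_inner_cong_right Te L2_op_space[OF T] L2_space_scale e)
      finally show ?thesis
        by (simp add: L2_inner_scale_right)
    qed
    have real: "cnj w = w" if "w \<in> W" for w
      using swap[OF that that] ne[OF that] by (auto simp: L2_inner_self)
    have orth: "L2_inner M (e w) (e w') = 0" if "w \<in> W" "w' \<in> W" "w \<noteq> w'" for w w'
      using swap[OF that(1,2)] real that by auto
    obtain c where c: "\<exists>w\<in>W. c w \<noteq> 0" "\<forall>i\<in>I. (\<Sum>w\<in>W. c w * L2_inner M (e w) (u i)) = 0"
      using underdetermined_system_nontrivial_solution[OF I W(1), of "\<lambda>w i. L2_inner M (e w) (u i)"] W(2)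
      by auto
    define f where "f = (\<lambda>x. \<Sum>w\<in>W. c w * e w x)"
    \<comment> \<open>\<open>r\<close> is the value of \<open>T - z\<close> at \<open>f\<close>.\<close>
    define r where "r = (\<lambda>x. \<Sum>w\<in>W. (c w * (w - z)) * e w x)"
    have f: "f \<in> L2_space M"
      unfolding f_def by (intro L2_space_sum L2_space_scale e)
    have r: "r \<in> L2_space M"
      unfolding r_def by (intro L2_space_sum L2_space_scale e)
    have norm_f: "(L2_norm M f)\<^sup>2 = (\<Sum>w\<in>W. (cmod (c w))\<^sup>2 * (L2_norm M (e w))\<^sup>2)"
      unfolding f_def by (intro L2_Pythagoras W e orth)
    have "(L2_norm M r)\<^sup>2 = (\<Sum>w\<in>W. (cmod (c w * (w - z)))\<^sup>2 * (L2_norm M (e w))\<^sup>2)"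
      unfolding r_def by (intro L2_Pythagoras W e orth)
    also have "\<dots> \<le> (\<Sum>w\<in>W. \<delta>\<^sup>2 * ((cmod (c w))\<^sup>2 * (L2_norm M (e w))\<^sup>2))"
    proof (intro sum_mono)
      fix w assume "w \<in> W"
      then have "(cmod (w - z))\<^sup>2 \<le> \<delta>\<^sup>2"
        using W(3)[of w] by (intro power_mono) (auto simp: dist_norm norm_minus_commute)
      then have "(cmod (w - z))\<^sup>2 * ((cmod (c w))\<^sup>2 * (L2_norm M (e w))\<^sup>2)
          \<le> \<delta>\<^sup>2 * ((cmod (c w))\<^sup>2 * (L2_norm M (e w))\<^sup>2)"
        by (intro mult_right_mono) auto
      then show "(cmod (c w * (w - z)))\<^sup>2 * (L2_norm M (e w))\<^sup>2 \<le> \<delta>\<^sup>2 * ((cmod (c w))\<^sup>2 * (L2_norm M (e w))\<^sup>2)"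
        by (simp add: norm_mult power_mult_distrib mult_ac)
    qed
    also have "\<dots> = (\<delta> * L2_norm M f)\<^sup>2"
      by (simp add: norm_f power_mult_distrib sum_distrib_left)
    finally have norm_r: "L2_norm M r \<le> \<delta> * L2_norm M f"
      by (rule power2_le_imp_le) (use \<delta> in \<open>simp add: L2_norm_nonneg\<close>)
    have Tf: "L2_eq M (T f) (\<lambda>x. \<Sum>w\<in>W. c w * (w * e w x))"
    proof -
      have "L2_eq M (T f) (\<lambda>x. \<Sum>w\<in>W. T (\<lambda>x. c w * e w x) x)"
        unfolding f_def by (intro L2_op_sum[OF T] L2_space_scale e)
      also have "L2_eq M (\<lambda>x. \<Sum>w\<in>W. T (\<lambda>x. c w * e w x) x) (\<lambda>x. \<Sum>w\<in>W. c w * (w * e w x))"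
        by (rule L2_eq_sum) (rule L2_eq_trans[OF L2_op_scale[OF T e] L2_eq_mult[OF Te]])
      finally show ?thesis .
    qed
    then have Tzf: "L2_eq M (\<lambda>x. T f x - z * f x) r"
      unfolding L2_eq_def
      by eventually_elim (simp add: r_def f_def sum_distrib_left sum_subtractf algebra_simps)
    have "L2_inner M f (u i) = 0" if "i \<in> I" for i
      unfolding f_def using c(2) that e u by (simp add: L2_inner_lincomb_left)
    then have "L2_eq M (R (\<lambda>x. T f x - z * f x)) f"
      using RT[OF f] by simp
    moreover have "(\<lambda>x. T f x - z * f x) \<in> L2_space M"
      by (intro L2_space_diff L2_space_scale L2_op_space[OF T] f)
    then have "L2_eq M (R (\<lambda>x. T f x - z * f x)) (R r)"
      by (rule L2_op_cong[OF R _ r Tzf])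
    ultimately have "L2_eq M f (R r)"
      using L2_eq_sym L2_eq_trans by metis
    then have "L2_norm M f = L2_norm M (R r)"
      by (rule L2_norm_cong[OF _ f L2_op_space[OF R r]])
    also have "\<dots> \<le> C * L2_norm M r"
      by (rule C(2)[OF r])
    also have "\<dots> \<le> C * (\<delta> * L2_norm M f)"
      by (intro mult_left_mono norm_r C(1))
    finally have "L2_norm M f \<le> (C * \<delta>) * L2_norm M f"
      by (simp add: mult.assoc)
    then have "L2_norm M f = 0"
      using \<delta>(2) L2_norm_nonneg[of M f] by (smt (verit) mult_less_cancel_right2)
    then have "\<forall>w\<in>W. (cmod (c w))\<^sup>2 * (L2_norm M (e w))\<^sup>2 = 0"
      using norm_f W(1) by (subst sum_nonneg_eq_0_iff[symmetric]) auto
    then show False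
      using c(1) ne by auto
  qed
  with \<delta>(1) show ?thesis by (rule that)
qed

text \<open>By the Fredholm alternative the spectrum in \<open>G\<close> consists of eigenvalues, and these do not
  accumulate in \<open>G\<close>.\<close>

theorem spectrum_discrete_if_parametrix:
  assumes T: "L2_op M T" and sym: "L2_symmetric M T" and I: "finite I"
    and G: "open G" "\<And>z. z \<in> G \<Longrightarrow> L2_parametrix M T I z"
  shows "L2_spectrum M T \<inter> G \<subseteq> L2_discrete_spectrum M T"
proof
  have eig: "L2_eigenvalue M T w" if "w \<in> L2_spectrum M T \<inter> G" for w
    using that injective_parametrix_in_resolvent_set[OF T I G(2)[of w]]
    unfolding L2_eigenvalue_eq L2_spectrum_def by blast
  fix z assume z: "z \<in> L2_spectrum M T \<inter> G"
  obtain \<delta> where \<delta>: "0 < \<delta>" "finite {w. dist z w < \<delta> \<and> L2_eigenvalue M T w}"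
    using parametrix_finitely_many_near_eigenvalues[OF T sym I G(2)] z by blast
  let ?F = "{w. dist z w < \<delta> \<and> L2_eigenvalue M T w} - {z}"
  have "open (ball z \<delta> \<inter> G - ?F)"
    using \<delta>(2) G(1) by (intro open_Diff open_Int finite_imp_closed) auto
  moreover have "(ball z \<delta> \<inter> G - ?F) \<inter> L2_spectrum M T = {z}"
    using eig z \<delta>(1) by auto
  ultimately have "z isolated_in L2_spectrum M T"
    using z unfolding isolated_in_def by blast
  then show "z \<in> L2_discrete_spectrum M T"
    unfolding L2_discrete_spectrum_def
    using eig[OF z] parametrix_eigenspace_finite_dim[OF T I G(2)] z by blast
qed

section \<open>Sums of two operators with a product of finite rank\<close>

text \<open>If \<open>R\<^sub>i\<close> inverts \<open>T\<^sub>i - z\<close>, then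
  \<open>(T\<^sub>1 - z) (T\<^sub>2 - z) = T\<^sub>1 T\<^sub>2 - z (T\<^sub>1 + T\<^sub>2 - z)\<close> shows that \<open>- z R\<^sub>2 R\<^sub>1\<close> inverts
  \<open>T\<^sub>1 + T\<^sub>2 - z\<close> up to \<open>R\<^sub>2 R\<^sub>1 T\<^sub>1 T\<^sub>2\<close>.\<close>

lemma L2_parametrix_sum_if_finite_rank_product:
  assumes T1: "L2_op M T1" and T2: "L2_op M T2" and R1: "L2_op M R1" and R2: "L2_op M R2"
    and RT1: "\<And>f. f \<in> L2_space M \<Longrightarrow> L2_eq M (R1 (\<lambda>x. T1 f x - z * f x)) f"
    and RT2: "\<And>f. f \<in> L2_space M \<Longrightarrow> L2_eq M (R2 (\<lambda>x. T2 f x - z * f x)) f"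
    and TR1: "\<And>f. f \<in> L2_space M \<Longrightarrow> L2_eq M (\<lambda>x. T1 (R1 f) x - z * R1 f x) f"
    and TR2: "\<And>f. f \<in> L2_space M \<Longrightarrow> L2_eq M (\<lambda>x. T2 (R2 f) x - z * R2 f x) f"
    and z: "z \<noteq> 0"
    and u: "\<And>i. i \<in> I \<Longrightarrow> u i \<in> L2_space M" and t: "\<And>i. i \<in> I \<Longrightarrow> t i \<in> L2_space M"
    and rank: "\<And>f. f \<in> L2_space M \<Longrightarrow> L2_eq M (T1 (T2 f)) (\<lambda>x. \<Sum>i\<in>I. L2_inner M f (u i) * t i x)"
  shows "L2_parametrix M (\<lambda>f x. T1 f x + T2 f x) I z"
proof -
  have inj: "L2_eq M g (\<lambda>x. 0)"
    if "L2_op M T" "L2_eq M (\<lambda>x. T (R g) x - z * R g x) g" "R g \<in> L2_space M" "L2_eq M (R g) (\<lambda>x. 0)"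
    for T R g
    using L2_op_null[OF that(1,3,4)] that(2,4) unfolding L2_eq_def by eventually_elim simp
  define R where "R = (\<lambda>f x. - z * R2 (R1 f) x)"
  define S where "S = (\<lambda>f. R2 (R1 f))"
  have S: "L2_op M S"
    unfolding S_def by (rule L2_op_comp[OF R2 R1])
  have R: "L2_op M R"
    using L2_op_lincomb[OF S L2_op_id, of "- z" 0] by (simp add: R_def S_def)
  show ?thesis
    unfolding L2_parametrix_def
  proof (intro exI conjI ballI impI)
    show "L2_op M R" by (rule R)
    show "L2_eq M g (\<lambda>x. 0)" if g: "g \<in> L2_space M" and Rg: "L2_eq M (R g) (\<lambda>x. 0)" for g
    proof -
      note g1 = L2_op_space[OF R1 g]
      have "L2_eq M (R2 (R1 g)) (\<lambda>x. 0)"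
        using Rg z by (simp add: R_def L2_eq_def)
      then have "L2_eq M (R1 g) (\<lambda>x. 0)"
        by (rule inj[of T2 R2, OF T2 TR2[OF g1] L2_op_space[OF R2 g1]])
      then show ?thesis
        by (rule inj[of T1 R1, OF T1 TR1[OF g] g1])
    qed
    show "u i \<in> L2_space M" if "i \<in> I" for i
      by (rule u[OF that])
    show "(\<lambda>x. - S (t i) x) \<in> L2_space M" if "i \<in> I" for i
      using L2_space_scale[OF L2_op_space[OF S t[OF that]], of "-1"] by simp
    fix f assume f: "f \<in> L2_space M"
    let ?a = "\<lambda>x. T1 f x + T2 f x - z * f x"
    define D where "D = (\<lambda>x. T2 f x - z * f x)"
    have mem: "T1 f \<in> L2_space M" "T2 f \<in> L2_space M" "T1 (T2 f) \<in> L2_space M"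
      by (intro L2_op_space[OF T1] L2_op_space[OF T2] f)+
    have D: "D \<in> L2_space M"
      unfolding D_def by (intro L2_space_diff L2_space_scale mem f)
    have a: "?a \<in> L2_space M"
      by (intro L2_space_diff L2_space_add L2_space_scale mem f)
    have T1D: "L2_eq M (T1 D) (\<lambda>x. T1 (T2 f) x - z * T1 f x)"
      using L2_op_diff[OF T1 mem(2) L2_space_scale[OF f, of z]] L2_op_scale[OF T1 f, of z]
      unfolding D_def L2_eq_def by eventually_elim simp
    have "L2_eq M (\<lambda>x. T1 D x - z * D x) (\<lambda>x. T1 (T2 f) x - z * ?a x)"
      using T1D unfolding L2_eq_def by eventually_elim (simp add: D_def algebra_simps)
    then have "L2_eq M (R1 (\<lambda>x. T1 D x - z * D x)) (R1 (\<lambda>x. T1 (T2 f) x - z * ?a x))"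
      by (rule L2_op_cong[OF R1, rotated 2])
        (intro L2_space_diff L2_space_scale mem a D L2_op_space[OF T1])+
    then have 1: "L2_eq M D (R1 (\<lambda>x. T1 (T2 f) x - z * ?a x))"
      by (rule L2_eq_trans[OF L2_eq_sym[OF RT1[OF D]]])
    have "L2_eq M (R2 D) (S (\<lambda>x. T1 (T2 f) x - z * ?a x))"
      unfolding S_def
      by (rule L2_op_cong[OF R2 D _ 1]) (intro L2_op_space[OF R1] L2_space_diff L2_space_scale mem a)
    moreover have "L2_eq M (R2 D) f"
      unfolding D_def by (rule RT2[OF f])
    moreover have "L2_eq M (S (\<lambda>x. T1 (T2 f) x - z * ?a x)) (\<lambda>x. S (T1 (T2 f)) x - z * S ?a x)"
      using L2_op_diff[OF S mem(3) L2_space_scale[OF a, of z]] L2_op_scale[OF S a, of z]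
      unfolding L2_eq_def by eventually_elim simp
    moreover have "L2_eq M (S (T1 (T2 f))) (\<lambda>x. \<Sum>i\<in>I. L2_inner M f (u i) * S (t i) x)"
    proof -
      have "L2_eq M (S (T1 (T2 f))) (S (\<lambda>x. \<Sum>i\<in>I. L2_inner M f (u i) * t i x))"
        by (rule L2_op_cong[OF S mem(3) _ rank[OF f]]) (intro L2_space_sum L2_space_scale t)
      also have "L2_eq M (S (\<lambda>x. \<Sum>i\<in>I. L2_inner M f (u i) * t i x))
          (\<lambda>x. \<Sum>i\<in>I. S (\<lambda>x. L2_inner M f (u i) * t i x) x)"
        by (intro L2_op_sum[OF S] L2_space_scale t)
      also have "L2_eq M (\<lambda>x. \<Sum>i\<in>I. S (\<lambda>x. L2_inner M f (u i) * t i x) x)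
          (\<lambda>x. \<Sum>i\<in>I. L2_inner M f (u i) * S (t i) x)"
        by (rule L2_eq_sum) (rule L2_op_scale[OF S t])
      finally show ?thesis .
    qed
    ultimately show "L2_eq M (R ?a) (\<lambda>x. f x + (\<Sum>i\<in>I. L2_inner M f (u i) * (- S (t i) x)))"
      unfolding L2_eq_def by eventually_elim (simp add: R_def S_def sum_negf algebra_simps)
  qed
qed

section \<open>Essential ranges in essential spectra\<close>

lemma bounded_away_if_not_in_Essran:
  assumes h: "h \<in> borel_measurable M" and z: "z \<notin> complex_of_real ` Essran M h"
  shows "\<exists>\<epsilon>>0. AE x in M. \<epsilon> \<le> cmod (complex_of_real (h x) - z)"
proof (cases "Im z = 0")
  case False
  have "\<bar>Im z\<bar> \<le> cmod (complex_of_real (h x) - z)" for x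
    using abs_Im_le_cmod[of "complex_of_real (h x) - z"] by simp
  then show ?thesis
    using False by (intro exI[of _ "\<bar>Im z\<bar>"]) auto
next
  case True
  then obtain r where z_eq: "z = complex_of_real r"
    by (metis complex_is_Real_iff Reals_cases)
  then have "r \<notin> Essran M h"
    using z by (auto simp: z_eq)
  then obtain \<epsilon> where \<epsilon>: "\<epsilon> > 0" and null: "emeasure M {\<xi> \<in> space M. r - \<epsilon> < h \<xi> \<and> h \<xi> < r + \<epsilon>} = 0"
    by (auto simp: Essran_def)
  have "AE x in M. \<not> (r - \<epsilon> < h x \<and> h x < r + \<epsilon>)"
    by (rule AE_I[OF _ null]) (use h in auto)
  then have "AE x in M. \<epsilon> \<le> cmod (complex_of_real (h x) - z)"
  proof eventually_elim
    case (elim x)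
    then have "\<epsilon> \<le> \<bar>h x - r\<bar>" by auto
    also have "\<dots> = cmod (complex_of_real (h x) - z)"
      unfolding z_eq by (simp flip: of_real_diff)
    finally show ?case .
  qed
  then show ?thesis using \<epsilon> by blast
qed

lemma open_bounded_away: "open {z. \<exists>\<epsilon>>0. AE x in M. \<epsilon> \<le> cmod (q x - z)}"
  unfolding open_dist
proof (intro ballI, clarify)
  fix z and \<epsilon> :: real assume \<epsilon>: "\<epsilon> > 0" "AE x in M. \<epsilon> \<le> cmod (q x - z)"
  show "\<exists>e>0. \<forall>w. dist w z < e \<longrightarrow> w \<in> {z. \<exists>\<epsilon>>0. AE x in M. \<epsilon> \<le> cmod (q x - z)}"
  proof (intro exI[of _ "\<epsilon> / 2"] conjI allI impI CollectI)
    fix w assume w: "dist w z < \<epsilon> / 2"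
    have "AE x in M. \<epsilon> / 2 \<le> cmod (q x - w)"
      using \<epsilon>(2)
    proof eventually_elim
      case (elim x)
      have "cmod (q x - z) \<le> cmod (q x - w) + cmod (w - z)"
        using norm_triangle_ineq[of "q x - w" "w - z"] by simp
      then show ?case
        using elim w by (simp add: dist_norm)
    qed
    then show "AE x in M. \<epsilon> / 2 \<le> cmod (q x - w)" .
  qed (use \<epsilon> in auto)
qed

text \<open>The complement of the essential range is covered by countably many intervals with
  rational end points whose preimages are null sets.\<close>

lemma AE_in_Essran:
  assumes h: "h \<in> borel_measurable M"
  shows "AE x in M. h x \<in> Essran M h"
proof -
  define P where "P = {(r, s). r \<in> \<rat> \<and> s \<in> \<rat> \<and> emeasure M {\<xi> \<in> space M. r < h \<xi> \<and> h \<xi> < s} = 0}"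
  have "countable P"
    by (rule countable_subset[of _ "\<rat> \<times> \<rat>"]) (auto simp: P_def countable_rat)
  moreover have "AE x in M. \<not> (fst p < h x \<and> h x < snd p)" if "p \<in> P" for p
    by (rule AE_I[of _ _ "{\<xi> \<in> space M. fst p < h \<xi> \<and> h \<xi> < snd p}"]) (use that h in \<open>auto simp: P_def\<close>)
  ultimately have "AE x in M. \<forall>p\<in>P. \<not> (fst p < h x \<and> h x < snd p)"
    by (simp add: AE_ball_countable)
  then show ?thesis
  proof eventually_elim
    case (elim x)
    show ?case
    proof (rule ccontr)
      assume "h x \<notin> Essran M h"
      then obtain \<epsilon> where \<epsilon>: "\<epsilon> > 0" "emeasure M {\<xi> \<in> space M. h x - \<epsilon> < h \<xi> \<and> h \<xi> < h x + \<epsilon>} = 0"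
        by (auto simp: Essran_def)
      obtain r s where r: "r \<in> \<rat>" "h x - \<epsilon> < r" "r < h x" and s: "s \<in> \<rat>" "h x < s" "s < h x + \<epsilon>"
        using Rats_dense_in_real[of "h x - \<epsilon>" "h x"] Rats_dense_in_real[of "h x" "h x + \<epsilon>"] \<epsilon>(1) by auto
      have "emeasure M {\<xi> \<in> space M. r < h \<xi> \<and> h \<xi> < s} \<le>
          emeasure M {\<xi> \<in> space M. h x - \<epsilon> < h \<xi> \<and> h \<xi> < h x + \<epsilon>}"
        using r s h by (intro emeasure_mono) auto
      then have "(r, s) \<in> P"
        using \<epsilon> r s by (simp add: P_def)
      then show False
        using elim r s by auto
    qed
  qed
qed

text \<open>A vector of \<open>E\<close> orthogonal to a finite subset of \<open>E\<close> that spans it would be orthogonal to itself.\<close>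

lemma not_L2_finite_dim_if_orthogonal:
  assumes E: "E \<subseteq> L2_space M"
    and ex: "\<And>B. finite B \<Longrightarrow> B \<subseteq> L2_space M \<Longrightarrow>
      \<exists>f\<in>E. \<not> L2_eq M f (\<lambda>x. 0) \<and> (\<forall>b\<in>B. L2_inner M f b = 0)"
  shows "\<not> L2_finite_dim M E"
proof
  assume "L2_finite_dim M E"
  then obtain B where B: "finite B" "B \<subseteq> E"
    and span: "\<And>f. f \<in> E \<Longrightarrow> \<exists>c. L2_eq M f (\<lambda>x. \<Sum>b\<in>B. c b * b x)"
    unfolding L2_finite_dim_def L2_eq_def by blast
  have BL: "b \<in> L2_space M" if "b \<in> B" for b
    using B(2) E that by auto
  obtain f where f: "f \<in> E" "\<not> L2_eq M f (\<lambda>x. 0)" "\<And>b. b \<in> B \<Longrightarrow> L2_inner M f b = 0"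
    using ex[OF B(1)] BL by blast
  obtain c where c: "L2_eq M f (\<lambda>x. \<Sum>b\<in>B. c b * b x)"
    using span[OF f(1)] by blast
  have fL: "f \<in> L2_space M"
    using f(1) E by auto
  have "L2_inner M f f = L2_inner M f (\<lambda>x. \<Sum>b\<in>B. c b * b x)"
    by (rule L2_inner_cong_right[OF c fL _ fL]) (intro L2_space_sum L2_space_scale BL)
  also have "\<dots> = 0"
    using BL f(3) fL by (simp add: L2_inner_sum_right L2_space_scale L2_inner_scale_right)
  finally have "L2_norm M f = 0"
    by (simp add: L2_inner_self)
  then show False
    using f(2) L2_norm_eq_0_iff[OF fL] by blast
qed

lemma infinite_dim_eigenspace_in_essential_spectrum:
  assumes ex: "\<And>B. finite B \<Longrightarrow> B \<subseteq> L2_space M \<Longrightarrow> \<exists>f\<in>L2_space M.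
      L2_eq M (T f) (\<lambda>x. z * f x) \<and> \<not> L2_eq M f (\<lambda>x. 0) \<and> (\<forall>b\<in>B. L2_inner M f b = 0)"
  shows "z \<in> L2_essential_spectrum M T"
proof -
  have "\<not> L2_finite_dim M (L2_eigenspace M T z)"
  proof (rule not_L2_finite_dim_if_orthogonal)
    fix B assume "finite B" "B \<subseteq> L2_space M"
    from ex[OF this] show "\<exists>f\<in>L2_eigenspace M T z. \<not> L2_eq M f (\<lambda>x. 0) \<and> (\<forall>b\<in>B. L2_inner M f b = 0)"
      by (auto simp: L2_eigenspace_def L2_eq_def)
  qed (auto simp: L2_eigenspace_def)
  moreover have "z \<in> L2_spectrum M T"
    using ex[of "{}"] by (auto simp: L2_spectrum_def L2_resolvent_set_def L2_eq_def)
  ultimately show ?thesis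
    by (simp add: L2_essential_spectrum_def L2_discrete_spectrum_def)
qed

text \<open>Suppose that \<open>T\<close> acts as multiplication by \<open>h\<close> on a family of vectors which is rich over
  every set of positive measure. Over a set where \<open>h\<close> is close to \<open>l\<close>, such vectors are
  approximate eigenvectors, so the essential range lies in the spectrum. If \<open>l\<close> is then isolated
  in the spectrum, it is isolated in the essential range, so \<open>h\<close> takes the value \<open>l\<close> on a set of
  positive measure and the eigenspace has infinite dimension.\<close>

theorem Essran_subset_essential_spectrum:
  assumes T: "L2_op M T" and h: "h \<in> borel_measurable N"
    and ex: "\<And>S B. S \<in> sets N \<Longrightarrow> 0 < emeasure N S \<Longrightarrow> finite B \<Longrightarrow> B \<subseteq> L2_space M \<Longrightarrow>
      \<exists>f\<in>L2_space M. L2_eq M (T f) (\<lambda>x. complex_of_real (h (\<pi> x)) * f x) \<and>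
        (\<forall>x. \<pi> x \<notin> S \<longrightarrow> f x = 0) \<and> \<not> L2_eq M f (\<lambda>x. 0) \<and> (\<forall>b\<in>B. L2_inner M f b = 0)"
  shows "complex_of_real ` Essran N h \<subseteq> L2_essential_spectrum M T"
proof -
  have spec: "complex_of_real l \<in> L2_spectrum M T" if l: "l \<in> Essran N h" for l
  proof (rule ccontr)
    assume "complex_of_real l \<notin> L2_spectrum M T"
    then obtain C where C: "\<And>f. f \<in> L2_space M \<Longrightarrow>
        L2_norm M f \<le> C * L2_norm M (\<lambda>x. T f x - complex_of_real l * f x)"
      by (auto simp: L2_spectrum_def L2_resolvent_set_def)
    define \<epsilon> where "\<epsilon> = 1 / (\<bar>C\<bar> + 1)"
    have \<epsilon>: "0 < \<epsilon>" "\<bar>C\<bar> * \<epsilon> < 1"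
      by (auto simp: \<epsilon>_def)
    define S where "S = {\<xi> \<in> space N. l - \<epsilon> < h \<xi> \<and> h \<xi> < l + \<epsilon>}"
    have "S \<in> sets N"
      using h by (simp add: S_def)
    moreover have "0 < emeasure N S"
      using l \<epsilon>(1) by (simp add: S_def Essran_def)
    ultimately obtain f where f: "f \<in> L2_space M"
      and Tf: "L2_eq M (T f) (\<lambda>x. complex_of_real (h (\<pi> x)) * f x)"
      and fS: "\<And>x. \<pi> x \<notin> S \<Longrightarrow> f x = 0" and f0: "\<not> L2_eq M f (\<lambda>x. 0)"
      using ex[of S "{}"] by auto
    have "L2_norm M (\<lambda>x. T f x - complex_of_real l * f x) \<le> \<epsilon> * L2_norm M f"
    proof (rule L2_norm_mono[OF f])
      show "AE x in M. cmod (T f x - complex_of_real l * f x) \<le> \<epsilon> * cmod (f x)"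
        using Tf unfolding L2_eq_def
      proof eventually_elim
        case (elim x)
        show ?case
        proof (cases "\<pi> x \<in> S")
          case True
          have "T f x - complex_of_real l * f x = complex_of_real (h (\<pi> x) - l) * f x"
            using elim by (simp add: algebra_simps)
          moreover have "\<bar>h (\<pi> x) - l\<bar> \<le> \<epsilon>"
            using True by (auto simp: S_def)
          ultimately show ?thesis
            by (auto simp: norm_mult simp del: of_real_diff intro!: mult_right_mono)
        qed (use elim fS in auto)
      qed
    qed (use \<epsilon> in \<open>auto intro!: L2_space_diff L2_space_scale L2_op_space[OF T] f\<close>)
    then have "\<bar>C\<bar> * L2_norm M (\<lambda>x. T f x - complex_of_real l * f x) \<le> \<bar>C\<bar> * (\<epsilon> * L2_norm M f)"
      by (intro mult_left_mono) auto
    moreover have "L2_norm M f \<le> \<bar>C\<bar> * L2_norm M (\<lambda>x. T f x - complex_of_real l * f x)"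
      by (rule order_trans[OF C[OF f]]) (intro mult_right_mono L2_norm_nonneg abs_ge_self)
    ultimately have "L2_norm M f \<le> (\<bar>C\<bar> * \<epsilon>) * L2_norm M f"
      by (simp add: mult.assoc)
    moreover have "0 < L2_norm M f"
      using f0 L2_norm_eq_0_iff[OF f] L2_norm_nonneg[of M f] by (metis less_eq_real_def)
    ultimately show False
      using \<epsilon>(2) by simp
  qed
  have not_discrete: "complex_of_real l \<notin> L2_discrete_spectrum M T" if l: "l \<in> Essran N h" for l
  proof
    assume discr: "complex_of_real l \<in> L2_discrete_spectrum M T"
    then obtain e where e: "e > 0"
      and iso: "\<And>w. w \<in> L2_spectrum M T \<Longrightarrow> dist (complex_of_real l) w < e \<Longrightarrow> w = complex_of_real l"
      by (auto simp: L2_discrete_spectrum_def isolated_in_dist_Ex_iff)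
    define S where "S = {\<xi> \<in> space N. h \<xi> = l}"
    have S: "S \<in> sets N"
      using h by (simp add: S_def)
    have "AE x in N. l - e < h x \<and> h x < l + e \<longleftrightarrow> h x = l"
      using AE_in_Essran[OF h]
    proof eventually_elim
      case (elim x)
      have "h x = l" if "l - e < h x" "h x < l + e"
      proof -
        have "dist (complex_of_real l) (complex_of_real (h x)) < e"
          using that by (simp add: dist_norm del: of_real_diff flip: of_real_diff)
        from iso[OF spec[OF elim] this] show ?thesis
          by (simp only: of_real_eq_iff)
      qed
      then show ?case using e by auto
    qed
    then have "emeasure N {\<xi> \<in> space N. l - e < h \<xi> \<and> h \<xi> < l + e} = emeasure N S"
      using h unfolding S_def by (intro emeasure_eq_AE) auto
    then have pos: "0 < emeasure N S"
      using l e by (auto simp: Essran_def)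
    have "complex_of_real l \<in> L2_essential_spectrum M T"
    proof (rule infinite_dim_eigenspace_in_essential_spectrum)
      fix B assume B: "finite B" "B \<subseteq> L2_space M"
      obtain f where f: "f \<in> L2_space M" "L2_eq M (T f) (\<lambda>x. complex_of_real (h (\<pi> x)) * f x)"
        "\<And>x. \<pi> x \<notin> S \<Longrightarrow> f x = 0" "\<not> L2_eq M f (\<lambda>x. 0)" "\<forall>b\<in>B. L2_inner M f b = 0"
        using ex[OF S pos B] by blast
      have "(\<lambda>x. complex_of_real (h (\<pi> x)) * f x) = (\<lambda>x. complex_of_real l * f x)"
      proof
        show "complex_of_real (h (\<pi> x)) * f x = complex_of_real l * f x" for x
          using f(3)[of x] by (cases "\<pi> x \<in> S") (auto simp: S_def)
      qed
      with f show "\<exists>f\<in>L2_space M. L2_eq M (T f) (\<lambda>x. complex_of_real l * f x) \<and>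
          \<not> L2_eq M f (\<lambda>x. 0) \<and> (\<forall>b\<in>B. L2_inner M f b = 0)"
        by auto
    qed
    then show False
      using discr by (simp add: L2_essential_spectrum_def)
  qed
  show ?thesis
    using spec not_discrete by (auto simp: L2_essential_spectrum_def)
qed

section \<open>Product of two completed finite measures\<close>

lemma completion_ex_borel_measurable_complex:
  fixes f :: "'a \<Rightarrow> complex"
  assumes "f \<in> borel_measurable (completion M)"
  shows "\<exists>f'\<in>borel_measurable M. AE x in M. f x = f' x"
proof -
  have "(\<lambda>x. Re (f x)) \<in> borel_measurable (completion M)" "(\<lambda>x. Im (f x)) \<in> borel_measurable (completion M)"
    using assms by measurable
  then obtain r i where ri: "r \<in> borel_measurable M" "i \<in> borel_measurable M"
    and "AE x in M. Re (f x) = r x" "AE x in M. Im (f x) = i x"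
    by (blast dest: completion_ex_borel_measurable_real)
  then have "AE x in M. f x = Complex (r x) (i x)"
    by (auto elim: eventually_elim2 simp: complex_eq_iff)
  moreover have "(\<lambda>x. Complex (r x) (i x)) \<in> borel_measurable M"
    using ri unfolding Complex_eq by measurable
  ultimately show ?thesis by (rule bexI)
qed

lemma borel_measurable_completion_if_AE:
  assumes g: "g \<in> borel_measurable (completion M)" and ae: "AE x in M. f x = g x"
  shows "f \<in> borel_measurable (completion M)"
proof (rule measurableI)
  fix A :: "'b set" assume A: "A \<in> sets borel"
  show "f -` A \<inter> space (completion M) \<in> sets (completion M)"
  proof (rule completion.in_sets_AE)
    show "AE x in completion M. x \<in> g -` A \<inter> space (completion M) \<longleftrightarrow> x \<in> f -` A \<inter> space (completion M)"
      using AE_completion[OF ae] by eventually_elim simp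
    show "g -` A \<inter> space (completion M) \<in> sets (completion M)"
      using g A by (rule measurable_sets)
  qed auto
qed auto

lemma integral_completion_AE:
  fixes f :: "'a \<Rightarrow> 'b::{banach, second_countable_topology}"
  assumes g: "g \<in> borel_measurable M" and ae: "AE x in M. f x = g x"
  shows "integrable (completion M) f \<longleftrightarrow> integrable M g"
    and "integral\<^sup>L (completion M) f = integral\<^sup>L M g"
proof -
  have f: "f \<in> borel_measurable (completion M)"
    using borel_measurable_completion_if_AE[OF measurable_completion[OF g] ae] .
  show "integrable (completion M) f \<longleftrightarrow> integrable M g"
    unfolding integrable_completion[OF g, symmetric]
    using f measurable_completion[OF g] AE_completion[OF ae] by (rule integrable_cong_AE)
  show "integral\<^sup>L (completion M) f = integral\<^sup>L M g"
    unfolding integral_completion[OF g, symmetric]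
    using f measurable_completion[OF g] AE_completion[OF ae] by (rule integral_cong_AE)
qed

lemma (in pair_sigma_finite) AE_pair_snd:
  assumes "AE z in M1 \<Otimes>\<^sub>M M2. P z"
  shows "AE y in M2. AE x in M1. P (x, y)"
proof -
  interpret Q: pair_sigma_finite M2 M1 ..
  have "AE z in M2 \<Otimes>\<^sub>M M1. P (case z of (x, y) \<Rightarrow> (y, x))"
    using assms by (subst (asm) distr_pair_swap) (rule AE_distrD[OF measurable_pair_swap'])
  then show ?thesis
    using Q.AE_pair by fastforce
qed

text \<open>A function measurable for the completed product is replaced by \<open>G\<close>, which is measurable for the
  product itself, so that Fubini's theorem applies; almost all sections of the two functions
  agree almost everywhere.\<close>

lemma (in pair_sigma_finite) Fubini_completion_AE:
  fixes F :: "'a \<times> 'b \<Rightarrow> 'c::{banach, second_countable_topology}"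
  assumes G: "G \<in> borel_measurable (M1 \<Otimes>\<^sub>M M2)" and ae: "AE z in M1 \<Otimes>\<^sub>M M2. F z = G z"
    and F: "integrable (completion (M1 \<Otimes>\<^sub>M M2)) F"
  shows "AE y in M2. integrable (completion M1) (\<lambda>x. F (x, y))"
    and "integrable (completion M2) (\<lambda>y. LINT x|completion M1. F (x, y))"
    and "(LINT y|completion M2. LINT x|completion M1. F (x, y)) = integral\<^sup>L (completion (M1 \<Otimes>\<^sub>M M2)) F"
proof -
  interpret Q: pair_sigma_finite M2 M1 ..
  have intG: "integrable (M1 \<Otimes>\<^sub>M M2) (case_prod (\<lambda>x y. G (x, y)))"
    using F integral_completion_AE(1)[OF G ae] by simp
  have meas: "(\<lambda>x. G (x, y)) \<in> borel_measurable M1" if "y \<in> space M2" for y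
    using G that by measurable
  have AE2: "AE y in M2. y \<in> space M2 \<and> (AE x in M1. F (x, y) = G (x, y))"
    using AE_pair_snd[OF ae] by auto
  show "AE y in M2. integrable (completion M1) (\<lambda>x. F (x, y))"
    using AE2 AE_integrable_snd[OF intG]
  proof eventually_elim
    case (elim y)
    then show ?case
      using integral_completion_AE(1)[OF meas[of y], of "\<lambda>x. F (x, y)"] by simp
  qed
  have eq: "AE y in M2. (LINT x|completion M1. F (x, y)) = (LINT x|M1. G (x, y))"
    using AE2
  proof eventually_elim
    case (elim y)
    then show ?case
      using integral_completion_AE(2)[OF meas[of y], of "\<lambda>x. F (x, y)"] by simp
  qed
  note iG = integrable_snd[OF intG]
  show "integrable (completion M2) (\<lambda>y. LINT x|completion M1. F (x, y))"
    using iG integral_completion_AE(1)[OF borel_measurable_integrable[OF iG] eq] by simp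
  show "(LINT y|completion M2. LINT x|completion M1. F (x, y)) = integral\<^sup>L (completion (M1 \<Otimes>\<^sub>M M2)) F"
    using integral_completion_AE(2)[OF borel_measurable_integrable[OF iG] eq]
      integral_completion_AE(2)[OF G ae] integral_snd[OF intG] by simp
qed

definition tensor :: "('a \<Rightarrow> complex) \<Rightarrow> ('b \<Rightarrow> complex) \<Rightarrow> 'a \<times> 'b \<Rightarrow> complex" where
  "tensor u v = (\<lambda>z. u (fst z) * v (snd z))"

text \<open>The \<open>u\<close>-coefficient of each slice \<open>s \<mapsto> f (s, y)\<close>. As a map in \<open>f\<close> it is the adjoint of
  \<open>v \<mapsto> tensor u v\<close>.\<close>

definition slice_coeff :: "'a measure \<Rightarrow> ('a \<Rightarrow> complex) \<Rightarrow> ('a \<times> 'b \<Rightarrow> complex) \<Rightarrow> 'b \<Rightarrow> complex" where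
  "slice_coeff N u f = (\<lambda>y. LINT s|N. f (s, y) * cnj (u s))"

text \<open>Finiteness of the measures makes constants square-integrable, so that \<open>f (s, y) * cnj (u s)\<close> is
  integrable on the product for square-integrable \<open>f\<close> and \<open>u\<close>.\<close>

locale finite_measure_pair = M1: finite_measure M1 + M2: finite_measure M2
  for M1 :: "'a measure" and M2 :: "'b measure"
begin

sublocale pair_sigma_finite M1 M2 ..

abbreviation "X \<equiv> completion M1"
abbreviation "Y \<equiv> completion M2"
abbreviation "XY \<equiv> completion (M1 \<Otimes>\<^sub>M M2)"

lemma swapped: "finite_measure_pair M2 M1"
  ..

lemma Fubini_complex:
  fixes F :: "'a \<times> 'b \<Rightarrow> complex"
  assumes F: "integrable XY F"
  shows "AE y in Y. integrable X (\<lambda>x. F (x, y))"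
    and "integrable Y (\<lambda>y. LINT x|X. F (x, y))"
    and "(LINT y|Y. LINT x|X. F (x, y)) = integral\<^sup>L XY F"
proof -
  obtain G where G: "G \<in> borel_measurable (M1 \<Otimes>\<^sub>M M2)" "AE z in M1 \<Otimes>\<^sub>M M2. F z = G z"
    using completion_ex_borel_measurable_complex[OF borel_measurable_integrable[OF F]] by blast
  note * = Fubini_completion_AE[OF G F]
  show "AE y in Y. integrable X (\<lambda>x. F (x, y))"
    by (rule AE_completion[OF *(1)])
  show "integrable Y (\<lambda>y. LINT x|X. F (x, y))" "(LINT y|Y. LINT x|X. F (x, y)) = integral\<^sup>L XY F"
    by (fact *(2,3))+
qed

lemma Fubini_real:
  fixes F :: "'a \<times> 'b \<Rightarrow> real"
  assumes F: "integrable XY F"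
  shows "AE y in Y. integrable X (\<lambda>x. F (x, y))"
    and "integrable Y (\<lambda>y. LINT x|X. F (x, y))"
    and "(LINT y|Y. LINT x|X. F (x, y)) = integral\<^sup>L XY F"
proof -
  obtain G where G: "G \<in> borel_measurable (M1 \<Otimes>\<^sub>M M2)" "AE z in M1 \<Otimes>\<^sub>M M2. F z = G z"
    using completion_ex_borel_measurable_real[OF borel_measurable_integrable[OF F]] by blast
  note * = Fubini_completion_AE[OF G F]
  show "AE y in Y. integrable X (\<lambda>x. F (x, y))"
    by (rule AE_completion[OF *(1)])
  show "integrable Y (\<lambda>y. LINT x|X. F (x, y))" "(LINT y|Y. LINT x|X. F (x, y)) = integral\<^sup>L XY F"
    by (fact *(2,3))+
qed

lemma fst_null_sets: "N \<in> null_sets M1 \<Longrightarrow> N \<in> null_sets (distr XY M1 fst)"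
proof -
  assume N: "N \<in> null_sets M1"
  have "fst -` N \<inter> space (M1 \<Otimes>\<^sub>M M2) = N \<times> space M2"
    using sets.sets_into_space[of N M1] N by (auto simp: space_pair_measure)
  then show ?thesis
    using N by (auto simp: null_sets_def emeasure_distr measurable_completion M2.emeasure_pair_measure_Times)
qed

lemma measurable_fst_XY: "fst \<in> XY \<rightarrow>\<^sub>M X"
  by (rule completion.measurable_completion2) (use fst_null_sets in \<open>auto intro: measurable_completion\<close>)

lemma AE_fst_XY:
  assumes "AE x in X. P x"
  shows "AE z in XY. P (fst z)"
proof -
  have "AE x in M1. P x"
    using assms by (simp add: AE_completion_iff)
  then obtain N where N: "N \<in> null_sets M1" "{x \<in> space M1. \<not> P x} \<subseteq> N"
    by (auto elim: AE_E simp: null_sets_def)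
  have "N \<times> space M2 \<in> null_sets (M1 \<Otimes>\<^sub>M M2)"
    using N by (auto simp: null_sets_def M2.emeasure_pair_measure_Times)
  then have "AE z in M1 \<Otimes>\<^sub>M M2. P (fst z)"
    by (rule AE_I') (use N(2) in \<open>auto simp: space_pair_measure\<close>)
  then show ?thesis
    by (rule AE_completion)
qed

lemma snd_null_sets: "N \<in> null_sets M2 \<Longrightarrow> N \<in> null_sets (distr XY M2 snd)"
proof -
  assume N: "N \<in> null_sets M2"
  have "snd -` N \<inter> space (M1 \<Otimes>\<^sub>M M2) = space M1 \<times> N"
    using sets.sets_into_space[of N M2] N by (auto simp: space_pair_measure)
  then show ?thesis
    using N by (auto simp: null_sets_def emeasure_distr measurable_completion M2.emeasure_pair_measure_Times)
qed

lemma measurable_snd_XY: "snd \<in> XY \<rightarrow>\<^sub>M Y"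
  by (rule completion.measurable_completion2) (use snd_null_sets in \<open>auto intro: measurable_completion\<close>)

lemma AE_snd_XY:
  assumes "AE y in Y. P y"
  shows "AE z in XY. P (snd z)"
proof -
  have "AE y in M2. P y"
    using assms by (simp add: AE_completion_iff)
  then obtain N where N: "N \<in> null_sets M2" "{y \<in> space M2. \<not> P y} \<subseteq> N"
    by (auto elim: AE_E simp: null_sets_def)
  have "space M1 \<times> N \<in> null_sets (M1 \<Otimes>\<^sub>M M2)"
    using N by (auto simp: null_sets_def M2.emeasure_pair_measure_Times)
  then have "AE z in M1 \<Otimes>\<^sub>M M2. P (snd z)"
    by (rule AE_I') (use N(2) in \<open>auto simp: space_pair_measure\<close>)
  then show ?thesis
    by (rule AE_completion)
qed

lemma integrable_product_XY:
  fixes f :: "'a \<Rightarrow> real" and g :: "'b \<Rightarrow> real"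
  assumes f: "integrable X f" and g: "integrable Y g"
  shows "integrable XY (\<lambda>z. f (fst z) * g (snd z))"
proof -
  obtain f' where f': "f' \<in> borel_measurable M1" "AE x in M1. f x = f' x"
    using completion_ex_borel_measurable_real[OF borel_measurable_integrable[OF f]] by blast
  obtain g' where g': "g' \<in> borel_measurable M2" "AE x in M2. g x = g' x"
    using completion_ex_borel_measurable_real[OF borel_measurable_integrable[OF g]] by blast
  have i: "integrable M1 f'" "integrable M2 g'"
    using f g integral_completion_AE(1)[OF f'] integral_completion_AE(1)[OF g'] by auto
  have int: "integrable (M1 \<Otimes>\<^sub>M M2) (\<lambda>z. f' (fst z) * g' (snd z))"
    by (rule Fubini_integrable) (use i f'(1) g'(1) in \<open>auto simp: abs_mult\<close>)
  have ae: "AE z in M1 \<Otimes>\<^sub>M M2. f (fst z) * g (snd z) = f' (fst z) * g' (snd z)"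
    using AE_fst_XY[OF AE_completion[OF f'(2)]] AE_snd_XY[OF AE_completion[OF g'(2)]]
    unfolding AE_completion_iff by eventually_elim simp
  show ?thesis
    using int integral_completion_AE(1)[OF borel_measurable_integrable[OF int] ae] by simp
qed

lemma tensor_L2:
  assumes u: "u \<in> L2_space X" and v: "v \<in> L2_space Y"
  shows "tensor u v \<in> L2_space XY"
proof -
  have "tensor u v \<in> borel_measurable XY"
    unfolding tensor_def
    using measurable_compose[OF measurable_fst_XY L2_spaceD(1)[OF u]]
      measurable_compose[OF measurable_snd_XY L2_spaceD(1)[OF v]] by measurable
  moreover have "integrable XY (\<lambda>z. (cmod (u (fst z)))\<^sup>2 * (cmod (v (snd z)))\<^sup>2)"
    by (rule integrable_product_XY) (use L2_spaceD(2) u v in auto)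
  ultimately show ?thesis
    by (simp add: L2_space_def tensor_def norm_mult power_mult_distrib)
qed

lemma one_L2: "(\<lambda>x. 1) \<in> L2_space X" "(\<lambda>x. 1) \<in> L2_space Y"
  by (auto simp: L2_space_def integrable_completion)

lemma slice_integrable:
  assumes f: "f \<in> L2_space XY" and u: "u \<in> L2_space X"
  shows "AE y in Y. integrable X (\<lambda>x. f (x, y) * cnj (u x))"
    and "slice_coeff X u f \<in> borel_measurable Y"
proof -
  have "integrable XY (\<lambda>z. f z * cnj (tensor u (\<lambda>_. 1) z))"
    by (intro L2_product_integrable tensor_L2 f u one_L2)
  from Fubini_complex[OF this] show "AE y in Y. integrable X (\<lambda>x. f (x, y) * cnj (u x))"
    "slice_coeff X u f \<in> borel_measurable Y"
    by (auto simp: tensor_def slice_coeff_def dest: borel_measurable_integrable)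
qed

lemma slice_in_L2:
  assumes f: "f \<in> L2_space XY"
  shows "AE y in Y. (\<lambda>x. f (x, y)) \<in> L2_space X"
  using slice_integrable(1)[OF f one_L2(1)] Fubini_real(1)[OF L2_spaceD(2)[OF f]]
  by eventually_elim (auto simp: L2_space_def dest: borel_measurable_integrable)

lemma slice_coeff_L2_bound:
  assumes f: "f \<in> L2_space XY" and u: "u \<in> L2_space X"
  shows "slice_coeff X u f \<in> L2_space Y"
    and "L2_norm Y (slice_coeff X u f) \<le> L2_norm X u * L2_norm XY f"
proof -
  note FR = Fubini_real[OF L2_spaceD(2)[OF f]]
  let ?b = "\<lambda>y. (L2_norm X u)\<^sup>2 * (LINT x|X. (cmod (f (x, y)))\<^sup>2)"
  have bound: "AE y in Y. (cmod (slice_coeff X u f y))\<^sup>2 \<le> ?b y"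
    using slice_in_L2[OF f]
  proof eventually_elim
    case (elim y)
    have "cmod (slice_coeff X u f y) \<le> L2_norm X (\<lambda>x. f (x, y)) * L2_norm X u"
      using L2_Cauchy_Schwarz[OF elim u] by (simp add: slice_coeff_def L2_inner_def)
    then have "(cmod (slice_coeff X u f y))\<^sup>2 \<le> (L2_norm X (\<lambda>x. f (x, y)) * L2_norm X u)\<^sup>2"
      by (intro power_mono) auto
    then show ?case
      by (simp add: power_mult_distrib L2_norm_square mult.commute)
  qed
  have b: "integrable Y ?b"
    using FR(2) by simp
  have "integrable Y (\<lambda>y. (cmod (slice_coeff X u f y))\<^sup>2)"
  proof (rule Bochner_Integration.integrable_bound[OF b])
    show "AE y in Y. norm ((cmod (slice_coeff X u f y))\<^sup>2) \<le> norm (?b y)"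
      using bound by eventually_elim (auto intro: order_trans[OF _ abs_ge_self])
  qed (use slice_integrable(2)[OF f u] in measurable)
  then show L2: "slice_coeff X u f \<in> L2_space Y"
    using slice_integrable(2)[OF f u] by (simp add: L2_space_def)
  have "(L2_norm Y (slice_coeff X u f))\<^sup>2 \<le> integral\<^sup>L Y ?b"
    unfolding L2_norm_square[of Y] by (rule integral_mono_AE[OF L2_spaceD(2)[OF L2] b bound])
  also have "\<dots> = (L2_norm X u * L2_norm XY f)\<^sup>2"
    by (simp add: power_mult_distrib L2_norm_square[of XY f] FR(3))
  finally show "L2_norm Y (slice_coeff X u f) \<le> L2_norm X u * L2_norm XY f"
    by (rule power2_le_imp_le) (simp add: L2_norm_nonneg)
qed

lemma slice_coeff_adjoint:
  assumes f: "f \<in> L2_space XY" and u: "u \<in> L2_space X" and v: "v \<in> L2_space Y"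
  shows "L2_inner Y (slice_coeff X u f) v = L2_inner XY f (tensor u v)"
proof -
  have "L2_inner XY f (tensor u v) = (LINT y|Y. LINT x|X. f (x, y) * cnj (tensor u v (x, y)))"
    unfolding L2_inner_def
    by (rule Fubini_complex(3)[symmetric]) (intro L2_product_integrable tensor_L2 f u v)
  also have "\<dots> = L2_inner Y (slice_coeff X u f) v"
    by (simp add: tensor_def slice_coeff_def L2_inner_def flip: mult.assoc)
  finally show ?thesis ..
qed

lemma tensor_inner:
  assumes f: "f \<in> L2_space XY" and u: "u \<in> L2_space X" and v: "v \<in> L2_space Y"
  shows "L2_inner XY (tensor u v) f = L2_inner Y v (slice_coeff X u f)"
  using slice_coeff_adjoint[OF f u v] by (metis L2_inner_cnj)

lemma slice_coeff_tensor: "slice_coeff X u (tensor u' v) = (\<lambda>y. L2_inner X u' u * v y)"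
proof
  fix y
  have "slice_coeff X u (tensor u' v) y = (LINT s|X. v y * (u' s * cnj (u s)))"
    unfolding slice_coeff_def tensor_def by (rule Bochner_Integration.integral_cong) auto
  then show "slice_coeff X u (tensor u' v) y = L2_inner X u' u * v y"
    by (simp add: L2_inner_def mult.commute)
qed

lemma tensor_norm:
  assumes u: "u \<in> L2_space X" and v: "v \<in> L2_space Y"
  shows "L2_norm XY (tensor u v) = L2_norm X u * L2_norm Y v"
proof -
  have "L2_inner XY (tensor u v) (tensor u v) = cnj (L2_inner X u u) * L2_inner Y v v"
    using tensor_inner[OF tensor_L2[OF u v] u v] by (simp add: slice_coeff_tensor L2_inner_scale_right)
  then have "complex_of_real ((L2_norm XY (tensor u v))\<^sup>2) = complex_of_real ((L2_norm X u * L2_norm Y v)\<^sup>2)"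
    by (simp add: L2_inner_self power_mult_distrib)
  then have "(L2_norm XY (tensor u v))\<^sup>2 = (L2_norm X u * L2_norm Y v)\<^sup>2"
    by (simp only: of_real_eq_iff)
  then show ?thesis
    by (simp add: L2_norm_nonneg)
qed

lemma tensor_not_null:
  assumes u: "u \<in> L2_space X" and v: "v \<in> L2_space Y"
    and "\<not> L2_eq X u (\<lambda>x. 0)" "\<not> L2_eq Y v (\<lambda>x. 0)"
  shows "\<not> L2_eq XY (tensor u v) (\<lambda>x. 0)"
  using assms L2_norm_eq_0_iff[OF u] L2_norm_eq_0_iff[OF v] L2_norm_eq_0_iff[OF tensor_L2[OF u v]]
  by (simp add: tensor_norm)

lemma slice_coeff_linear:
  assumes f: "f \<in> L2_space XY" and g: "g \<in> L2_space XY" and u: "u \<in> L2_space X"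
  shows "L2_eq Y (slice_coeff X u (\<lambda>z. c * f z + g z)) (\<lambda>y. c * slice_coeff X u f y + slice_coeff X u g y)"
proof (rule L2_eq_if_inner_eq)
  fix w assume "w \<in> L2_space Y"
  then show "L2_inner Y (slice_coeff X u (\<lambda>z. c * f z + g z)) w =
      L2_inner Y (\<lambda>y. c * slice_coeff X u f y + slice_coeff X u g y) w"
    using f g u
    by (simp add: slice_coeff_adjoint L2_inner_add_left L2_inner_scale_left L2_space_closed
        slice_coeff_L2_bound(1) tensor_L2)
qed (intro L2_space_closed slice_coeff_L2_bound(1) f g u)+

subsection \<open>Exchanging the factors\<close>

lemma measurable_swap_XY: "prod.swap \<in> completion (M2 \<Otimes>\<^sub>M M1) \<rightarrow>\<^sub>M XY"
  and distr_swap_XY: "distr (completion (M2 \<Otimes>\<^sub>M M1)) XY prod.swap = XY"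
proof -
  have swap: "prod.swap = (\<lambda>(x, y). (y, x))"
    by auto
  have m: "prod.swap \<in> completion (M2 \<Otimes>\<^sub>M M1) \<rightarrow>\<^sub>M M1 \<Otimes>\<^sub>M M2"
    unfolding swap by (intro measurable_completion measurable_pair_swap')
  have d: "distr (completion (M2 \<Otimes>\<^sub>M M1)) (M1 \<Otimes>\<^sub>M M2) prod.swap = M1 \<Otimes>\<^sub>M M2"
    unfolding swap by (subst distr_completion) (auto simp: measurable_pair_swap' distr_pair_swap[symmetric])
  show "prod.swap \<in> completion (M2 \<Otimes>\<^sub>M M1) \<rightarrow>\<^sub>M XY"
    by (rule completion.measurable_completion2[OF m]) (simp add: d)
  show "distr (completion (M2 \<Otimes>\<^sub>M M1)) XY prod.swap = XY"
    using completion.completion_distr_eq[OF m] by (simp add: d)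
qed

lemma swap_L2:
  assumes f: "f \<in> L2_space XY"
  shows "f \<circ> prod.swap \<in> L2_space (completion (M2 \<Otimes>\<^sub>M M1))"
proof -
  have "integrable (completion (M2 \<Otimes>\<^sub>M M1)) (\<lambda>z. (cmod (f (prod.swap z)))\<^sup>2)"
  proof (rule integrable_distr[OF measurable_swap_XY])
    show "integrable (distr (completion (M2 \<Otimes>\<^sub>M M1)) XY prod.swap) (\<lambda>z. (cmod (f z))\<^sup>2)"
      unfolding distr_swap_XY by (rule L2_spaceD(2)[OF f])
  qed
  then show ?thesis
    using measurable_comp[OF measurable_swap_XY L2_spaceD(1)[OF f]] by (simp add: L2_space_def)
qed

lemma swap_inner:
  assumes f: "f \<in> L2_space XY" and g: "g \<in> L2_space XY"
  shows "L2_inner (completion (M2 \<Otimes>\<^sub>M M1)) (f \<circ> prod.swap) (g \<circ> prod.swap) = L2_inner XY f g"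
proof -
  have "(LINT z|distr (completion (M2 \<Otimes>\<^sub>M M1)) XY prod.swap. f z * cnj (g z)) =
      (LINT z|completion (M2 \<Otimes>\<^sub>M M1). f (prod.swap z) * cnj (g (prod.swap z)))"
    by (rule integral_distr[OF measurable_swap_XY])
      (intro borel_measurable_integrable L2_product_integrable f g)
  then show ?thesis
    by (simp add: distr_swap_XY L2_inner_def)
qed

lemma swap_norm:
  assumes f: "f \<in> L2_space XY"
  shows "L2_norm (completion (M2 \<Otimes>\<^sub>M M1)) (f \<circ> prod.swap) = L2_norm XY f"
proof -
  have "(L2_norm (completion (M2 \<Otimes>\<^sub>M M1)) (f \<circ> prod.swap))\<^sup>2 = (L2_norm XY f)\<^sup>2"
    using swap_inner[OF f f] by (simp add: L2_inner_self del: of_real_power)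
  then show ?thesis
    by (simp add: L2_norm_nonneg)
qed

lemma swap_eq:
  assumes "L2_eq XY f g"
  shows "L2_eq (completion (M2 \<Otimes>\<^sub>M M1)) (f \<circ> prod.swap) (g \<circ> prod.swap)"
proof -
  have "AE z in distr (completion (M2 \<Otimes>\<^sub>M M1)) XY prod.swap. f z = g z"
    using assms unfolding distr_swap_XY L2_eq_def .
  from AE_distrD[OF measurable_swap_XY this] show ?thesis
    by (simp add: L2_eq_def)
qed

lemma swap_op:
  assumes T: "L2_op (completion (M2 \<Otimes>\<^sub>M M1)) T"
  shows "L2_op XY (\<lambda>f. T (f \<circ> prod.swap) \<circ> prod.swap)"
proof -
  interpret S: finite_measure_pair M2 M1 by (rule swapped)
  show ?thesis
    unfolding L2_op_def
  proof (intro conjI ballI allI)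
    show "T (f \<circ> prod.swap) \<circ> prod.swap \<in> L2_space XY" if "f \<in> L2_space XY" for f
      by (intro S.swap_L2 L2_op_space[OF T] swap_L2 that)
    show "L2_eq XY (T ((\<lambda>x. c * f x + g x) \<circ> prod.swap) \<circ> prod.swap)
        (\<lambda>x. c * (T (f \<circ> prod.swap) \<circ> prod.swap) x + (T (g \<circ> prod.swap) \<circ> prod.swap) x)"
      if "f \<in> L2_space XY" "g \<in> L2_space XY" for f g c
      using S.swap_eq[OF L2_op_linear[OF T swap_L2[OF that(1)] swap_L2[OF that(2)], of c]]
      by (simp add: o_def)
    obtain C where C: "0 \<le> C" "\<And>f. f \<in> L2_space (completion (M2 \<Otimes>\<^sub>M M1)) \<Longrightarrow>
        L2_norm (completion (M2 \<Otimes>\<^sub>M M1)) (T f) \<le> C * L2_norm (completion (M2 \<Otimes>\<^sub>M M1)) f"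
      using L2_op_bound[OF T] by blast
    show "\<exists>C\<ge>0. \<forall>f\<in>L2_space XY. L2_norm XY (T (f \<circ> prod.swap) \<circ> prod.swap) \<le> C * L2_norm XY f"
      using C S.swap_norm swap_norm L2_op_space[OF T] swap_L2 by (intro exI[of _ C]) metis
  qed
qed

end

section \<open>Operators acting along fibres\<close>

text \<open>For orthonormal \<open>\<phi>\<close> this is multiplication by \<open>q k (y)\<close> on the subspace \<open>\<phi> k \<otimes> L\<^sub>2\<close>, and it
  vanishes on the orthogonal complement of these subspaces. So the operators compose by pointwise
  multiplication of the \<open>q k\<close>.\<close>

definition fibre_op :: "'a measure \<Rightarrow> 'i set \<Rightarrow> ('i \<Rightarrow> 'a \<Rightarrow> complex) \<Rightarrow> ('i \<Rightarrow> 'b \<Rightarrow> complex) \<Rightarrow>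
    ('a \<times> 'b \<Rightarrow> complex) \<Rightarrow> 'a \<times> 'b \<Rightarrow> complex" where
  "fibre_op N I \<phi> q f = (\<lambda>z. \<Sum>k\<in>I. tensor (\<phi> k) (\<lambda>y. q k y * slice_coeff N (\<phi> k) f y) z)"

definition ess_bounded :: "'a measure \<Rightarrow> ('a \<Rightarrow> complex) \<Rightarrow> bool" where
  "ess_bounded M q \<longleftrightarrow> q \<in> borel_measurable M \<and> (\<exists>C. AE x in M. cmod (q x) \<le> C)"

lemma ess_bounded_nonneg:
  assumes "ess_bounded M q"
  obtains C where "0 \<le> C" "AE x in M. cmod (q x) \<le> C"
proof -
  obtain C where "AE x in M. cmod (q x) \<le> C"
    using assms by (auto simp: ess_bounded_def)
  then have "AE x in M. cmod (q x) \<le> max C 0"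
    by eventually_elim simp
  then show thesis by (intro that[of "max C 0"]) auto
qed

lemma ess_bounded_mult_L2: "ess_bounded M q \<Longrightarrow> f \<in> L2_space M \<Longrightarrow> (\<lambda>x. q x * f x) \<in> L2_space M"
  by (auto simp: ess_bounded_def intro: L2_space_bounded_mult)

lemma ess_bounded_of_real:
  "ess_bounded_measurable M g \<Longrightarrow> ess_bounded M (\<lambda>x. complex_of_real (g x))"
  by (auto simp: ess_bounded_def ess_bounded_measurable_def)

lemma L2_orthonormalD:
  assumes "L2_orthonormal M I e" "i \<in> I"
  shows "e i \<in> L2_space M" "\<And>j. j \<in> I \<Longrightarrow> L2_inner M (e i) (e j) = (if i = j then 1 else 0)"
  using assms by (auto simp: L2_orthonormal_def)

context finite_measure_pair
begin

lemma fibre_term_L2: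
  assumes "L2_orthonormal X I \<phi>" "k \<in> I" "ess_bounded Y (q k)" "f \<in> L2_space XY"
  shows "(\<lambda>y. q k y * slice_coeff X (\<phi> k) f y) \<in> L2_space Y"
  using assms by (intro ess_bounded_mult_L2 slice_coeff_L2_bound(1)) (auto dest: L2_orthonormalD)

lemma fibre_op_L2:
  assumes "L2_orthonormal X I \<phi>" "\<And>k. k \<in> I \<Longrightarrow> ess_bounded Y (q k)" "f \<in> L2_space XY"
  shows "fibre_op X I \<phi> q f \<in> L2_space XY"
  unfolding fibre_op_def
  by (intro L2_space_sum tensor_L2 fibre_term_L2[OF assms(1)] assms L2_orthonormalD(1)[OF assms(1)])

lemma fibre_op_inner:
  assumes \<phi>: "L2_orthonormal X I \<phi>" and q: "\<And>k. k \<in> I \<Longrightarrow> ess_bounded Y (q k)"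
    and f: "f \<in> L2_space XY" and w: "w \<in> L2_space XY"
  shows "L2_inner XY (fibre_op X I \<phi> q f) w =
    (\<Sum>k\<in>I. L2_inner Y (\<lambda>y. q k y * slice_coeff X (\<phi> k) f y) (slice_coeff X (\<phi> k) w))"
proof -
  have [simp]: "(\<lambda>y. q k y * slice_coeff X (\<phi> k) f y) \<in> L2_space Y" if "k \<in> I" for k
    by (rule fibre_term_L2[where q = q, OF \<phi> that q[OF that] f])
  note [simp] = L2_orthonormalD(1)[OF \<phi>] w
  show ?thesis
    unfolding fibre_op_def
    by (subst L2_inner_sum_left) (auto intro!: tensor_L2 sum.cong simp: tensor_inner)
qed

lemma fibre_op_cong:
  assumes "\<And>k. k \<in> I \<Longrightarrow>
    L2_eq Y (\<lambda>y. q k y * slice_coeff X (\<phi> k) f y) (\<lambda>y. r k y * slice_coeff X (\<phi> k) g y)"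
  shows "L2_eq XY (fibre_op X I \<phi> q f) (fibre_op X I \<phi> r g)"
  unfolding fibre_op_def
proof (rule L2_eq_sum)
  fix k assume "k \<in> I"
  from AE_snd_XY[OF assms[OF this, unfolded L2_eq_def]]
  show "L2_eq XY (tensor (\<phi> k) (\<lambda>y. q k y * slice_coeff X (\<phi> k) f y))
      (tensor (\<phi> k) (\<lambda>y. r k y * slice_coeff X (\<phi> k) g y))"
    unfolding L2_eq_def by eventually_elim (simp add: tensor_def)
qed

lemma L2_op_fibre_op:
  assumes \<phi>: "L2_orthonormal X I \<phi>" and q: "\<And>k. k \<in> I \<Longrightarrow> ess_bounded Y (q k)"
  shows "L2_op XY (fibre_op X I \<phi> q)"
  unfolding L2_op_def
proof (intro conjI ballI allI)
  show "fibre_op X I \<phi> q f \<in> L2_space XY" if "f \<in> L2_space XY" for f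
    using \<phi> q that by (rule fibre_op_L2)
  show "L2_eq XY (fibre_op X I \<phi> q (\<lambda>x. c * f x + g x))
      (\<lambda>x. c * fibre_op X I \<phi> q f x + fibre_op X I \<phi> q g x)"
    if f: "f \<in> L2_space XY" and g: "g \<in> L2_space XY" for f g c
  proof -
    have "L2_eq XY (\<lambda>z. \<Sum>k\<in>I. tensor (\<phi> k) (\<lambda>y. q k y * slice_coeff X (\<phi> k) (\<lambda>x. c * f x + g x) y) z)
        (\<lambda>z. \<Sum>k\<in>I. c * tensor (\<phi> k) (\<lambda>y. q k y * slice_coeff X (\<phi> k) f y) z +
          tensor (\<phi> k) (\<lambda>y. q k y * slice_coeff X (\<phi> k) g y) z)"
    proof (rule L2_eq_sum)
      fix k assume "k \<in> I"
      from AE_snd_XY[OF slice_coeff_linear[OF f g L2_orthonormalD(1)[OF \<phi> this], of c, unfolded L2_eq_def]]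
      show "L2_eq XY (tensor (\<phi> k) (\<lambda>y. q k y * slice_coeff X (\<phi> k) (\<lambda>x. c * f x + g x) y))
        (\<lambda>z. c * tensor (\<phi> k) (\<lambda>y. q k y * slice_coeff X (\<phi> k) f y) z +
          tensor (\<phi> k) (\<lambda>y. q k y * slice_coeff X (\<phi> k) g y) z)"
        unfolding L2_eq_def by eventually_elim (simp add: tensor_def algebra_simps)
    qed
    then show ?thesis
      unfolding fibre_op_def by (simp add: sum.distrib sum_distrib_left)
  qed
  have "\<exists>C. 0 \<le> C \<and> (AE y in Y. cmod (q k y) \<le> C)" if "k \<in> I" for k
    using q[OF that] by (rule ess_bounded_nonneg) blast
  then obtain C where C: "\<And>k. k \<in> I \<Longrightarrow> 0 \<le> C k" "\<And>k. k \<in> I \<Longrightarrow> AE y in Y. cmod (q k y) \<le> C k"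
    by metis
  show "\<exists>C\<ge>0. \<forall>f\<in>L2_space XY. L2_norm XY (fibre_op X I \<phi> q f) \<le> C * L2_norm XY f"
  proof (intro exI[of _ "\<Sum>k\<in>I. L2_norm X (\<phi> k) * (C k * L2_norm X (\<phi> k))"] conjI ballI)
    show "0 \<le> (\<Sum>k\<in>I. L2_norm X (\<phi> k) * (C k * L2_norm X (\<phi> k)))"
      using C(1) by (intro sum_nonneg mult_nonneg_nonneg L2_norm_nonneg)
    fix f assume f: "f \<in> L2_space XY"
    note \<phi>L = L2_orthonormalD(1)[OF \<phi>]
    have "L2_norm XY (fibre_op X I \<phi> q f) \<le>
        (\<Sum>k\<in>I. L2_norm XY (tensor (\<phi> k) (\<lambda>y. q k y * slice_coeff X (\<phi> k) f y)))"
      unfolding fibre_op_def by (intro L2_norm_sum tensor_L2 fibre_term_L2[OF \<phi>] q f \<phi>L)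
    also have "\<dots> \<le> (\<Sum>k\<in>I. (L2_norm X (\<phi> k) * (C k * L2_norm X (\<phi> k))) * L2_norm XY f)"
    proof (rule sum_mono)
      fix k assume k: "k \<in> I"
      note s = slice_coeff_L2_bound[OF f \<phi>L[OF k]]
      have "L2_norm Y (\<lambda>y. q k y * slice_coeff X (\<phi> k) f y) \<le> C k * L2_norm Y (slice_coeff X (\<phi> k) f)"
        using q[OF k] by (intro L2_norm_bounded_mult s C k) (auto simp: ess_bounded_def)
      also have "\<dots> \<le> C k * (L2_norm X (\<phi> k) * L2_norm XY f)"
        by (intro mult_left_mono s C k)
      finally have "L2_norm X (\<phi> k) * L2_norm Y (\<lambda>y. q k y * slice_coeff X (\<phi> k) f y)
          \<le> L2_norm X (\<phi> k) * (C k * (L2_norm X (\<phi> k) * L2_norm XY f))"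
        by (intro mult_left_mono L2_norm_nonneg)
      then show "L2_norm XY (tensor (\<phi> k) (\<lambda>y. q k y * slice_coeff X (\<phi> k) f y)) \<le>
          (L2_norm X (\<phi> k) * (C k * L2_norm X (\<phi> k))) * L2_norm XY f"
        by (simp add: tensor_norm \<phi>L k fibre_term_L2[where q = q, OF \<phi> k q[OF k] f] mult_ac)
    qed
    finally show "L2_norm XY (fibre_op X I \<phi> q f) \<le>
        (\<Sum>k\<in>I. L2_norm X (\<phi> k) * (C k * L2_norm X (\<phi> k))) * L2_norm XY f"
      by (simp add: sum_distrib_right)
  qed
qed

lemma slice_coeff_fibre_op:
  assumes I: "finite I" and \<phi>: "L2_orthonormal X I \<phi>" and q: "\<And>k. k \<in> I \<Longrightarrow> ess_bounded Y (q k)"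
    and f: "f \<in> L2_space XY" and l: "l \<in> I"
  shows "L2_eq Y (slice_coeff X (\<phi> l) (fibre_op X I \<phi> q f)) (\<lambda>y. q l y * slice_coeff X (\<phi> l) f y)"
proof (rule L2_eq_if_inner_eq)
  note \<phi>l = L2_orthonormalD[OF \<phi> l]
  have Qf: "fibre_op X I \<phi> q f \<in> L2_space XY"
    using \<phi> q f by (rule fibre_op_L2)
  show "slice_coeff X (\<phi> l) (fibre_op X I \<phi> q f) \<in> L2_space Y"
    by (intro slice_coeff_L2_bound Qf \<phi>l)
  show "(\<lambda>y. q l y * slice_coeff X (\<phi> l) f y) \<in> L2_space Y"
    by (rule fibre_term_L2[where q = q, OF \<phi> l q[OF l] f])
  fix w assume w: "w \<in> L2_space Y"
  have "L2_inner Y (slice_coeff X (\<phi> l) (fibre_op X I \<phi> q f)) w =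
      L2_inner XY (fibre_op X I \<phi> q f) (tensor (\<phi> l) w)"
    by (intro slice_coeff_adjoint Qf \<phi>l w)
  also have "\<dots> = (\<Sum>k\<in>I. L2_inner Y (\<lambda>y. q k y * slice_coeff X (\<phi> k) f y)
      (slice_coeff X (\<phi> k) (tensor (\<phi> l) w)))"
    by (intro fibre_op_inner \<phi> q f tensor_L2 \<phi>l w)
  also have "\<dots> = (\<Sum>k\<in>I. if l = k then L2_inner Y (\<lambda>y. q k y * slice_coeff X (\<phi> k) f y) w else 0)"
    by (intro sum.cong) (auto simp: slice_coeff_tensor L2_inner_scale_right \<phi>l(2))
  also have "\<dots> = L2_inner Y (\<lambda>y. q l y * slice_coeff X (\<phi> l) f y) w"
    using I l by simp
  finally show "L2_inner Y (slice_coeff X (\<phi> l) (fibre_op X I \<phi> q f)) w =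
      L2_inner Y (\<lambda>y. q l y * slice_coeff X (\<phi> l) f y) w" .
qed

lemma fibre_op_comp:
  assumes I: "finite I" and \<phi>: "L2_orthonormal X I \<phi>" and r: "\<And>k. k \<in> I \<Longrightarrow> ess_bounded Y (r k)"
    and f: "f \<in> L2_space XY"
  shows "L2_eq XY (fibre_op X I \<phi> q (fibre_op X I \<phi> r f)) (fibre_op X I \<phi> (\<lambda>k y. q k y * r k y) f)"
proof (rule fibre_op_cong)
  fix k assume "k \<in> I"
  then have "L2_eq Y (slice_coeff X (\<phi> k) (fibre_op X I \<phi> r f)) (\<lambda>y. r k y * slice_coeff X (\<phi> k) f y)"
    using I \<phi> r f by (intro slice_coeff_fibre_op)
  then show "L2_eq Y (\<lambda>y. q k y * slice_coeff X (\<phi> k) (fibre_op X I \<phi> r f) y)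
      (\<lambda>y. q k y * r k y * slice_coeff X (\<phi> k) f y)"
    unfolding L2_eq_def by eventually_elim simp
qed

lemma fibre_op_symmetric:
  assumes \<phi>: "L2_orthonormal X I \<phi>" and h: "\<And>k. k \<in> I \<Longrightarrow> ess_bounded_measurable Y (h k)"
  shows "L2_symmetric XY (fibre_op X I \<phi> (\<lambda>k y. complex_of_real (h k y)))"
  unfolding L2_symmetric_def
proof (intro ballI)
  fix f g assume f: "f \<in> L2_space XY" and g: "g \<in> L2_space XY"
  let ?q = "\<lambda>k y. complex_of_real (h k y)"
  note q = ess_bounded_of_real[OF h]
  have "L2_inner XY f (fibre_op X I \<phi> ?q g) = cnj (L2_inner XY (fibre_op X I \<phi> ?q g) f)"
    by (simp add: L2_inner_cnj)
  also have "\<dots> = (\<Sum>k\<in>I. L2_inner Y (slice_coeff X (\<phi> k) f) (\<lambda>y. ?q k y * slice_coeff X (\<phi> k) g y))"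
    using \<phi> q g f by (subst fibre_op_inner) (auto simp: L2_inner_cnj)
  also have "\<dots> = (\<Sum>k\<in>I. L2_inner Y (\<lambda>y. ?q k y * slice_coeff X (\<phi> k) f y) (slice_coeff X (\<phi> k) g))"
    by (simp add: L2_inner_def mult_ac)
  also have "\<dots> = L2_inner XY (fibre_op X I \<phi> ?q f) g"
    by (intro fibre_op_inner[symmetric] \<phi> q f g)
  finally show "L2_inner XY (fibre_op X I \<phi> ?q f) g = L2_inner XY f (fibre_op X I \<phi> ?q g)" ..
qed

lemma fibre_op_tensor:
  assumes I: "finite I" and \<phi>: "L2_orthonormal X I \<phi>" and l: "l \<in> I"
  shows "fibre_op X I \<phi> q (tensor (\<phi> l) g) = (\<lambda>z. q l (snd z) * tensor (\<phi> l) g z)"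
proof
  fix z
  have "fibre_op X I \<phi> q (tensor (\<phi> l) g) z = (\<Sum>k\<in>I. if l = k then q l (snd z) * tensor (\<phi> l) g z else 0)"
    unfolding fibre_op_def slice_coeff_tensor
    by (intro sum.cong) (auto simp: tensor_def L2_orthonormalD(2)[OF \<phi> l])
  then show "fibre_op X I \<phi> q (tensor (\<phi> l) g) z = q l (snd z) * tensor (\<phi> l) g z"
    using I l by simp
qed

lemma fibre_op_tensor_orthogonal:
  assumes "\<And>k. k \<in> I \<Longrightarrow> L2_inner X u (\<phi> k) = 0"
  shows "fibre_op X I \<phi> q (tensor u g) = (\<lambda>z. 0)"
  unfolding fibre_op_def slice_coeff_tensor using assms by (simp add: tensor_def)

text \<open>The resolvent is \<open>1 / (q k - z)\<close> on the \<open>k\<close>-th subspace and \<open>- 1 / z\<close> on the complement. The function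
  \<open>r k\<close> is the difference of the two.\<close>

lemma fibre_op_resolvent:
  assumes I: "finite I" and \<phi>: "L2_orthonormal X I \<phi>" and q: "\<And>k. k \<in> I \<Longrightarrow> ess_bounded Y (q k)"
    and z: "z \<noteq> 0" and away: "\<And>k. k \<in> I \<Longrightarrow> \<exists>\<epsilon>>0. AE y in Y. \<epsilon> \<le> cmod (q k y - z)"
  obtains R where "L2_op XY R"
    "\<And>f. f \<in> L2_space XY \<Longrightarrow> L2_eq XY (R (\<lambda>x. fibre_op X I \<phi> q f x - z * f x)) f"
    "\<And>f. f \<in> L2_space XY \<Longrightarrow> L2_eq XY (\<lambda>x. fibre_op X I \<phi> q (R f) x - z * R f x) f"
proof -
  define r where "r = (\<lambda>k y. q k y / (z * (q k y - z)))"
  have r: "ess_bounded Y (r k)" if k: "k \<in> I" for k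
  proof -
    obtain \<epsilon> where \<epsilon>: "\<epsilon> > 0" "AE y in Y. \<epsilon> \<le> cmod (q k y - z)"
      using away[OF k] by blast
    obtain C where C: "0 \<le> C" "AE y in Y. cmod (q k y) \<le> C"
      using ess_bounded_nonneg[OF q[OF k]] by blast
    have "AE y in Y. cmod (r k y) \<le> C / (cmod z * \<epsilon>)"
      using \<epsilon>(2) C(2)
    proof eventually_elim
      case (elim y)
      then show ?case
        unfolding r_def norm_divide norm_mult using \<epsilon>(1) z C(1)
        by (intro frac_le mult_left_mono mult_pos_pos) auto
    qed
    then show ?thesis
      using q[OF k] by (auto simp: ess_bounded_def r_def)
  qed
  let ?Q = "fibre_op X I \<phi> q" and ?S = "fibre_op X I \<phi> r"
  have Q: "L2_op XY ?Q"
    using \<phi> q by (rule L2_op_fibre_op)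
  have S: "L2_op XY ?S"
    using \<phi> r by (rule L2_op_fibre_op)
  define R where "R = (\<lambda>f x. (- 1 / z) * f x + 1 * ?S f x)"
  \<comment> \<open>This is \<open>q * r = q / z + z * r\<close>, multiplied by \<open>z\<close>.\<close>
  have key: "z * tensor u (\<lambda>y. q k y * r k y * s y) x = tensor u (\<lambda>y. q k y * s y) x + z * (z * tensor u (\<lambda>y. r k y * s y) x)"
    if "q k (snd x) \<noteq> z" for u s k and x :: "'a \<times> 'b"
  proof -
    have "z * (q k (snd x) * r k (snd x)) = q k (snd x) + z * (z * r k (snd x))"
      using z that by (simp add: r_def field_simps)
    then have "u (fst x) * s (snd x) * (z * (q k (snd x) * r k (snd x))) =
        u (fst x) * s (snd x) * (q k (snd x) + z * (z * r k (snd x)))"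
      by (rule arg_cong)
    then show ?thesis
      by (simp add: tensor_def algebra_simps)
  qed
  have resolvent_eq: "L2_eq XY (\<lambda>x. z * fibre_op X I \<phi> (\<lambda>k y. q k y * r k y) f x)
      (\<lambda>x. ?Q f x + z * (z * ?S f x))" for f
    unfolding fibre_op_def sum_distrib_left sum.distrib[symmetric]
  proof (rule L2_eq_sum)
    fix k assume "k \<in> I"
    then obtain \<epsilon> where \<epsilon>: "\<epsilon> > 0" "AE y in Y. \<epsilon> \<le> cmod (q k y - z)"
      using away by blast
    from AE_snd_XY[OF \<epsilon>(2)]
    show "L2_eq XY (\<lambda>x. z * tensor (\<phi> k) (\<lambda>y. q k y * r k y * slice_coeff X (\<phi> k) f y) x)
       (\<lambda>x. tensor (\<phi> k) (\<lambda>y. q k y * slice_coeff X (\<phi> k) f y) x +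
            z * (z * tensor (\<phi> k) (\<lambda>y. r k y * slice_coeff X (\<phi> k) f y) x))"
      unfolding L2_eq_def
    proof eventually_elim
      case (elim x)
      then have "q k (snd x) \<noteq> z"
        using \<epsilon>(1) by auto
      then show ?case by (rule key)
    qed
  qed
  show ?thesis
  proof
    show "L2_op XY R"
      unfolding R_def by (rule L2_op_lincomb[OF L2_op_id S])
    fix f assume f: "f \<in> L2_space XY"
    have SQ: "L2_eq XY (?S (?Q f)) (fibre_op X I \<phi> (\<lambda>k y. q k y * r k y) f)"
      unfolding mult.commute[of "q _ _"]
      by (rule fibre_op_comp[where q = r and r = q, OF I \<phi> _ f]) (rule q)
    have QS: "L2_eq XY (?Q (?S f)) (fibre_op X I \<phi> (\<lambda>k y. q k y * r k y) f)"
      by (rule fibre_op_comp[where q = q and r = r, OF I \<phi> _ f]) (rule r)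
    show "L2_eq XY (R (\<lambda>x. ?Q f x - z * f x)) f"
      using L2_op_diff[OF S L2_op_space[OF Q f] L2_space_scale[OF f, of z]] L2_op_scale[OF S f, of z]
        SQ resolvent_eq[of f]
      unfolding L2_eq_def
    proof eventually_elim
      case (elim x)
      have "?S (\<lambda>x. ?Q f x - z * f x) x = fibre_op X I \<phi> (\<lambda>k y. q k y * r k y) f x - z * ?S f x"
        using elim by simp
      then have "z * ?S (\<lambda>x. ?Q f x - z * f x) x =
          z * fibre_op X I \<phi> (\<lambda>k y. q k y * r k y) f x - z * (z * ?S f x)"
        by (simp add: right_diff_distrib)
      then have "z * ?S (\<lambda>x. ?Q f x - z * f x) x = ?Q f x"
        using elim by simp
      then have "?S (\<lambda>x. ?Q f x - z * f x) x = ?Q f x / z"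
        using z by (simp add: field_simps)
      then show ?case
        using z by (simp add: R_def field_simps)
    qed
    have "L2_eq XY (?Q (R f)) (\<lambda>x. (- 1 / z) * ?Q f x + ?Q (?S f) x)"
      using L2_op_linear[OF Q f L2_op_space[OF S f], of "- 1 / z"] by (simp add: R_def)
    then show "L2_eq XY (\<lambda>x. ?Q (R f) x - z * R f x) f"
      using QS resolvent_eq[of f] unfolding L2_eq_def
    proof eventually_elim
      case (elim x)
      have "z * ?Q (?S f) x = ?Q f x + z * (z * ?S f x)"
        using elim by simp
      then have "?Q (?S f) x = ?Q f x / z + z * ?S f x"
        using z by (simp add: field_simps)
      then show ?case
        using z elim(1) by (simp add: R_def field_simps)
    qed
  qed
qed

end

section \<open>Sums of two partial integral operators\<close>

text \<open>Over each set of positive measure the space has infinite dimension, in the form in which it is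
  used: some nonzero vector is orthogonal to any given finite set.\<close>

definition L2_diffuse :: "'a measure \<Rightarrow> bool" where
  "L2_diffuse M \<longleftrightarrow> (\<forall>S\<in>sets M. 0 < emeasure M S \<longrightarrow>
     (\<forall>W. finite W \<longrightarrow> W \<subseteq> L2_space M \<longrightarrow>
       (\<exists>g\<in>L2_space M. (\<forall>x. x \<notin> S \<longrightarrow> g x = 0) \<and> \<not> L2_eq M g (\<lambda>x. 0) \<and>
          (\<forall>w\<in>W. L2_inner M g w = 0))))"

lemma L2_diffuseE:
  assumes "L2_diffuse M" "S \<in> sets M" "0 < emeasure M S" "finite W" "W \<subseteq> L2_space M"
  obtains g where "g \<in> L2_space M" "\<And>x. x \<notin> S \<Longrightarrow> g x = 0" "\<not> L2_eq M g (\<lambda>x. 0)"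
    "\<And>w. w \<in> W \<Longrightarrow> L2_inner M g w = 0"
proof -
  have "\<exists>g\<in>L2_space M. (\<forall>x. x \<notin> S \<longrightarrow> g x = 0) \<and> \<not> L2_eq M g (\<lambda>x. 0) \<and> (\<forall>w\<in>W. L2_inner M g w = 0)"
    using assms(1)[unfolded L2_diffuse_def] assms(2-5) by simp
  then show thesis
    using that by (elim bexE conjE) simp
qed

lemma tensor_swap: "tensor u v \<circ> prod.swap = tensor v u"
  by (auto simp: tensor_def fun_eq_iff)

lemma swap_swap: "(f \<circ> prod.swap) \<circ> prod.swap = f"
  by (simp add: fun_eq_iff)

locale two_fibre_ops = finite_measure_pair M1 M2
  for M1 :: "'a measure" and M2 :: "'b measure" +
  fixes I :: "'i set" and J :: "'j set"
    and \<phi> :: "'i \<Rightarrow> 'a \<Rightarrow> complex" and h :: "'i \<Rightarrow> 'b \<Rightarrow> real"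
    and \<psi> :: "'j \<Rightarrow> 'b \<Rightarrow> complex" and p :: "'j \<Rightarrow> 'a \<Rightarrow> real"
  assumes I: "finite I" and J: "finite J"
    and \<phi>: "L2_orthonormal X I \<phi>" and h: "\<And>k. k \<in> I \<Longrightarrow> ess_bounded_measurable Y (h k)"
    and \<psi>: "L2_orthonormal Y J \<psi>" and p: "\<And>j. j \<in> J \<Longrightarrow> ess_bounded_measurable X (p j)"
begin

interpretation S: finite_measure_pair M2 M1 by (rule swapped)

abbreviation "hc \<equiv> \<lambda>k y. complex_of_real (h k y)"
abbreviation "pc \<equiv> \<lambda>j x. complex_of_real (p j x)"

definition "T1 = fibre_op X I \<phi> hc"
definition "T2 = (\<lambda>f. fibre_op Y J \<psi> pc (f \<circ> prod.swap) \<circ> prod.swap)"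
definition "T = (\<lambda>f z. T1 f z + T2 f z)"

lemma hc: "k \<in> I \<Longrightarrow> ess_bounded Y (hc k)"
  by (intro ess_bounded_of_real h)

lemma pc: "j \<in> J \<Longrightarrow> ess_bounded X (pc j)"
  by (intro ess_bounded_of_real p)

lemma \<phi>L: "k \<in> I \<Longrightarrow> \<phi> k \<in> L2_space X"
  by (rule L2_orthonormalD(1)[OF \<phi>])

lemma \<psi>L: "j \<in> J \<Longrightarrow> \<psi> j \<in> L2_space Y"
  by (rule L2_orthonormalD(1)[OF \<psi>])

lemma T1_op: "L2_op XY T1"
  unfolding T1_def using \<phi> hc by (rule L2_op_fibre_op)

lemma T2'_op: "L2_op S.XY (fibre_op Y J \<psi> pc)"
  using \<psi> pc by (rule S.L2_op_fibre_op)

lemma T2_op: "L2_op XY T2"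
  unfolding T2_def by (rule swap_op[OF T2'_op])

lemma T_op: "L2_op XY T"
  using L2_op_lincomb[OF T1_op T2_op, of 1 1] by (simp add: T_def)

lemma T_symmetric: "L2_symmetric XY T"
  unfolding L2_symmetric_def
proof (intro ballI)
  fix f g assume f: "f \<in> L2_space XY" and g: "g \<in> L2_space XY"
  have 1: "L2_inner XY (T1 f) g = L2_inner XY f (T1 g)"
    using fibre_op_symmetric[OF \<phi> h] f g by (simp add: L2_symmetric_def T1_def)
  have swap: "L2_inner XY u v = L2_inner S.XY (u \<circ> prod.swap) (v \<circ> prod.swap)"
    if "u \<in> L2_space XY" "v \<in> L2_space XY" for u v
    by (rule swap_inner[OF that, symmetric])
  have 2: "L2_inner XY (T2 f) g = L2_inner XY f (T2 g)"
    using S.fibre_op_symmetric[OF \<psi> p] swap_L2[OF f] swap_L2[OF g]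
    by (simp add: swap f g L2_op_space[OF T2_op]) (simp add: T2_def swap_swap L2_symmetric_def)
  show "L2_inner XY (T f) g = L2_inner XY f (T g)"
    unfolding T_def using f g 1 2
    by (simp add: L2_inner_add_left L2_inner_add_right L2_op_space[OF T1_op] L2_op_space[OF T2_op])
qed

text \<open>The product \<open>T1 T2\<close> has finite rank because \<open>T2 f\<close> has slices in the span of the \<open>\<psi> j\<close>: its
  \<open>\<phi> k\<close>-coefficients therefore lie in this finite-dimensional span.\<close>

lemma slice_coeff_T2:
  assumes f: "f \<in> L2_space XY" and k: "k \<in> I"
  shows "L2_eq Y (slice_coeff X (\<phi> k) (T2 f))
    (\<lambda>y. \<Sum>j\<in>J. L2_inner XY f (tensor (\<lambda>x. pc j x * \<phi> k x) (\<psi> j)) * \<psi> j y)"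
proof (rule L2_eq_if_inner_eq)
  have pL: "(\<lambda>x. pc j x * \<phi> k x) \<in> L2_space X" if "j \<in> J" for j
    using that k by (intro ess_bounded_mult_L2 pc \<phi>L)
  note T2f = L2_op_space[OF T2_op f] and f' = swap_L2[OF f]
  show "slice_coeff X (\<phi> k) (T2 f) \<in> L2_space Y"
    by (intro slice_coeff_L2_bound T2f \<phi>L k)
  show "(\<lambda>y. \<Sum>j\<in>J. L2_inner XY f (tensor (\<lambda>x. pc j x * \<phi> k x) (\<psi> j)) * \<psi> j y) \<in> L2_space Y"
    by (intro L2_space_sum L2_space_scale \<psi>L)
  fix w assume w: "w \<in> L2_space Y"
  have "L2_inner Y (slice_coeff X (\<phi> k) (T2 f)) w = L2_inner XY (T2 f) (tensor (\<phi> k) w)"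
    by (intro slice_coeff_adjoint T2f \<phi>L k w)
  also have "\<dots> = L2_inner S.XY (T2 f \<circ> prod.swap) (tensor (\<phi> k) w \<circ> prod.swap)"
    by (intro swap_inner[symmetric] T2f tensor_L2 \<phi>L k w)
  also have "\<dots> = L2_inner S.XY (fibre_op Y J \<psi> pc (f \<circ> prod.swap)) (tensor w (\<phi> k))"
    by (simp add: T2_def swap_swap tensor_swap)
  also have "\<dots> = (\<Sum>j\<in>J. L2_inner X (\<lambda>x. pc j x * slice_coeff Y (\<psi> j) (f \<circ> prod.swap) x)
      (slice_coeff Y (\<psi> j) (tensor w (\<phi> k))))"
    by (intro S.fibre_op_inner \<psi> pc f' S.tensor_L2 w \<phi>L k)
  also have "\<dots> = (\<Sum>j\<in>J. L2_inner XY f (tensor (\<lambda>x. pc j x * \<phi> k x) (\<psi> j)) * L2_inner Y (\<psi> j) w)"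
  proof (rule sum.cong[OF refl])
    fix j assume j: "j \<in> J"
    have "L2_inner X (\<lambda>x. pc j x * slice_coeff Y (\<psi> j) (f \<circ> prod.swap) x) (slice_coeff Y (\<psi> j) (tensor w (\<phi> k)))
        = L2_inner Y (\<psi> j) w * L2_inner X (\<lambda>x. pc j x * slice_coeff Y (\<psi> j) (f \<circ> prod.swap) x) (\<phi> k)"
      by (simp add: S.slice_coeff_tensor L2_inner_scale_right L2_inner_cnj)
    also have "L2_inner X (\<lambda>x. pc j x * slice_coeff Y (\<psi> j) (f \<circ> prod.swap) x) (\<phi> k) =
        L2_inner X (slice_coeff Y (\<psi> j) (f \<circ> prod.swap)) (\<lambda>x. pc j x * \<phi> k x)"
      by (simp add: L2_inner_def mult_ac)
    also have "\<dots> = L2_inner S.XY (f \<circ> prod.swap) (tensor (\<psi> j) (\<lambda>x. pc j x * \<phi> k x))"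
      by (intro S.slice_coeff_adjoint f' \<psi>L j pL)
    also have "\<dots> = L2_inner XY f (tensor (\<lambda>x. pc j x * \<phi> k x) (\<psi> j))"
      using swap_inner[OF f tensor_L2[OF pL \<psi>L]] j by (simp add: tensor_swap)
    finally show "L2_inner X (\<lambda>x. pc j x * slice_coeff Y (\<psi> j) (f \<circ> prod.swap) x) (slice_coeff Y (\<psi> j) (tensor w (\<phi> k)))
        = L2_inner XY f (tensor (\<lambda>x. pc j x * \<phi> k x) (\<psi> j)) * L2_inner Y (\<psi> j) w"
      by (simp only: mult.commute)
  qed
  also have "\<dots> = L2_inner Y (\<lambda>y. \<Sum>j\<in>J. L2_inner XY f (tensor (\<lambda>x. pc j x * \<phi> k x) (\<psi> j)) * \<psi> j y) w"
    using \<psi>L w by (subst L2_inner_lincomb_left) auto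
  finally show "L2_inner Y (slice_coeff X (\<phi> k) (T2 f)) w =
      L2_inner Y (\<lambda>y. \<Sum>j\<in>J. L2_inner XY f (tensor (\<lambda>x. pc j x * \<phi> k x) (\<psi> j)) * \<psi> j y) w" .
qed

lemma T1_T2_finite_rank:
  assumes f: "f \<in> L2_space XY"
  shows "L2_eq XY (T1 (T2 f)) (\<lambda>z. \<Sum>(k, j)\<in>I \<times> J.
    L2_inner XY f (tensor (\<lambda>x. pc j x * \<phi> k x) (\<psi> j)) * tensor (\<phi> k) (\<lambda>y. hc k y * \<psi> j y) z)"
proof -
  let ?c = "\<lambda>k j. L2_inner XY f (tensor (\<lambda>x. pc j x * \<phi> k x) (\<psi> j))"
  have "L2_eq XY (T1 (T2 f)) (\<lambda>z. \<Sum>k\<in>I. \<Sum>j\<in>J. ?c k j * tensor (\<phi> k) (\<lambda>y. hc k y * \<psi> j y) z)"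
    unfolding T1_def fibre_op_def
  proof (rule L2_eq_sum)
    fix k assume k: "k \<in> I"
    from AE_snd_XY[OF slice_coeff_T2[OF f k, unfolded L2_eq_def]]
    show "L2_eq XY (tensor (\<phi> k) (\<lambda>y. hc k y * slice_coeff X (\<phi> k) (T2 f) y))
        (\<lambda>z. \<Sum>j\<in>J. ?c k j * tensor (\<phi> k) (\<lambda>y. hc k y * \<psi> j y) z)"
      unfolding L2_eq_def
      by eventually_elim (simp add: tensor_def sum_distrib_left mult_ac)
  qed
  then show ?thesis
    by (simp add: sum.cartesian_product)
qed

lemma T_parametrix:
  assumes z: "z \<noteq> 0"
    and hz: "\<And>k. k \<in> I \<Longrightarrow> \<exists>\<epsilon>>0. AE y in Y. \<epsilon> \<le> cmod (hc k y - z)"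
    and pz: "\<And>j. j \<in> J \<Longrightarrow> \<exists>\<epsilon>>0. AE x in X. \<epsilon> \<le> cmod (pc j x - z)"
  shows "L2_parametrix XY T (I \<times> J) z"
proof -
  obtain R1 where R1: "L2_op XY R1"
    "\<And>f. f \<in> L2_space XY \<Longrightarrow> L2_eq XY (R1 (\<lambda>x. T1 f x - z * f x)) f"
    "\<And>f. f \<in> L2_space XY \<Longrightarrow> L2_eq XY (\<lambda>x. T1 (R1 f) x - z * R1 f x) f"
    by (rule fibre_op_resolvent[where q = hc, OF I \<phi> hc z hz])
      (assumption, assumption, rule that, simp_all add: T1_def)
  obtain R where R: "L2_op S.XY R"
    "\<And>f. f \<in> L2_space S.XY \<Longrightarrow> L2_eq S.XY (R (\<lambda>x. fibre_op Y J \<psi> pc f x - z * f x)) f"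
    "\<And>f. f \<in> L2_space S.XY \<Longrightarrow> L2_eq S.XY (\<lambda>x. fibre_op Y J \<psi> pc (R f) x - z * R f x) f"
    by (rule S.fibre_op_resolvent[where q = pc, OF J \<psi> pc z pz]) (assumption, assumption, rule that)
  define R2 where "R2 = (\<lambda>f. R (f \<circ> prod.swap) \<circ> prod.swap)"
  have R2: "L2_op XY R2"
    unfolding R2_def by (rule swap_op[OF R(1)])
  have RT2: "L2_eq XY (R2 (\<lambda>x. T2 f x - z * f x)) f" if f: "f \<in> L2_space XY" for f
    using S.swap_eq[OF R(2)[OF swap_L2[OF f]]]
    by (simp add: R2_def T2_def swap_swap o_def)
  have TR2: "L2_eq XY (\<lambda>x. T2 (R2 f) x - z * R2 f x) f" if f: "f \<in> L2_space XY" for f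
    using S.swap_eq[OF R(3)[OF swap_L2[OF f]]]
    by (simp add: R2_def T2_def swap_swap) (simp add: o_def)
  have "L2_parametrix XY (\<lambda>f x. T1 f x + T2 f x) (I \<times> J) z"
  proof (rule L2_parametrix_sum_if_finite_rank_product[OF T1_op T2_op R1(1) R2 R1(2) RT2 R1(3) TR2 z,
        where u = "\<lambda>(k, j). tensor (\<lambda>x. pc j x * \<phi> k x) (\<psi> j)"
          and t = "\<lambda>(k, j). tensor (\<phi> k) (\<lambda>y. hc k y * \<psi> j y)"])
    show "(case i of (k, j) \<Rightarrow> tensor (\<lambda>x. pc j x * \<phi> k x) (\<psi> j)) \<in> L2_space XY" if "i \<in> I \<times> J" for i
      using that by (auto intro!: tensor_L2 ess_bounded_mult_L2 pc \<phi>L \<psi>L)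
    show "(case i of (k, j) \<Rightarrow> tensor (\<phi> k) (\<lambda>y. hc k y * \<psi> j y)) \<in> L2_space XY" if "i \<in> I \<times> J" for i
      using that by (auto intro!: tensor_L2 ess_bounded_mult_L2 hc \<phi>L \<psi>L)
    show "L2_eq XY (T1 (T2 f)) (\<lambda>x. \<Sum>i\<in>I \<times> J.
        L2_inner XY f (case i of (k, j) \<Rightarrow> tensor (\<lambda>x. pc j x * \<phi> k x) (\<psi> j)) *
        (case i of (k, j) \<Rightarrow> tensor (\<phi> k) (\<lambda>y. hc k y * \<psi> j y)) x)"
      if "f \<in> L2_space XY" for f
      using T1_T2_finite_rank[OF that] by (simp add: case_prod_beta)
  qed
  then show ?thesis
    by (simp add: T_def)
qed

lemma essential_spectrum_subset:
  "L2_essential_spectrum XY T \<subseteq>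
    complex_of_real ` ({0} \<union> (\<Union>k\<in>I. Essran Y (h k)) \<union> (\<Union>j\<in>J. Essran X (p j)))"
proof -
  define G where "G = (- {0}) \<inter> (\<Inter>k\<in>I. {z. \<exists>\<epsilon>>0. AE y in Y. \<epsilon> \<le> cmod (hc k y - z)}) \<inter>
      (\<Inter>j\<in>J. {z. \<exists>\<epsilon>>0. AE x in X. \<epsilon> \<le> cmod (pc j x - z)})"
  have "open G"
    unfolding G_def using I J by (intro open_Int open_INT ballI open_bounded_away) auto
  moreover have "L2_parametrix XY T (I \<times> J) z" if "z \<in> G" for z
    using that unfolding G_def by (intro T_parametrix) auto
  ultimately have discr: "L2_spectrum XY T \<inter> G \<subseteq> L2_discrete_spectrum XY T"
    using I J by (intro spectrum_discrete_if_parametrix[where I = "I \<times> J", OF T_op T_symmetric]) auto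
  have "z \<in> G" if "z \<notin> complex_of_real ` ({0} \<union> (\<Union>k\<in>I. Essran Y (h k)) \<union> (\<Union>j\<in>J. Essran X (p j)))" for z
  proof -
    have "\<exists>\<epsilon>>0. AE y in Y. \<epsilon> \<le> cmod (hc k y - z)" if "k \<in> I" for k
      using h[OF that] \<open>z \<notin> _\<close> that
      by (intro bounded_away_if_not_in_Essran) (auto simp: ess_bounded_measurable_def)
    moreover have "\<exists>\<epsilon>>0. AE x in X. \<epsilon> \<le> cmod (pc j x - z)" if "j \<in> J" for j
      using p[OF that] \<open>z \<notin> _\<close> that
      by (intro bounded_away_if_not_in_Essran) (auto simp: ess_bounded_measurable_def)
    moreover have "z \<noteq> 0"
      using that by auto
    ultimately show ?thesis
      by (simp add: G_def)
  qed
  then show ?thesis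
    using discr unfolding L2_essential_spectrum_def by blast
qed

text \<open>The \<open>\<psi> j\<close>-coefficients of \<open>\<phi> k \<otimes> g\<close> vanish if \<open>g\<close> is orthogonal to all \<open>\<psi> j\<close>. Then \<open>T2\<close> kills
  this vector, and \<open>T1\<close> acts on it as a multiplication.\<close>

lemma T_tensor_left:
  assumes "k \<in> I" and "\<And>j. j \<in> J \<Longrightarrow> L2_inner Y g (\<psi> j) = 0"
  shows "T (tensor (\<phi> k) g) = (\<lambda>z. hc k (snd z) * tensor (\<phi> k) g z)"
  using fibre_op_tensor[OF I \<phi> assms(1), of hc g] S.fibre_op_tensor_orthogonal[OF assms(2), where q = pc and g = "\<phi> k"]
  by (simp add: T_def T1_def T2_def tensor_swap)

lemma T_tensor_right:
  assumes "j \<in> J" and "\<And>k. k \<in> I \<Longrightarrow> L2_inner X g (\<phi> k) = 0"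
  shows "T (tensor g (\<psi> j)) = (\<lambda>z. pc j (fst z) * tensor g (\<psi> j) z)"
proof
  fix z
  have "T2 (tensor g (\<psi> j)) z = pc j (fst z) * tensor (\<psi> j) g (prod.swap z)"
    using S.fibre_op_tensor[OF J \<psi> assms(1), of pc g] by (simp add: T2_def tensor_swap)
  moreover have "T1 (tensor g (\<psi> j)) z = 0"
    using fibre_op_tensor_orthogonal[OF assms(2), where q = hc and g = "\<psi> j"] by (simp add: T1_def)
  ultimately show "T (tensor g (\<psi> j)) z = pc j (fst z) * tensor g (\<psi> j) z"
    by (simp add: T_def tensor_def)
qed

lemma T_tensor_orthogonal:
  assumes "\<And>k. k \<in> I \<Longrightarrow> L2_inner X u (\<phi> k) = 0" and "\<And>j. j \<in> J \<Longrightarrow> L2_inner Y v (\<psi> j) = 0"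
  shows "T (tensor u v) = (\<lambda>z. 0)"
  using fibre_op_tensor_orthogonal[OF assms(1), where q = hc and g = v] S.fibre_op_tensor_orthogonal[OF assms(2), where q = pc and g = u]
  by (simp add: T_def T1_def T2_def tensor_swap fun_eq_iff)

lemma unit_not_null: "L2_orthonormal M K e \<Longrightarrow> k \<in> K \<Longrightarrow> \<not> L2_eq M (e k) (\<lambda>x. 0)"
  using L2_norm_eq_0_iff[of "e k" M] L2_inner_self[of M "e k"] by (auto simp: L2_orthonormal_def)

text \<open>The vector orthogonal to \<open>B\<close> is \<open>\<phi> k \<otimes> g\<close> with \<open>g\<close> orthogonal to all \<open>\<psi> j\<close> and to the
  \<open>\<phi> k\<close>-coefficients of the elements of \<open>B\<close>.\<close>

lemma Essran_h_subset:
  assumes Y: "L2_diffuse Y" and k: "k \<in> I"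
  shows "complex_of_real ` Essran Y (h k) \<subseteq> L2_essential_spectrum XY T"
proof (rule Essran_subset_essential_spectrum[OF T_op, where \<pi> = snd])
  show "h k \<in> borel_measurable Y"
    using h[OF k] by (simp add: ess_bounded_measurable_def)
  fix S B assume S: "S \<in> sets Y" "0 < emeasure Y S" and B: "finite B" "B \<subseteq> L2_space XY"
  obtain g where g: "g \<in> L2_space Y" "\<And>y. y \<notin> S \<Longrightarrow> g y = 0" "\<not> L2_eq Y g (\<lambda>x. 0)"
    and orth: "\<And>w. w \<in> \<psi> ` J \<union> slice_coeff X (\<phi> k) ` B \<Longrightarrow> L2_inner Y g w = 0"
  proof (rule L2_diffuseE[OF Y S])
    show "finite (\<psi> ` J \<union> slice_coeff X (\<phi> k) ` B)"
      using B J by simp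
    show "\<psi> ` J \<union> slice_coeff X (\<phi> k) ` B \<subseteq> L2_space Y"
      using B(2) by (auto intro!: \<psi>L slice_coeff_L2_bound(1) \<phi>L k)
  qed (rule that)
  show "\<exists>f\<in>L2_space XY. L2_eq XY (T f) (\<lambda>z. complex_of_real (h k (snd z)) * f z) \<and>
      (\<forall>z. snd z \<notin> S \<longrightarrow> f z = 0) \<and> \<not> L2_eq XY f (\<lambda>x. 0) \<and> (\<forall>b\<in>B. L2_inner XY f b = 0)"
  proof (intro bexI[of _ "tensor (\<phi> k) g"] conjI allI impI ballI)
    show "L2_eq XY (T (tensor (\<phi> k) g)) (\<lambda>z. hc k (snd z) * tensor (\<phi> k) g z)"
      using orth by (simp add: T_tensor_left k L2_eq_refl)
    show "tensor (\<phi> k) g z = 0" if "snd z \<notin> S" for z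
      using g(2) that by (simp add: tensor_def)
    show "\<not> L2_eq XY (tensor (\<phi> k) g) (\<lambda>x. 0)"
      by (rule tensor_not_null[OF \<phi>L[OF k] g(1) unit_not_null[OF \<phi> k] g(3)])
    show "L2_inner XY (tensor (\<phi> k) g) b = 0" if "b \<in> B" for b
      using tensor_inner[of b "\<phi> k" g] that B \<phi>L[OF k] g(1) orth by auto
    show "tensor (\<phi> k) g \<in> L2_space XY"
      by (intro tensor_L2 \<phi>L k g)
  qed
qed

lemma Essran_p_subset:
  assumes X: "L2_diffuse X" and j: "j \<in> J"
  shows "complex_of_real ` Essran X (p j) \<subseteq> L2_essential_spectrum XY T"
proof (rule Essran_subset_essential_spectrum[OF T_op, where \<pi> = fst])
  show "p j \<in> borel_measurable X"
    using p[OF j] by (simp add: ess_bounded_measurable_def)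
  fix S B assume S: "S \<in> sets X" "0 < emeasure X S" and B: "finite B" "B \<subseteq> L2_space XY"
  obtain g where g: "g \<in> L2_space X" "\<And>y. y \<notin> S \<Longrightarrow> g y = 0" "\<not> L2_eq X g (\<lambda>x. 0)"
    and orth: "\<And>w. w \<in> \<phi> ` I \<union> (\<lambda>b. slice_coeff Y (\<psi> j) (b \<circ> prod.swap)) ` B \<Longrightarrow> L2_inner X g w = 0"
  proof (rule L2_diffuseE[OF X S])
    show "finite (\<phi> ` I \<union> (\<lambda>b. slice_coeff Y (\<psi> j) (b \<circ> prod.swap)) ` B)"
      using B I by simp
    show "\<phi> ` I \<union> (\<lambda>b. slice_coeff Y (\<psi> j) (b \<circ> prod.swap)) ` B \<subseteq> L2_space X"
      using B(2) by (auto intro!: \<phi>L S.slice_coeff_L2_bound(1) swap_L2 \<psi>L j)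
  qed (rule that)
  show "\<exists>f\<in>L2_space XY. L2_eq XY (T f) (\<lambda>z. complex_of_real (p j (fst z)) * f z) \<and>
      (\<forall>z. fst z \<notin> S \<longrightarrow> f z = 0) \<and> \<not> L2_eq XY f (\<lambda>x. 0) \<and> (\<forall>b\<in>B. L2_inner XY f b = 0)"
  proof (intro bexI[of _ "tensor g (\<psi> j)"] conjI allI impI ballI)
    show "L2_eq XY (T (tensor g (\<psi> j))) (\<lambda>z. pc j (fst z) * tensor g (\<psi> j) z)"
      using orth by (simp add: T_tensor_right j L2_eq_refl)
    show "tensor g (\<psi> j) z = 0" if "fst z \<notin> S" for z
      using g(2) that by (simp add: tensor_def)
    show "\<not> L2_eq XY (tensor g (\<psi> j)) (\<lambda>x. 0)"
      by (rule tensor_not_null[OF g(1) \<psi>L[OF j] g(3) unit_not_null[OF \<psi> j]])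
    show "L2_inner XY (tensor g (\<psi> j)) b = 0" if b: "b \<in> B" for b
    proof -
      have bL: "b \<in> L2_space XY"
        using b B by auto
      have "L2_inner XY (tensor g (\<psi> j)) b = L2_inner S.XY (tensor (\<psi> j) g) (b \<circ> prod.swap)"
        using swap_inner[OF tensor_L2[OF g(1) \<psi>L[OF j]] bL] by (simp add: tensor_swap)
      also have "\<dots> = L2_inner X g (slice_coeff Y (\<psi> j) (b \<circ> prod.swap))"
        by (intro S.tensor_inner swap_L2 bL \<psi>L j g)
      also have "\<dots> = 0"
        using orth b by blast
      finally show ?thesis .
    qed
    show "tensor g (\<psi> j) \<in> L2_space XY"
      by (intro tensor_L2 \<psi>L j g)
  qed
qed

lemma zero_in_essential_spectrum:
  assumes X: "L2_diffuse X" "0 < emeasure X (space X)" and Y: "L2_diffuse Y" "0 < emeasure Y (space Y)"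
  shows "0 \<in> L2_essential_spectrum XY T"
proof (rule infinite_dim_eigenspace_in_essential_spectrum)
  fix B assume B: "finite B" "B \<subseteq> L2_space XY"
  obtain u where u: "u \<in> L2_space X" "\<And>x. x \<notin> space X \<Longrightarrow> u x = 0" "\<not> L2_eq X u (\<lambda>x. 0)"
    "\<And>w. w \<in> \<phi> ` I \<Longrightarrow> L2_inner X u w = 0"
  proof (rule L2_diffuseE[OF X(1) sets.top X(2)])
    show "finite (\<phi> ` I)" "\<phi> ` I \<subseteq> L2_space X"
      using I \<phi>L by auto
  qed (rule that)
  obtain v where v: "v \<in> L2_space Y" "\<And>y. y \<notin> space Y \<Longrightarrow> v y = 0" "\<not> L2_eq Y v (\<lambda>x. 0)"
    and orth: "\<And>w. w \<in> \<psi> ` J \<union> slice_coeff X u ` B \<Longrightarrow> L2_inner Y v w = 0"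
  proof (rule L2_diffuseE[OF Y(1) sets.top Y(2)])
    show "finite (\<psi> ` J \<union> slice_coeff X u ` B)"
      using B J by simp
    show "\<psi> ` J \<union> slice_coeff X u ` B \<subseteq> L2_space Y"
      using B(2) by (auto intro!: \<psi>L slice_coeff_L2_bound(1) u(1))
  qed (rule that)
  show "\<exists>f\<in>L2_space XY. L2_eq XY (T f) (\<lambda>x. 0 * f x) \<and> \<not> L2_eq XY f (\<lambda>x. 0) \<and>
      (\<forall>b\<in>B. L2_inner XY f b = 0)"
  proof (intro bexI[of _ "tensor u v"] conjI ballI)
    show "L2_eq XY (T (tensor u v)) (\<lambda>x. 0 * tensor u v x)"
      using orth u(4) by (simp add: T_tensor_orthogonal L2_eq_refl)
    show "\<not> L2_eq XY (tensor u v) (\<lambda>x. 0)"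
      by (rule tensor_not_null[OF u(1) v(1) u(3) v(3)])
    show "L2_inner XY (tensor u v) b = 0" if "b \<in> B" for b
      using tensor_inner[of b u v] that B u(1) v(1) orth by auto
    show "tensor u v \<in> L2_space XY"
      by (intro tensor_L2 u(1) v(1))
  qed
qed

theorem essential_spectrum_eq:
  assumes "L2_diffuse X" "0 < emeasure X (space X)" "L2_diffuse Y" "0 < emeasure Y (space Y)"
  shows "L2_essential_spectrum XY T =
    complex_of_real ` ({0} \<union> (\<Union>k\<in>I. Essran Y (h k)) \<union> (\<Union>j\<in>J. Essran X (p j)))"
proof
  show "complex_of_real ` ({0} \<union> (\<Union>k\<in>I. Essran Y (h k)) \<union> (\<Union>j\<in>J. Essran X (p j)))
      \<subseteq> L2_essential_spectrum XY T"
    using zero_in_essential_spectrum[OF assms] Essran_h_subset[OF assms(3)] Essran_p_subset[OF assms(1)]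
    by (simp add: image_Un image_UN UN_subset_iff)
qed (rule essential_spectrum_subset)

end

section \<open>Lebesgue measure on a rectangle\<close>

context finite_measure_pair
begin

text \<open>The integral of the sum splits for those \<open>y\<close> for which all slice coefficients are given by
  convergent integrals, hence for almost all \<open>y\<close>.\<close>

lemma integral_kernel_eq_fibre_op:
  assumes I: "finite I" and \<phi>: "\<And>k. k \<in> I \<Longrightarrow> \<phi> k \<in> L2_space X" and f: "f \<in> L2_space XY"
  shows "L2_eq XY (\<lambda>(x, y). LINT s|X. (\<Sum>k\<in>I. \<phi> k x * cnj (\<phi> k s) * q k y) * f (s, y)) (fibre_op X I \<phi> q f)"
proof -
  have "AE y in Y. \<forall>k\<in>I. integrable X (\<lambda>s. f (s, y) * cnj (\<phi> k s))"
    using I slice_integrable(1)[OF f \<phi>] by (simp add: AE_finite_all)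
  from AE_snd_XY[OF this] show ?thesis
    unfolding L2_eq_def
  proof eventually_elim
    case (elim z)
    obtain x y where z: "z = (x, y)" by (cases z)
    have "(LINT s|X. (\<Sum>k\<in>I. \<phi> k x * cnj (\<phi> k s) * q k y) * f (s, y)) =
        (LINT s|X. (\<Sum>k\<in>I. (\<phi> k x * q k y) * (f (s, y) * cnj (\<phi> k s))))"
      by (simp add: sum_distrib_left mult_ac)
    also have "\<dots> = (\<Sum>k\<in>I. LINT s|X. (\<phi> k x * q k y) * (f (s, y) * cnj (\<phi> k s)))"
      using elim by (intro Bochner_Integration.integral_sum) (auto simp: z)
    also have "\<dots> = (\<Sum>k\<in>I. (\<phi> k x * q k y) * slice_coeff X (\<phi> k) f y)"
      by (simp add: slice_coeff_def)
    finally show ?case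
      by (simp add: z fibre_op_def tensor_def mult.assoc)
  qed
qed

lemma L2_space_if_eq:
  assumes "L2_eq XY f g" "g \<in> L2_space XY"
  shows "f \<in> L2_space XY"
proof (rule L2_eq_imp_space[OF assms])
  show "f \<in> borel_measurable XY"
    using borel_measurable_completion_if_AE[OF L2_spaceD(1)[OF assms(2)]] assms(1)
    by (simp add: L2_eq_def AE_completion_iff)
qed

end

lemma completion_restrict_space:
  assumes A: "A \<in> sets M"
  shows "completion (restrict_space M A) = restrict_space (completion M) A"
proof (rule measure_eqI)
  have R: "S \<in> sets (restrict_space M A) \<longleftrightarrow> S \<in> sets M \<and> S \<subseteq> A" for S
    using A by (auto simp: sets_restrict_space_iff)
  have C: "S \<in> sets (restrict_space (completion M) A) \<longleftrightarrow> S \<in> sets (completion M) \<and> S \<subseteq> A" for S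
    using A by (auto simp: sets_restrict_space_iff)
  show "sets (completion (restrict_space M A)) = sets (restrict_space (completion M) A)"
  proof (intro subset_antisym subsetI)
    fix S assume "S \<in> sets (completion (restrict_space M A))"
    then obtain S0 N N' where "S = S0 \<union> N" "N \<subseteq> N'" "N' \<in> null_sets (restrict_space M A)"
      "S0 \<in> sets (restrict_space M A)"
      by (rule sets_completionE)
    then show "S \<in> sets (restrict_space (completion M) A)"
      unfolding C R null_sets_restrict_space[OF A] by (auto intro: sets_completionI)
  next
    fix S assume "S \<in> sets (restrict_space (completion M) A)"
    then have S: "S \<in> sets (completion M)" "S \<subseteq> A"
      by (auto simp: C)
    from S(1) obtain S0 N N' where *: "S = S0 \<union> N" "N \<subseteq> N'" "N' \<in> null_sets M" "S0 \<in> sets M"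
      by (rule sets_completionE)
    show "S \<in> sets (completion (restrict_space M A))"
    proof (rule sets_completionI)
      show "S = S0 \<union> N" "N \<subseteq> N' \<inter> A" "S0 \<in> sets (restrict_space M A)"
        using * S(2) by (auto simp: R)
      show "N' \<inter> A \<in> null_sets (restrict_space M A)"
        using *(3) A by (simp add: null_sets_restrict_space null_set_Int2)
    qed
  qed
  fix S assume "S \<in> sets (completion (restrict_space M A))"
  then obtain S0 N N' where *: "S = S0 \<union> N" "N \<subseteq> N'" "N' \<in> null_sets (restrict_space M A)"
    "S0 \<in> sets (restrict_space M A)"
    by (rule sets_completionE)
  have N: "N \<in> null_sets (completion (restrict_space M A))" "N \<in> null_sets (completion M)"
    using * by (auto simp: null_sets_completion_iff2 null_sets_restrict_space[OF A])
  have S0: "S0 \<in> sets M" "S0 \<subseteq> A"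
    using *(4) by (auto simp: R)
  have NA: "N \<subseteq> A"
    using * by (auto simp: null_sets_restrict_space[OF A])
  have "emeasure (completion (restrict_space M A)) S = emeasure (completion (restrict_space M A)) S0"
    unfolding *(1) by (intro emeasure_Un_null_set N sets_completionI_sets *(4))
  also have "\<dots> = emeasure M S0"
    using *(4) S0 A by (simp add: emeasure_restrict_space)
  also have "\<dots> = emeasure (completion M) (S0 \<union> N)"
    using S0 N(2) by (subst emeasure_Un_null_set) auto
  also have "\<dots> = emeasure (restrict_space (completion M) A) S"
    unfolding *(1) using A S0 NA by (subst emeasure_restrict_space) auto
  finally show "emeasure (completion (restrict_space M A)) S = emeasure (restrict_space (completion M) A) S" .
qed

lemma pair_restrict_space:
  assumes M: "sigma_finite_measure (restrict_space M A)" "A \<in> sets M"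
    and N: "sigma_finite_measure N" "sigma_finite_measure (restrict_space N B)" "B \<in> sets N"
  shows "restrict_space M A \<Otimes>\<^sub>M restrict_space N B = restrict_space (M \<Otimes>\<^sub>M N) (A \<times> B)"
proof (rule pair_measure_eqI[OF M(1) N(2)])
  interpret N: sigma_finite_measure N by fact
  have AB: "A \<times> B \<in> sets (M \<Otimes>\<^sub>M N)"
    using M N by auto
  have RA: "S \<in> sets (restrict_space M A) \<longleftrightarrow> S \<in> sets M \<and> S \<subseteq> A" for S
    using M by (auto simp: sets_restrict_space_iff)
  have RB: "S \<in> sets (restrict_space N B) \<longleftrightarrow> S \<in> sets N \<and> S \<subseteq> B" for S
    using N by (auto simp: sets_restrict_space_iff)
  have RAB: "S \<in> sets (restrict_space (M \<Otimes>\<^sub>M N) (A \<times> B)) \<longleftrightarrow> S \<in> sets (M \<Otimes>\<^sub>M N) \<and> S \<subseteq> A \<times> B" for S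
    using AB by (auto simp: sets_restrict_space_iff)
  have sp: "space (restrict_space M A) = A" "space (restrict_space N B) = B"
    using M N sets.sets_into_space by (auto simp: space_restrict_space)
  show "sets (restrict_space M A \<Otimes>\<^sub>M restrict_space N B) = sets (restrict_space (M \<Otimes>\<^sub>M N) (A \<times> B))"
  proof (intro subset_antisym)
    have "{S \<times> T |S T. S \<in> sets (restrict_space M A) \<and> T \<in> sets (restrict_space N B)}
        \<subseteq> sets (restrict_space (M \<Otimes>\<^sub>M N) (A \<times> B))"
      by (auto simp: RA RB RAB)
    moreover have "space (restrict_space (M \<Otimes>\<^sub>M N) (A \<times> B)) = A \<times> B"
      using sets.sets_into_space[OF AB] by (auto simp: space_restrict_space)
    ultimately show "sets (restrict_space M A \<Otimes>\<^sub>M restrict_space N B) \<subseteq> sets (restrict_space (M \<Otimes>\<^sub>M N) (A \<times> B))"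
      unfolding sets_pair_measure sp
      using sets.sigma_sets_subset[of _ "restrict_space (M \<Otimes>\<^sub>M N) (A \<times> B)"] by simp
    show "sets (restrict_space (M \<Otimes>\<^sub>M N) (A \<times> B)) \<subseteq> sets (restrict_space M A \<Otimes>\<^sub>M restrict_space N B)"
    proof
      fix S assume S: "S \<in> sets (restrict_space (M \<Otimes>\<^sub>M N) (A \<times> B))"
      have "(\<lambda>z. (fst z, snd z)) \<in> restrict_space M A \<Otimes>\<^sub>M restrict_space N B \<rightarrow>\<^sub>M M \<Otimes>\<^sub>M N"
        by (intro measurable_Pair
            measurable_compose[OF measurable_fst measurable_restrict_space1[OF measurable_ident_sets[OF refl]]]
            measurable_compose[OF measurable_snd measurable_restrict_space1[OF measurable_ident_sets[OF refl]]])
      then have "(\<lambda>z. (fst z, snd z)) -` S \<inter> space (restrict_space M A \<Otimes>\<^sub>M restrict_space N B)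
          \<in> sets (restrict_space M A \<Otimes>\<^sub>M restrict_space N B)"
        using S by (intro measurable_sets) (auto simp: RAB)
      also have "(\<lambda>z. (fst z, snd z)) -` S \<inter> space (restrict_space M A \<Otimes>\<^sub>M restrict_space N B) = S"
        using S by (auto simp: RAB space_pair_measure sp)
      finally show "S \<in> sets (restrict_space M A \<Otimes>\<^sub>M restrict_space N B)" .
    qed
  qed
  fix S T assume "S \<in> sets (restrict_space M A)" "T \<in> sets (restrict_space N B)"
  then have ST: "S \<in> sets M" "S \<subseteq> A" "T \<in> sets N" "T \<subseteq> B"
    by (auto simp: RA RB)
  then have "S \<times> T \<subseteq> A \<times> B" by auto
  then have "emeasure (restrict_space (M \<Otimes>\<^sub>M N) (A \<times> B)) (S \<times> T) = emeasure (M \<Otimes>\<^sub>M N) (S \<times> T)"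
    using AB by (intro emeasure_restrict_space) auto
  also have "\<dots> = emeasure M S * emeasure N T"
    using ST by (intro N.emeasure_pair_measure_Times)
  also have "\<dots> = emeasure (restrict_space M A) S * emeasure (restrict_space N B) T"
    using ST M N by (simp add: emeasure_restrict_space)
  finally show "emeasure (restrict_space M A) S * emeasure (restrict_space N B) T =
      emeasure (restrict_space (M \<Otimes>\<^sub>M N) (A \<times> B)) (S \<times> T)" ..
qed

lemma finite_measure_restrict_lborel: "finite_measure (restrict_space lborel {a..b::real})"
  by (rule finite_measureI) (simp add: emeasure_restrict_space space_restrict_space emeasure_lborel_Icc_eq)

lemma lebesgue_on_rectangle:
  fixes a b c d :: real
  shows "lebesgue_on ({a..b} \<times> {c..d}) =
    completion (restrict_space lborel {a..b} \<Otimes>\<^sub>M restrict_space lborel {c..d})"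
proof -
  have "restrict_space lborel {a..b} \<Otimes>\<^sub>M restrict_space lborel {c..d} =
      restrict_space (lborel \<Otimes>\<^sub>M lborel) ({a..b} \<times> {c..d})"
    by (rule pair_restrict_space)
      (auto intro: sigma_finite_lborel finite_measure.axioms(1) finite_measure_restrict_lborel)
  then show ?thesis
    by (subst completion_restrict_space[symmetric]) (auto simp: lborel_prod borel_closed closed_Times)
qed

text \<open>The polynomials of degree at most \<open>card W\<close>, cut off outside \<open>S\<close>, have more coefficients than there
  are orthogonality conditions. A nonzero polynomial vanishes at finitely many points only.\<close>

lemma L2_diffuse_lebesgue_on:
  fixes a b :: real
  shows "L2_diffuse (lebesgue_on {a..b})"
  unfolding L2_diffuse_def
proof (intro ballI impI allI)
  let ?M = "lebesgue_on {a..b}"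
  fix S W assume S: "S \<in> sets ?M" "0 < emeasure ?M S" and W: "finite W" "W \<subseteq> L2_space ?M"
  interpret finite_measure ?M
    by (rule finite_measureI) (simp add: emeasure_restrict_space space_restrict_space emeasure_lborel_Icc_eq)
  define e where "e = (\<lambda>i x. indicator S x * complex_of_real x ^ i * 1)"
  have e: "e i \<in> L2_space ?M" for i
    unfolding e_def
  proof (rule L2_space_bounded_mult)
    show "(\<lambda>x. 1) \<in> L2_space ?M"
      by (simp add: L2_space_def)
    have "(\<lambda>x. complex_of_real x ^ i) \<in> borel_measurable ?M"
      by (intro measurable_restrict_space1 measurable_completion) measurable
    then show "(\<lambda>x. indicator S x * complex_of_real x ^ i) \<in> borel_measurable ?M"
      using S(1) by measurable
    have "cmod (indicator S x * complex_of_real x ^ i) \<le> max \<bar>a\<bar> \<bar>b\<bar> ^ i" if "x \<in> {a..b}" for x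
    proof -
      have "\<bar>x\<bar> ^ i \<le> max \<bar>a\<bar> \<bar>b\<bar> ^ i"
        using that by (intro power_mono) auto
      then show ?thesis
        by (auto simp: indicator_def norm_power intro: order_trans[of _ "\<bar>x\<bar> ^ i"])
    qed
    then show "AE x in ?M. cmod (indicator S x * complex_of_real x ^ i) \<le> max \<bar>a\<bar> \<bar>b\<bar> ^ i"
      by (intro AE_I2) (simp add: space_restrict_space)
  qed
  obtain c where c: "\<exists>i\<in>{..card W}. c i \<noteq> 0" "\<forall>w\<in>W. (\<Sum>i\<le>card W. c i * L2_inner ?M (e i) w) = 0"
    using underdetermined_system_nontrivial_solution[OF W(1), of "{..card W}" "\<lambda>i w. L2_inner ?M (e i) w"]
    by auto
  define g where "g = (\<lambda>x. \<Sum>i\<le>card W. c i * e i x)"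
  have g_eq: "g x = indicator S x * (\<Sum>i\<le>card W. c i * complex_of_real x ^ i)" for x
    by (simp add: g_def e_def sum_distrib_left mult_ac)
  show "\<exists>g\<in>L2_space ?M. (\<forall>x. x \<notin> S \<longrightarrow> g x = 0) \<and> \<not> L2_eq ?M g (\<lambda>x. 0) \<and> (\<forall>w\<in>W. L2_inner ?M g w = 0)"
  proof (intro bexI[of _ g] conjI allI impI ballI)
    show "g \<in> L2_space ?M"
      unfolding g_def by (intro L2_space_sum L2_space_scale e)
    show "g x = 0" if "x \<notin> S" for x
      using that by (simp add: g_eq)
    show "L2_inner ?M g w = 0" if "w \<in> W" for w
      unfolding g_def using c(2) W(2) e that by (subst L2_inner_lincomb_left) auto
    show "\<not> L2_eq ?M g (\<lambda>x. 0)"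
    proof
      assume "L2_eq ?M g (\<lambda>x. 0)"
      then have ae: "AE x in ?M. g x = 0"
        by (simp add: L2_eq_def)
      define Z where "Z = {x. (\<Sum>i\<le>card W. c i * complex_of_real x ^ i) = 0}"
      have "finite {z. (\<Sum>i\<le>card W. c i * z ^ i) = 0}"
        using c(1) by (subst polyfun_finite_roots) auto
      then have "finite (complex_of_real -` {z. (\<Sum>i\<le>card W. c i * z ^ i) = 0})"
        by (rule finite_vimageI) (simp add: inj_on_def)
      then have "finite Z"
        by (simp add: Z_def)
      then have "Z \<in> null_sets lebesgue"
        by (intro null_sets_completionI finite_imp_null_set_lborel)
      then have "Z \<inter> {a..b} \<in> null_sets ?M"
        by (subst null_sets_restrict_space) (auto intro: null_sets_completion_subset)
      then have "AE x in ?M. x \<notin> Z"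
        by (rule AE_I') (auto simp: space_restrict_space)
      with ae have "AE x in ?M. x \<notin> S"
        by eventually_elim (auto simp: g_eq Z_def indicator_def split: if_splits)
      then have "S \<in> null_sets ?M"
        using S(1) by (simp add: AE_iff_null_sets[symmetric])
      then show False
        using S(2) by (simp add: null_sets_def)
    qed
  qed
qed

theorem theorem5p6:
  fixes a b c d :: real and n m :: nat
    and \<phi> \<psi> :: "nat \<Rightarrow> real \<Rightarrow> complex"
    and h p :: "nat \<Rightarrow> real \<Rightarrow> real"
  assumes "a < b" and "c < d" and "0 < n" and "0 < m"
    and "L2_orthonormal (lebesgue_on {a..b}) {1..n} \<phi>"
    and "\<And>k. k \<in> {1..n} \<Longrightarrow> ess_bounded_measurable (lebesgue_on {c..d}) (h k)"
    and "L2_orthonormal (lebesgue_on {c..d}) {1..m} \<psi>"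
    and "\<And>j. j \<in> {1..m} \<Longrightarrow> ess_bounded_measurable (lebesgue_on {a..b}) (p j)"
  shows "L2_essential_spectrum (lebesgue_on ({a..b} \<times> {c..d}))
           (\<lambda>f z. partial_int_op1 a b n \<phi> h f z + partial_int_op2 c d m p \<psi> f z) =
         complex_of_real `
           ({0} \<union> (\<Union>i\<in>{1..n}. Essran (lebesgue_on {c..d}) (h i))
                \<union> (\<Union>j\<in>{1..m}. Essran (lebesgue_on {a..b}) (p j)))"
proof -
  define M1 where "M1 = restrict_space lborel {a..b}"
  define M2 where "M2 = restrict_space lborel {c..d}"
  have X: "lebesgue_on {a..b} = completion M1" and Y: "lebesgue_on {c..d} = completion M2"
    by (simp_all add: M1_def M2_def completion_restrict_space)
  have XY: "lebesgue_on ({a..b} \<times> {c..d}) = completion (M1 \<Otimes>\<^sub>M M2)"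
    by (simp add: M1_def M2_def lebesgue_on_rectangle)
  interpret finite_measure_pair M1 M2
    unfolding finite_measure_pair_def M1_def M2_def by (simp add: finite_measure_restrict_lborel)
  interpret S: finite_measure_pair M2 M1
    by (rule swapped)
  interpret two_fibre_ops M1 M2 "{1..n}" "{1..m}" \<phi> h \<psi> p
    by unfold_locales (use assms in \<open>simp_all add: X Y\<close>)
  have pos: "0 < emeasure (completion M1) (space (completion M1))"
    "0 < emeasure (completion M2) (space (completion M2))"
    unfolding X[symmetric] Y[symmetric]
    using assms(1,2) by (simp_all add: emeasure_restrict_space space_restrict_space)
  have "L2_essential_spectrum (completion (M1 \<Otimes>\<^sub>M M2))
      (\<lambda>f z. partial_int_op1 a b n \<phi> h f z + partial_int_op2 c d m p \<psi> f z) =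
    L2_essential_spectrum (completion (M1 \<Otimes>\<^sub>M M2)) T"
  proof (rule L2_essential_spectrum_cong)
    fix f :: "real \<times> real \<Rightarrow> complex" assume f: "f \<in> L2_space (completion (M1 \<Otimes>\<^sub>M M2))"
    have "L2_eq (completion (M1 \<Otimes>\<^sub>M M2)) (partial_int_op1 a b n \<phi> h f) (T1 f)"
      unfolding partial_int_op1_def T1_def X
      by (rule integral_kernel_eq_fibre_op) (use \<phi>L f in auto)
    moreover have "L2_eq (completion (M1 \<Otimes>\<^sub>M M2)) (partial_int_op2 c d m p \<psi> f) (T2 f)"
    proof -
      have "partial_int_op2 c d m p \<psi> f =
        (\<lambda>(y, x). LINT t|completion M2. (\<Sum>j = 1..m. \<psi> j y * cnj (\<psi> j t) * complex_of_real (p j x)) *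
          (f \<circ> prod.swap) (t, x)) \<circ> prod.swap"
        by (simp add: partial_int_op2_def Y fun_eq_iff mult_ac)
      moreover have "L2_eq (completion (M2 \<Otimes>\<^sub>M M1))
        (\<lambda>(y, x). LINT t|completion M2. (\<Sum>j = 1..m. \<psi> j y * cnj (\<psi> j t) * complex_of_real (p j x)) *
          (f \<circ> prod.swap) (t, x))
        (fibre_op (completion M2) {1..m} \<psi> (\<lambda>j x. complex_of_real (p j x)) (f \<circ> prod.swap))"
        by (rule S.integral_kernel_eq_fibre_op) (simp, erule \<psi>L, rule swap_L2[OF f])
      ultimately show ?thesis
        unfolding T2_def by (simp only: S.swap_eq)
    qed
    ultimately show eq: "L2_eq (completion (M1 \<Otimes>\<^sub>M M2))
        (\<lambda>z. partial_int_op1 a b n \<phi> h f z + partial_int_op2 c d m p \<psi> f z) (T f)"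
      unfolding T_def by (rule L2_eq_add)
    show Tf: "T f \<in> L2_space (completion (M1 \<Otimes>\<^sub>M M2))"
      by (rule L2_op_space[OF T_op f])
    show "(\<lambda>z. partial_int_op1 a b n \<phi> h f z + partial_int_op2 c d m p \<psi> f z)
        \<in> L2_space (completion (M1 \<Otimes>\<^sub>M M2))"
      by (rule L2_space_if_eq[OF eq Tf])
  qed
  also have "\<dots> = complex_of_real `
      ({0} \<union> (\<Union>k\<in>{1..n}. Essran (completion M2) (h k)) \<union> (\<Union>j\<in>{1..m}. Essran (completion M1) (p j)))"
    by (intro essential_spectrum_eq pos L2_diffuse_lebesgue_on[of a b, unfolded X] L2_diffuse_lebesgue_on[of c d, unfolded Y])
  finally show ?thesis
    by (simp only: X Y XY)
qed

end
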